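(* Let $\eta:\mathcal{C}\to\mathbb{I}$ be a dependence measure which is continuous with respect to weak conditional convergence. Let $\psi,\psi_1,\psi_2,\ldots\in\Psi$, $A,A_1,A_2,\ldots\in\mathcal{A}\setminus\{A_M\}$, and let $C_{\psi,A},C_{\psi_1,A_1},C_{\psi_2,A_2},\ldots$ be the corresponding Archimax copulas. Then the following two implications hold: (i) If $(\psi_n)_{1-\tau_{A_n}}\to(\psi)_{1-\tau_A}$ pointwise on $[0,\infty)$ and $(A_n)_{1-\tau_{A_n}}\to(A)_{1-\tau_A}$ pointwise on $\mathbb{I}$ as $n\to\infty$, then $\eta(C_{\psi_n,A_n})\to\eta(C_{\psi,A})$. (ii) If $C_{\psi_n,A_n}\to C_{\psi,A}$ uniformly on $\mathbb{I}^2$, then $\eta(C_{\psi_n,A_n})\to\eta(C_{\psi,A})$.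
   Context: Write $\mathbb{I}=[0,1]$, $\lambda$ for Lebesgue measure, $\mathcal{C}$ for the set of bivariate copulas, $\Pi(x,y)=xy$. For a copula $C$ and $(X,Y)\sim C$, $K_C(x,E)$ denotes (a version of) the regular conditional distribution (Markov kernel) of $Y$ given $X=x$. $(C_n)$ converges weakly conditional to $C$ if there is a Borel set $\Lambda\subseteq\mathbb{I}$ with $\lambda(\Lambda)=1$ such that for every $x\in\Lambda$ the measures $K_{C_n}(x,\cdot)$ converge weakly to $K_C(x,\cdot)$. A dependence measure is a map $\eta:\mathcal{C}\to\mathbb{I}$ with $\eta(C)=0$ iff $C=\Pi$, and $\eta(C)=1$ iff $C$ is completely dependent (i.e. there is a $\lambda$-preserving $g:\mathbb{I}\to\mathbb{I}$ with $Y=g(X)$ a.s. for $(X,Y)\sim C$); it is continuous with respect to weak conditional convergence if $\eta(C_n)\to\eta(C)$ whenever $C_n\to C$ weakly conditional. $\Psi$ denotes the set of convex normalized (Archimedean) generators: continuous, non-increasing, convex $\psi:[0,\infty)\to\mathbb{I}$ with $\psi(0)=1$, $\lim_{z\to\infty}\psi(z)=0$, $\psi$ strictly decreasing on $[0,\inf\{x:\psi(x)=0\})$ (with $\inf\emptyset=\infty$), and $\psi(1)=\frac12$. The pseudo-inverse of $\psi$ is $\varphi:\mathbb{I}\to[0,\infty]$, $\varphi(y)=\inf\{z\in[0,\infty]:\psi(z)=y\}$ (with $\psi(\infty)=0$). $\mathcal{A}$ denotes the set of Pickands dependence functions, i.e. convex $A:\mathbb{I}\to\mathbb{I}$ with $\max\{1-x,x\}\le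 A(x)\le1$; $A_M(t)=\max\{t,1-t\}$. The extreme-value copula of $A$ is $C_A(x,y)=(xy)^{A(\log x/\log(xy))}$ on $(0,1)^2$, extended continuously to $\mathbb{I}^2$; $\tau_A:=\tau(C_A)$ is its Kendall's $\tau$, $\tau(C)=4\int_{\mathbb{I}^2}C\,d\mu_C-1$; $\tau_A<1$ if $A\ne A_M$. The Archimax copula is $C_{\psi,A}(x,y)=\psi\big((\varphi(x)+\varphi(y))A\big(\frac{\varphi(x)}{\varphi(x)+\varphi(y)}\big)\big)$ on $(0,1)^2$, extended continuously to a copula on $\mathbb{I}^2$. For $\alpha\in(0,\infty)$: $(\psi)_\alpha(z):=\psi(z^\alpha)$ for $z\in[0,\infty)$ and $(A)_\alpha(t):=(t^\alpha+(1-t)^\alpha)^{1/\alpha}\Big[A\Big(\frac{t^\alpha}{t^\alpha+(1-t)^\alpha}\Big)\Big]^{1/\alpha}$ for $t\in\mathbb{I}$. *)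

theory Defs
  imports "HOL-Probability.Probability"
begin

text \<open>
  A function on a proper subset \<open>S\<close> of a type is represented by the unique
  function on the whole type that agrees with it on \<open>S\<close> and is
  \<^term>\<open>undefined\<close> elsewhere (\<^const>\<open>PiE\<close>, \<^const>\<open>extensional\<close>), so that equality
  of copulas, generators and Pickands functions is equality of functions on \<open>S\<close>.
\<close>

section \<open>Copulas\<close>

abbreviation unit_square :: "(real \<times> real) set" where
  "unit_square \<equiv> {0..1} \<times> {0..1}"

abbreviation open_unit_square :: "(real \<times> real) set" where
  "open_unit_square \<equiv> {0<..<1} \<times> {0<..<1}"

definition copulas :: "(real \<times> real \<Rightarrow> real) set" where
  "copulas = {C \<in> unit_square \<rightarrow>\<^sub>E {0..1}.
     (\<forall>x\<in>{0..1}. C (x, 0) = 0 \<and> C (0, x) = 0 \<and> C (x, 1) = x \<and> C (1, x) = x) \<and>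
     (\<forall>x\<^sub>1\<in>{0..1}. \<forall>x\<^sub>2\<in>{0..1}. \<forall>y\<^sub>1\<in>{0..1}. \<forall>y\<^sub>2\<in>{0..1}. x\<^sub>1 \<le> x\<^sub>2 \<longrightarrow> y\<^sub>1 \<le> y\<^sub>2 \<longrightarrow>
        0 \<le> C (x\<^sub>2, y\<^sub>2) - C (x\<^sub>2, y\<^sub>1) - C (x\<^sub>1, y\<^sub>2) + C (x\<^sub>1, y\<^sub>1))}"

definition product_copula :: "real \<times> real \<Rightarrow> real" where
  "product_copula = (\<lambda>(x, y)\<in>unit_square. x * y)"

text \<open>
  The law of \<open>(X, Y)\<close> under the copula \<open>C\<close>, as a Borel measure on the plane which
  is concentrated on the unit square. It is the canonical model of \<open>(X, Y) \<sim> C\<close>,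
  with \<open>X = fst\<close> and \<open>Y = snd\<close>.
\<close>
definition copula_measure :: "(real \<times> real \<Rightarrow> real) \<Rightarrow> (real \<times> real) measure" where
  "copula_measure C = (THE M. prob_space M \<and> sets M = sets borel \<and>
     (\<forall>x\<in>{0..1}. \<forall>y\<in>{0..1}. measure M ({0..x} \<times> {0..y}) = C (x, y)))"

definition kendall_tau :: "(real \<times> real \<Rightarrow> real) \<Rightarrow> real" where
  "kendall_tau C = 4 * (LINT p:unit_square|copula_measure C. C p) - 1"


section \<open>Weak conditional convergence\<close>

text \<open>
  \<open>K\<close> is a version of the regular conditional distribution of \<open>Y\<close> given \<open>X = x\<close>;
  the law of \<open>X\<close> is Lebesgue measure on the unit interval. The measures \<open>K x\<close> live
  on the Borel sets of the whole line, so that the library notion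
  \<^const>\<open>weak_conv_m\<close> of weak convergence applies.
\<close>
definition is_markov_kernel_of ::
    "(real \<times> real \<Rightarrow> real) \<Rightarrow> (real \<Rightarrow> real measure) \<Rightarrow> bool" where
  "is_markov_kernel_of C K \<longleftrightarrow>
     K \<in> restrict_space borel {0..1} \<rightarrow>\<^sub>M prob_algebra borel \<and>
     (\<forall>x\<in>{0..1}. measure (K x) {0..1} = 1) \<and>
     (\<forall>E\<in>sets borel. \<forall>F\<in>sets borel. E \<subseteq> {0..1} \<longrightarrow>
        emeasure (copula_measure C) (E \<times> F) = (\<integral>\<^sup>+x\<in>E. emeasure (K x) F \<partial>lborel))"

text \<open>
  Any two versions of a Markov kernel agree for almost every \<open>x\<close>, and only countably
  many kernels are involved, so the choice of versions is immaterial.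
\<close>
definition weak_cond_conv ::
    "(nat \<Rightarrow> real \<times> real \<Rightarrow> real) \<Rightarrow> (real \<times> real \<Rightarrow> real) \<Rightarrow> bool" where
  "weak_cond_conv Cs C \<longleftrightarrow>
     (\<exists>Ks K. (\<forall>n. is_markov_kernel_of (Cs n) (Ks n)) \<and> is_markov_kernel_of C K \<and>
        (\<exists>\<Lambda>\<in>sets borel. \<Lambda> \<subseteq> {0..1} \<and> emeasure lborel \<Lambda> = 1 \<and>
           (\<forall>x\<in>\<Lambda>. weak_conv_m (\<lambda>n. Ks n x) (K x))))"


section \<open>Dependence measures\<close>

definition completely_dependent :: "(real \<times> real \<Rightarrow> real) \<Rightarrow> bool" where
  "completely_dependent C \<longleftrightarrow>
     (\<exists>g. g \<in> restrict_space lborel {0..1} \<rightarrow>\<^sub>M restrict_space lborel {0..1} \<and>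
          distr (restrict_space lborel {0..1}) (restrict_space lborel {0..1}) g
            = restrict_space lborel {0..1} \<and>
          (AE p in copula_measure C. snd p = g (fst p)))"

definition dependence_measure :: "((real \<times> real \<Rightarrow> real) \<Rightarrow> real) \<Rightarrow> bool" where
  "dependence_measure \<eta> \<longleftrightarrow>
     \<eta> \<in> copulas \<rightarrow> {0..1} \<and>
     (\<forall>C\<in>copulas. \<eta> C = 0 \<longleftrightarrow> C = product_copula) \<and>
     (\<forall>C\<in>copulas. \<eta> C = 1 \<longleftrightarrow> completely_dependent C)"

definition weak_cond_continuous :: "((real \<times> real \<Rightarrow> real) \<Rightarrow> real) \<Rightarrow> bool" where
  "weak_cond_continuous \<eta> \<longleftrightarrow>
     (\<forall>Cs C. (\<forall>n. Cs n \<in> copulas) \<longrightarrow> C \<in> copulas \<longrightarrow> weak_cond_conv Cs C \<longrightarrow>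
        (\<lambda>n. \<eta> (Cs n)) \<longlonglongrightarrow> \<eta> C)"


section \<open>Generators, Pickands functions and Archimax copulas\<close>

definition generators :: "(real \<Rightarrow> real) set" where
  "generators = {\<psi> \<in> {0..} \<rightarrow>\<^sub>E {0..1}.
     continuous_on {0..} \<psi> \<and> antimono_on {0..} \<psi> \<and> convex_on {0..} \<psi> \<and>
     \<psi> 0 = 1 \<and> (\<psi> \<longlongrightarrow> 0) at_top \<and>
     strict_antimono_on {z. 0 \<le> z \<and> ennreal z < Inf (ennreal ` {x. 0 \<le> x \<and> \<psi> x = 0})} \<psi> \<and>
     \<psi> 1 = 1 / 2}"

definition pseudo_inverse :: "(real \<Rightarrow> real) \<Rightarrow> real \<Rightarrow> ennreal" where
  "pseudo_inverse \<psi> y = Inf {z. (if z = \<infinity> then 0 else \<psi> (enn2real z)) = y}"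

definition pickands :: "(real \<Rightarrow> real) set" where
  "pickands = {A \<in> {0..1} \<rightarrow>\<^sub>E {0..1}.
     convex_on {0..1} A \<and> (\<forall>x\<in>{0..1}. max (1 - x) x \<le> A x \<and> A x \<le> 1)}"

definition pickands_M :: "real \<Rightarrow> real" where
  "pickands_M = (\<lambda>t\<in>{0..1}. max t (1 - t))"

definition continuous_extension :: "(real \<times> real \<Rightarrow> real) \<Rightarrow> real \<times> real \<Rightarrow> real" where
  "continuous_extension F = (\<lambda>p\<in>unit_square.
     if p \<in> open_unit_square then F p else Lim (at p within open_unit_square) F)"

definition ev_copula :: "(real \<Rightarrow> real) \<Rightarrow> real \<times> real \<Rightarrow> real" where
  "ev_copula A = continuous_extension
     (\<lambda>(x, y). (x * y) powr A (ln x / ln (x * y)))"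

text \<open>
  For \<open>\<psi>\<close> in \<^const>\<open>generators\<close> the pseudo-inverse is finite on \<open>(0, 1)\<close>, so that
  \<^const>\<open>enn2real\<close> loses nothing here.
\<close>
definition archimax :: "(real \<Rightarrow> real) \<Rightarrow> (real \<Rightarrow> real) \<Rightarrow> real \<times> real \<Rightarrow> real" where
  "archimax \<psi> A = continuous_extension
     (\<lambda>(x, y). let u = enn2real (pseudo_inverse \<psi> x); v = enn2real (pseudo_inverse \<psi> y)
               in \<psi> ((u + v) * A (u / (u + v))))"

definition generator_power :: "real \<Rightarrow> (real \<Rightarrow> real) \<Rightarrow> real \<Rightarrow> real" where
  "generator_power \<alpha> \<psi> = (\<lambda>z\<in>{0..}. \<psi> (z powr \<alpha>))"

definition pickands_power :: "real \<Rightarrow> (real \<Rightarrow> real) \<Rightarrow> real \<Rightarrow> real" where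
  "pickands_power \<alpha> A = (\<lambda>t\<in>{0..1}.
     (t powr \<alpha> + (1 - t) powr \<alpha>) powr (1 / \<alpha>) *
     A (t powr \<alpha> / (t powr \<alpha> + (1 - t) powr \<alpha>)) powr (1 / \<alpha>))"

end

theory Submission
  imports Defs
begin

text \<open>
  Write \<open>\<phi>\<close> for the inverse of a generator \<open>\<psi>\<close> and
  \<open>\<ell> u v = (u + v) A (u / (u + v))\<close> for the stable tail dependence function of \<open>A\<close>, so that
  \<open>C (x, y) = \<psi> (\<ell> (\<phi> x) (\<phi> y))\<close> for the Archimax copula \<open>C\<close> of \<open>\<psi>\<close> and \<open>A\<close>.

  Both implications follow from one statement, \<open>archimax_dependence_limit\<close>: if Archimax copulas
  converge pointwise on the open square to an Archimax copula with \<open>A\<close> different from the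
  comonotone \<open>A\<^sub>M\<close>, then the values of \<open>\<eta>\<close> converge.  It rests on three facts.

  Continuity (\<open>archimax_weak_cond_conv\<close>): pointwise convergence of the generators and of the
  Pickands functions implies weak conditional convergence of the Archimax copulas.  The conditional
  distribution function of \<open>Y\<close> given \<open>X = x\<close> is the partial derivative of \<open>C\<close> in \<open>x\<close>, which by the
  chain rule is \<open>\<psi>' (\<ell> u v) * \<partial>\<^sub>u \<ell> u v / \<psi>' u\<close> with \<open>u = \<phi> x\<close> and \<open>v = \<phi> y\<close>.  All three factors are
  derivatives of convex functions, and derivatives of pointwise convergent convex functions converge
  wherever the limit is differentiable, that is, outside a countable set.

  Compactness (\<open>archimax_components_subsequence\<close>): the functions \<open>\<psi> \<circ> exp\<close> and \<open>A\<close> are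
  1-Lipschitz and bounded, so every sequence of pairs has a pointwise convergent subsequence.

  Nondegeneracy (\<open>generator_limit\<close>): the limit \<open>\<theta>\<close> of the generators along such a subsequence might
  jump at \<open>0\<close> or stay positive at infinity.  But \<open>\<ell> z z \<le> 2 z\<close> gives
  \<open>\<theta> (2 z) \<le> C (\<theta> z, \<theta> z)\<close>, so both one-sided limits of \<open>\<theta>\<close> are fixed points of the diagonal of \<open>C\<close>.
  Since \<open>A\<close> is not \<open>A\<^sub>M\<close>, the diagonal has no fixed point strictly between \<open>0\<close> and \<open>1\<close>.

  Thus every subsequence has a further subsequence whose generators and Pickands functions converge to
  those of some Archimax copula.  That copula can only be \<open>C\<close>, although its generator and Pickands
  function may differ from the given ones, because \<open>C\<close> does not determine them.  Hence \<open>\<eta>\<close>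
  converges along it to \<open>\<eta> C\<close>, and so along the whole sequence.

  The second implication is immediate.  For the first one, the pair of rescaled functions with exponent
  \<open>\<alpha> = 1 - \<tau>\<close> represents the same copula: the inverse of \<open>\<psi> (z\<^sup>\<alpha>)\<close> is \<open>\<phi>\<close> to the power \<open>1 / \<alpha>\<close>, and the
  rescaled \<open>A\<close> corresponds to the function \<open>\<ell> (u\<^sup>\<alpha>) (v\<^sup>\<alpha>)\<close> to the power \<open>1 / \<alpha>\<close>.  The rescaled
  functions need not be convex, but monotonicity and homogeneity suffice to deduce pointwise
  convergence of the copulas (\<open>archimax_limit_of_powers\<close>).  This needs \<open>\<alpha> > 0\<close>, that is \<open>\<tau> < 1\<close>:
  if \<open>\<tau>\<close> were at least \<open>1\<close>, then \<open>X \<le> Y\<close> would hold almost surely, which makes \<open>C\<close> comonotone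
  (\<open>kendall_tau_less_one\<close>).
\<close>

section \<open>Limits of convex, monotone and homogeneous functions\<close>

text \<open>
  The slope of a tangent of a convex function is at most that of every chord leaving the point of
  tangency to the right, and at least that of every chord to the left.  Chords converge with the
  functions, and short chords of the limit have slopes close to its derivative.
\<close>
lemma convex_derivative_limit:
  fixes f :: "nat \<Rightarrow> real \<Rightarrow> real" and g :: "real \<Rightarrow> real"
  assumes S: "open S" "convex S" and cvx: "\<And>n. convex_on S (f n)"
    and lim: "\<And>z. z \<in> S \<Longrightarrow> (\<lambda>n. f n z) \<longlonglongrightarrow> g z"
    and x: "x \<in> S" and xs: "\<And>n. xs n \<in> S" "xs \<longlonglongrightarrow> x"
    and fx: "(\<lambda>n. f n (xs n)) \<longlonglongrightarrow> g x"
    and df: "\<And>n. (f n has_real_derivative d n) (at (xs n))"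
    and dg: "(g has_real_derivative e) (at x)"
  shows "d \<longlonglongrightarrow> e"
proof (rule LIMSEQ_I)
  fix r :: real assume r: "r > 0"
  have tangent: "f n y - f n (xs n) \<ge> d n * (y - xs n)" if "y \<in> S" for n y
    by (rule convex_on_imp_above_tangent[OF cvx]) 
       (use that S xs df in \<open>auto simp: interior_open convex_connected intro: has_field_derivative_at_within\<close>)
  have "((\<lambda>y. (g y - g x) / (y - x)) \<longlongrightarrow> e) (at x)"
    using dg by (simp add: has_field_derivative_iff)
  then obtain \<delta> where \<delta>: "\<delta> > 0" "\<And>y. y \<noteq> x \<Longrightarrow> dist y x < \<delta> \<Longrightarrow> dist ((g y - g x) / (y - x)) e < r / 2"
    using r tendstoD[of "\<lambda>y. (g y - g x) / (y - x)" e "at x" "r / 2"] that unfolding eventually_at by auto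
  obtain \<epsilon> where \<epsilon>: "\<epsilon> > 0" "\<And>y. dist y x < \<epsilon> \<Longrightarrow> y \<in> S"
    using S(1) x by (metis open_dist)
  define h where "h = min \<delta> \<epsilon> / 2"
  have h: "h > 0" "h < \<delta>" "h < \<epsilon>" using \<delta>(1) \<epsilon>(1) by (auto simp: h_def)
  have mem: "x + h \<in> S" "x - h \<in> S" using h by (auto intro!: \<epsilon>(2) simp: dist_real_def)
  have quot: "(\<lambda>n. (f n (x + s) - f n (xs n)) / (x + s - xs n)) \<longlonglongrightarrow> (g (x + s) - g x) / (x + s - x)"
    if "x + s \<in> S" "s \<noteq> 0" for s
    by (intro tendsto_intros lim that fx xs) (use that in auto)
  have up: "(g (x + h) - g x) / (x + h - x) < e + r / 2"
  proof -
    have "dist ((g (x + h) - g x) / (x + h - x)) e < r / 2"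
      by (rule \<delta>(2)) (use h in \<open>auto simp: dist_real_def\<close>)
    then show ?thesis unfolding dist_real_def by linarith
  qed
  have lo: "(g (x + -h) - g x) / (x + -h - x) > e - r / 2"
  proof -
    have "dist ((g (x + -h) - g x) / (x + -h - x)) e < r / 2"
      by (rule \<delta>(2)) (use h in \<open>auto simp: dist_real_def\<close>)
    then show ?thesis unfolding dist_real_def by linarith
  qed
  have ev: "eventually (\<lambda>n. \<bar>xs n - x\<bar> < h) sequentially"
    using xs(2) h(1) by (auto simp: tendsto_iff dist_real_def)
  have 1: "eventually (\<lambda>n. (f n (x + h) - f n (xs n)) / (x + h - xs n) < e + r) sequentially"
    by (rule order_tendstoD(2)[OF quot]) (use mem h r up in auto)
  have 2: "eventually (\<lambda>n. e - r < (f n (x + -h) - f n (xs n)) / (x + -h - xs n)) sequentially"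
    by (rule order_tendstoD(1)[OF quot]) (use mem h r lo in auto)
  from ev 1 2 have "eventually (\<lambda>n. norm (d n - e) < r) sequentially"
  proof eventually_elim
    case (elim n)
    have "x + h - xs n > 0" using elim(1) by auto
    then have "d n \<le> (f n (x + h) - f n (xs n)) / (x + h - xs n)"
      using tangent[OF mem(1), of n] by (simp add: pos_le_divide_eq)
    moreover have "x - h - xs n < 0" using elim(1) by auto
    then have "d n \<ge> (f n (x - h) - f n (xs n)) / (x - h - xs n)"
      using tangent[OF mem(2), of n] by (simp add: neg_divide_le_eq)
    ultimately show ?case using elim(2,3) by (simp add: abs_less_iff)
  qed
  then show "\<exists>N. \<forall>n\<ge>N. norm (d n - e) < r" by (simp add: eventually_sequentially)
qed

text \<open>
  The right derivative of a convex function is nondecreasing, hence continuous outside a countable set,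
  and where it is continuous it squeezes all difference quotients.
\<close>
lemma convex_countable_not_differentiable:
  fixes f :: "real \<Rightarrow> real"
  assumes S: "open S" "convex S" and cvx: "convex_on S f"
  shows "countable {x \<in> S. \<not> f differentiable (at x)}"
proof -
  \<comment> \<open>The right derivative of \<open>f\<close>.\<close>
  define D where "D x = Inf ((\<lambda>t. (f x - f t) / (x - t)) ` ({x<..} \<inter> S))" for x
  have sub: "f y \<ge> f x + D x * (y - x)" if "x \<in> S" "y \<in> S" for x y
    unfolding D_def using convex_le_Inf_differential[OF cvx, of x y] that S by (simp add: interior_open)
  have "mono_on S D"
  proof (rule mono_onI)
    fix x y assume xy: "x \<in> S" "y \<in> S" "x \<le> y"
    have "(D y - D x) * (y - x) \<ge> 0"
      using sub[of x y] sub[of y x] xy by (simp add: algebra_simps)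
    then show "D x \<le> D y" using xy by (cases "x = y") (auto simp: zero_le_mult_iff)
  qed
  then have "countable {x \<in> S. \<not> isCont D x}" by (rule mono_on_ctble_discont_open[OF S(1)])
  moreover have "f differentiable (at x)" if x: "x \<in> S" "isCont D x" for x
  proof -
    have nbhd: "eventually (\<lambda>y. y \<in> S) (at x)" using S x by (simp add: eventually_at_topological) blast
    have "((\<lambda>y. (f y - f x) / (y - x)) \<longlongrightarrow> D x) (at x)"
    proof (rule tendsto_sandwich)
      have le: "y \<in> S \<Longrightarrow> y \<noteq> x \<Longrightarrow> min (D x) (D y) \<le> (f y - f x) / (y - x) \<and> (f y - f x) / (y - x) \<le> max (D x) (D y)" for y
        using sub[of x y] sub[of y x] x by (cases y x rule: linorder_cases) (auto simp: field_simps min_le_iff_disj le_max_iff_disj)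
      show "eventually (\<lambda>y. min (D x) (D y) \<le> (f y - f x) / (y - x)) (at x)"
        "eventually (\<lambda>y. (f y - f x) / (y - x) \<le> max (D x) (D y)) (at x)"
        using nbhd le by (auto simp: eventually_at_filter elim!: eventually_mono)
      have "(D \<longlongrightarrow> D x) (at x)" using x by (simp add: isCont_def)
      from tendsto_min[OF tendsto_const this, of "D x"] show "((\<lambda>y. min (D x) (D y)) \<longlongrightarrow> D x) (at x)" by simp
      from tendsto_max[OF tendsto_const \<open>(D \<longlongrightarrow> D x) (at x)\<close>, of "D x"] show "((\<lambda>y. max (D x) (D y)) \<longlongrightarrow> D x) (at x)" by simp
    qed
    then show ?thesis by (auto simp: real_differentiable_def has_field_derivative_iff)
  qed
  ultimately show ?thesis by (auto elim!: countable_subset[rotated])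
qed

text \<open>
  Monotonicity replaces local uniformity: a moving argument is trapped between two fixed ones.
\<close>
lemma antimono_limit_moving_argument:
  fixes f :: "nat \<Rightarrow> real \<Rightarrow> real" and g :: "real \<Rightarrow> real"
  assumes anti: "\<And>n. antimono_on {0<..} (f n)"
    and lim: "\<And>z. z > 0 \<Longrightarrow> (\<lambda>n. f n z) \<longlonglongrightarrow> g z"
    and z: "z > 0" "isCont g z" and zs: "zs \<longlonglongrightarrow> z"
  shows "(\<lambda>n. f n (zs n)) \<longlonglongrightarrow> g z"
proof (rule LIMSEQ_I)
  fix r :: real assume r: "r > 0"
  obtain \<delta> where \<delta>: "\<delta> > 0" "\<And>y. \<bar>y - z\<bar> < \<delta> \<Longrightarrow> \<bar>g y - g z\<bar> < r"
    using z(2) r unfolding continuous_at_eps_delta dist_real_def by blast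
  define h where "h = min \<delta> z / 2"
  have h: "h > 0" "h < \<delta>" "h < z" using \<delta>(1) z(1) by (auto simp: h_def)
  have 1: "eventually (\<lambda>n. f n (z - h) < g z + r) sequentially"
    by (rule order_tendstoD(2)[OF lim]) (use \<delta>(2)[of "z - h"] h in auto)
  have 2: "eventually (\<lambda>n. f n (z + h) > g z - r) sequentially"
    by (rule order_tendstoD(1)[OF lim]) (use \<delta>(2)[of "z + h"] h in auto)
  have "eventually (\<lambda>n. \<bar>zs n - z\<bar> < h) sequentially"
    using zs h(1) by (auto simp: tendsto_iff dist_real_def)
  with 1 2 have "eventually (\<lambda>n. norm (f n (zs n) - g z) < r) sequentially"
  proof eventually_elim
    case (elim n)
    have "f n (z + h) \<le> f n (zs n)" "f n (zs n) \<le> f n (z - h)"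
      using elim h by (auto intro!: monotone_onD[OF anti])
    with elim show ?case by auto
  qed
  then show "\<exists>N. \<forall>n\<ge>N. norm (f n (zs n) - g z) < r" by (simp add: eventually_sequentially)
qed

lemma antimono_limit_inverse:
  fixes f :: "nat \<Rightarrow> real \<Rightarrow> real" and g :: "real \<Rightarrow> real"
  assumes anti: "\<And>n. antimono_on {0<..} (f n)"
    and lim: "\<And>z. z > 0 \<Longrightarrow> (\<lambda>n. f n z) \<longlonglongrightarrow> g z"
    and u: "u > 0" "\<And>z. 0 < z \<Longrightarrow> z < u \<Longrightarrow> g u < g z" "\<And>z. u < z \<Longrightarrow> g z < g u"
    and us: "\<And>n. us n > 0" "(\<lambda>n. f n (us n)) \<longlonglongrightarrow> g u"
  shows "us \<longlonglongrightarrow> u"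
proof (rule LIMSEQ_I)
  fix r :: real assume r: "r > 0"
  define h where "h = min r u / 2"
  have h: "h > 0" "h < r" "h < u" using r u(1) by (auto simp: h_def)
  have 1: "eventually (\<lambda>n. f n (us n) - f n (u - h) < 0) sequentially"
    by (rule order_tendstoD(2)[OF tendsto_diff[OF us(2) lim]]) (use u(2)[of "u - h"] h in auto)
  have 2: "eventually (\<lambda>n. f n (us n) - f n (u + h) > 0) sequentially"
    by (rule order_tendstoD(1)[OF tendsto_diff[OF us(2) lim]]) (use u(3)[of "u + h"] h u(1) in auto)
  from 1 2 have "eventually (\<lambda>n. norm (us n - u) < r) sequentially"
  proof eventually_elim
    case (elim n)
    have "us n > u - h"
      using elim(1) h monotone_onD[OF anti, of "us n" "u - h" n] us(1)[of n] by fastforce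
    moreover have "us n < u + h"
      using elim(2) h monotone_onD[OF anti, of "u + h" "us n" n] us(1)[of n] by fastforce
    ultimately show ?case using h by auto
  qed
  then show "\<exists>N. \<forall>n\<ge>N. norm (us n - u) < r" by (simp add: eventually_sequentially)
qed

text \<open>
  Monotonicity and homogeneity trap \<open>f (us n) (vs n)\<close> between multiples of \<open>f u v\<close> with factors
  tending to \<open>1\<close>; this plays the role of equicontinuity.
\<close>
lemma homogeneous_limit_moving_arguments:
  fixes f :: "nat \<Rightarrow> real \<Rightarrow> real \<Rightarrow> real" and g :: "real \<Rightarrow> real \<Rightarrow> real"
  assumes mono: "\<And>n a b c d. 0 < a \<Longrightarrow> a \<le> c \<Longrightarrow> 0 < b \<Longrightarrow> b \<le> d \<Longrightarrow> f n a b \<le> f n c d"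
    and hom: "\<And>n a b k. 0 < a \<Longrightarrow> 0 < b \<Longrightarrow> 0 < k \<Longrightarrow> f n (k * a) (k * b) = k * f n a b"
    and lim: "\<And>a b. 0 < a \<Longrightarrow> 0 < b \<Longrightarrow> (\<lambda>n. f n a b) \<longlonglongrightarrow> g a b"
    and u: "us \<longlonglongrightarrow> u" "u > 0" and v: "vs \<longlonglongrightarrow> v" "v > 0"
  shows "(\<lambda>n. f n (us n) (vs n)) \<longlonglongrightarrow> g u v"
proof -
  define lo where "lo n = min (us n / u) (vs n / v)" for n
  define hi where "hi n = max (us n / u) (vs n / v)" for n
  have lo: "lo \<longlonglongrightarrow> min (u / u) (v / v)" and hi: "hi \<longlonglongrightarrow> max (u / u) (v / v)"
    unfolding lo_def hi_def using u v by (intro tendsto_min tendsto_max tendsto_divide tendsto_const; simp)+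
  have pos: "eventually (\<lambda>n. us n > 0 \<and> vs n > 0) sequentially"
    using order_tendstoD(1)[OF u] order_tendstoD(1)[OF v] by eventually_elim auto
  show ?thesis
  proof (rule tendsto_sandwich)
    show "eventually (\<lambda>n. lo n * f n u v \<le> f n (us n) (vs n)) sequentially"
      using pos
    proof eventually_elim
      case (elim n)
      have "lo n > 0" using elim u v by (auto simp: lo_def)
      moreover have "lo n * u \<le> us n" "lo n * v \<le> vs n" using u v by (auto simp: lo_def min_def field_simps)
      ultimately show ?case using mono[of "lo n * u" "us n" "lo n * v" "vs n" n] hom[of u v "lo n" n] u v by simp
    qed
    show "eventually (\<lambda>n. f n (us n) (vs n) \<le> hi n * f n u v) sequentially"
      using pos
    proof eventually_elim
      case (elim n)
      have "hi n > 0" using elim u v by (auto simp: hi_def less_max_iff_disj)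
      moreover have "us n \<le> hi n * u" "vs n \<le> hi n * v" using u v by (auto simp: hi_def max_def field_simps)
      ultimately show ?case using mono[of "us n" "hi n * u" "vs n" "hi n * v" n] hom[of u v "hi n" n] elim u v by simp
    qed
    show "(\<lambda>n. lo n * f n u v) \<longlonglongrightarrow> g u v"
      using tendsto_mult[OF lo lim[OF u(2) v(2)]] u v by simp
    show "(\<lambda>n. hi n * f n u v) \<longlonglongrightarrow> g u v"
      using tendsto_mult[OF hi lim[OF u(2) v(2)]] u v by simp
  qed
qed

section \<open>Generators and stable tail dependence functions\<close>

text \<open>
  The stable tail dependence function of the extreme-value copula of \<open>A\<close>: the homogeneous extension of
  \<open>A\<close> from the segment \<open>u + v = 1\<close> to the quadrant.
\<close>
definition stable_tail :: "(real \<Rightarrow> real) \<Rightarrow> real \<Rightarrow> real \<Rightarrow> real" where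
  "stable_tail A u v = (u + v) * A (u / (u + v))"

definition gen_inv :: "(real \<Rightarrow> real) \<Rightarrow> real \<Rightarrow> real" where
  "gen_inv \<psi> x = enn2real (pseudo_inverse \<psi> x)"

text \<open>
  A convex function that is constant on an interval never falls below that constant to the right of
  it, so a positive constant piece is incompatible with decay to \<open>0\<close>.
\<close>
lemma convex_vanishing_strict_decreasing:
  fixes f :: "real \<Rightarrow> real"
  assumes cvx: "convex_on {0..} f" and anti: "antimono_on {0..} f" and lim: "(f \<longlongrightarrow> 0) at_top"
    and ab: "0 \<le> a" "a < b" "f a > 0"
  shows "f b < f a"
proof (rule ccontr)
  assume "\<not> f b < f a"
  then have eq: "f b = f a" using monotone_onD[OF anti, of a b] ab by auto
  have "f a \<le> f z" if "z > b" for z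
  proof -
    have "(f a - f b) / (a - b) \<le> (f a - f z) / (a - z)"
      by (rule convex_on_slope_le(1)[OF cvx]) (use ab that in auto)
    then show ?thesis using ab that eq by (simp add: zero_le_divide_iff)
  qed
  moreover have "eventually (\<lambda>z. f z < f a) at_top" by (rule order_tendstoD(2)[OF lim ab(3)])
  then have "eventually (\<lambda>z. f z < f a \<and> z > b) at_top" using eventually_gt_at_top eventually_conj by blast
  then obtain z where "f z < f a" "z > b" by (metis (mono_tags, lifting) eventually_at_top_linorder order_refl)
  ultimately show False by fastforce
qed

text \<open>
  Both \<open>b\<close> and \<open>c\<close> are convex combinations of \<open>a\<close> and \<open>d\<close>, with the weights exchanged.
\<close>
lemma convex_on_majorization:
  fixes f :: "real \<Rightarrow> real"
  assumes "convex_on S f" "a \<in> S" "d \<in> S" "a \<le> b" "a \<le> c" "a + d = b + c"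
  shows "f b + f c \<le> f a + f d"
proof (cases "a = d")
  case False
  then have ad: "a < d" using assms by linarith
  define t where "t = (b - a) / (d - a)"
  have t: "0 \<le> t" "t \<le> 1" using ad assms by (auto simp: t_def)
  have "t * (d - a) = b - a" using ad by (simp add: t_def)
  then have b: "b = (1 - t) * a + t * d" by (simp add: algebra_simps)
  then have c: "c = t * a + (1 - t) * d" using assms(6) by (simp add: algebra_simps)
  have "f b \<le> (1 - t) * f a + t * f d"
    using convex_onD[OF assms(1) t assms(2,3)] b by simp
  moreover have "f c \<le> t * f a + (1 - t) * f d"
    using convex_onD[OF assms(1), of "1 - t" a d] t assms(2,3) c by simp
  ultimately show ?thesis by (simp add: algebra_simps)
next
  case True
  then have "b = a" "c = a" using assms by linarith+
  then show ?thesis using True by simp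
qed

lemma convex_on_chord_mono:
  fixes f :: "real \<Rightarrow> real"
  assumes f: "convex_on S f" and "a \<in> S" "b' \<in> S" "a' \<in> S" and ab: "a < b" "a' < b'" "a \<le> a'" "b \<le> b'"
  shows "(f b - f a) / (b - a) \<le> (f b' - f a') / (b' - a')"
proof -
  have flip: "(f p - f q) / (p - q) = (f q - f p) / (q - p)" for p q
    by (metis minus_diff_eq minus_divide_divide)
  have "(f b - f a) / (b - a) \<le> (f b' - f a) / (b' - a)"
    using convex_on_slope_le(1)[OF f, of a b' b] assms flip[of a] by (cases "b = b'") auto
  also have "\<dots> \<le> (f b' - f a') / (b' - a')"
    using convex_on_slope_le(2)[OF f, of a b' a'] assms flip[of _ b'] by (cases "a = a'") auto
  finally show ?thesis .
qed

lemma generatorsD: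
  assumes "\<psi> \<in> generators"
  shows "continuous_on {0..} \<psi>" "antimono_on {0..} \<psi>" "convex_on {0..} \<psi>" "\<psi> 0 = 1"
    "(\<psi> \<longlongrightarrow> 0) at_top" "\<psi> 1 = 1 / 2" "\<And>z. z \<ge> 0 \<Longrightarrow> 0 \<le> \<psi> z" "\<And>z. z \<ge> 0 \<Longrightarrow> \<psi> z \<le> 1"
  using assms by (auto simp: generators_def PiE_iff)

lemma generator_strict:
  assumes "\<psi> \<in> generators" "0 \<le> a" "a < b" "\<psi> a > 0"
  shows "\<psi> b < \<psi> a"
  using convex_vanishing_strict_decreasing generatorsD[OF assms(1)] assms(2-) by blast

lemma generator_isCont: "\<psi> \<in> generators \<Longrightarrow> z > 0 \<Longrightarrow> isCont \<psi> z"
  using continuous_on_interior[OF generatorsD(1), of \<psi> z] by simp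

text \<open>
  A positive value is attained only once, so the infimum that defines the pseudo-inverse is taken over
  a singleton.
\<close>
lemma gen_inv_unique:
  assumes "\<psi> \<in> generators" "z \<ge> 0" "\<psi> z = x" "0 < x"
  shows "gen_inv \<psi> x = z"
proof -
  have "{w. (if w = \<infinity> then 0 else \<psi> (enn2real w)) = x} = {ennreal z}"
  proof (intro equalityI subsetI)
    fix w assume "w \<in> {w. (if w = \<infinity> then 0 else \<psi> (enn2real w)) = x}"
    then have w: "w \<noteq> \<infinity>" "\<psi> (enn2real w) = x" using assms by (auto split: if_splits)
    have "enn2real w = z"
      using generator_strict[OF assms(1), of z "enn2real w"] generator_strict[OF assms(1), of "enn2real w" z]
        w assms by (cases "enn2real w" z rule: linorder_cases) auto
    then show "w \<in> {ennreal z}" using w by (auto simp: less_top)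
  qed (use assms in auto)
  then show ?thesis using assms by (simp add: gen_inv_def pseudo_inverse_def)
qed

lemma gen_inv:
  assumes "\<psi> \<in> generators" "0 < x" "x < 1"
  shows "gen_inv \<psi> x > 0" "\<psi> (gen_inv \<psi> x) = x"
proof -
  note g = generatorsD[OF assms(1)]
  have "eventually (\<lambda>z. \<psi> z < x \<and> z > 0) at_top"
    using order_tendstoD(2)[OF g(5) assms(2)] eventually_gt_at_top eventually_conj by blast
  then obtain b where "\<psi> b < x" "b > 0" by (metis (mono_tags, lifting) eventually_at_top_linorder order_refl)
  then obtain z where z: "0 \<le> z" "z \<le> b" "\<psi> z = x"
    using IVT2'[of \<psi> b x 0] continuous_on_subset[OF g(1), of "{0..b}"] g(4) assms by auto
  then show "\<psi> (gen_inv \<psi> x) = x" using gen_inv_unique[OF assms(1) z(1,3)] assms by simp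
  show "gen_inv \<psi> x > 0" using gen_inv_unique[OF assms(1) z(1,3)] assms z g(4) by (cases "z = 0") auto
qed

lemma gen_inv_antimono:
  assumes "\<psi> \<in> generators" "0 < x" "x \<le> y" "y < 1"
  shows "gen_inv \<psi> y \<le> gen_inv \<psi> x"
proof (rule ccontr)
  assume "\<not> ?thesis"
  then have "\<psi> (gen_inv \<psi> y) < \<psi> (gen_inv \<psi> x)"
    using assms gen_inv[OF assms(1), of x] by (intro generator_strict[OF assms(1)]) auto
  then show False using gen_inv[OF assms(1)] assms by simp
qed

lemma archimax_interior:
  assumes "0 < x" "x < 1" "0 < y" "y < 1"
  shows "archimax \<psi> A (x, y) = \<psi> (stable_tail A (gen_inv \<psi> x) (gen_inv \<psi> y))"
  using assms by (auto simp: archimax_def continuous_extension_def stable_tail_def gen_inv_def Let_def)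

lemma pickandsD:
  assumes "A \<in> pickands"
  shows "convex_on {0..1} A" "\<And>t. 0 \<le> t \<Longrightarrow> t \<le> 1 \<Longrightarrow> t \<le> A t" "\<And>t. 0 \<le> t \<Longrightarrow> t \<le> 1 \<Longrightarrow> 1 - t \<le> A t"
    "\<And>t. 0 \<le> t \<Longrightarrow> t \<le> 1 \<Longrightarrow> A t \<le> 1" "A 0 = 1" "A 1 = 1"
proof -
  show "convex_on {0..1} A" using assms by (auto simp: pickands_def)
  show *: "t \<le> A t" "1 - t \<le> A t" "A t \<le> 1" if "0 \<le> t" "t \<le> 1" for t
    using assms that by (auto simp: pickands_def)
  show "A 0 = 1" "A 1 = 1" using *[of 0] *[of 1] by auto
qed

lemma stable_tail_bounds:
  assumes "A \<in> pickands" "u \<ge> 0" "v > 0"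
  shows "u \<le> stable_tail A u v" "v \<le> stable_tail A u v" "stable_tail A u v \<le> u + v"
proof -
  have t: "0 \<le> u / (u + v)" "u / (u + v) \<le> 1" using assms by auto
  have uv: "u + v > 0" using assms by simp
  have "u = (u + v) * (u / (u + v))" using uv by simp
  also have "\<dots> \<le> stable_tail A u v" unfolding stable_tail_def using pickandsD(2)[OF assms(1) t] uv by (intro mult_left_mono) auto
  finally show "u \<le> stable_tail A u v" .
  have "v = (u + v) * (1 - u / (u + v))" using uv by (simp add: field_simps)
  also have "\<dots> \<le> stable_tail A u v" unfolding stable_tail_def using pickandsD(3)[OF assms(1) t] uv by (intro mult_left_mono) auto
  finally show "v \<le> stable_tail A u v" .
  show "stable_tail A u v \<le> u + v" unfolding stable_tail_def using pickandsD(4)[OF assms(1) t] uv by (simp add: mult_left_le)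
qed

lemma stable_tail_zero: "A \<in> pickands \<Longrightarrow> stable_tail A 0 v = v"
  by (simp add: stable_tail_def pickandsD)

lemma stable_tail_homogeneous: "k > 0 \<Longrightarrow> stable_tail A (k * u) (k * v) = k * stable_tail A u v"
  unfolding stable_tail_def by (simp flip: distrib_left)

text \<open>
  This is the perspective of the convex function \<open>A\<close>: the weights of the convex combination change
  from \<open>1 - t\<close> and \<open>t\<close> to the ones proportional to \<open>(1 - t) (a + v)\<close> and \<open>t (b + v)\<close>.
\<close>
lemma stable_tail_convex:
  assumes A: "A \<in> pickands" and v: "v > 0"
  shows "convex_on {0..} (\<lambda>u. stable_tail A u v)"
proof (rule convex_onI)
  fix t a b :: real
  assume t: "0 < t" "t < 1" and ab: "a \<in> {0..}" "b \<in> {0..}"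
  define s where "s = ((1 - t) * a + t * b) + v"
  have s: "s = (1 - t) * (a + v) + t * (b + v)" by (simp add: s_def algebra_simps)
  have pos: "a + v > 0" "b + v > 0" using ab v by auto
  have s0: "s > 0" unfolding s by (rule add_pos_pos; rule mult_pos_pos) (use t pos in linarith)+
  define w where "w = t * (b + v) / s"
  have w: "0 \<le> w" "w \<le> 1" using t pos s0 by (auto simp: w_def s)
  have w1: "1 - w = (1 - t) * (a + v) / s" using s0 by (simp add: w_def field_simps s)
  have "((1 - t) * a + t * b) / s = (1 - w) * (a / (a + v)) + w * (b / (b + v))"
    unfolding w1 using pos by (simp add: w_def add_divide_distrib)
  then have "A (((1 - t) * a + t * b) / s) \<le> (1 - w) * A (a / (a + v)) + w * A (b / (b + v))"
    using convex_onD[OF pickandsD(1)[OF A] w, of "a / (a + v)" "b / (b + v)"] ab v pos by simp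
  then have "s * A (((1 - t) * a + t * b) / s) \<le> s * ((1 - w) * A (a / (a + v)) + w * A (b / (b + v)))"
    using s0 by (intro mult_left_mono) auto
  also have "\<dots> = (1 - t) * stable_tail A a v + t * stable_tail A b v"
  proof -
    have "s * (1 - w) = (1 - t) * (a + v)" unfolding w1 using s0 by simp
    moreover have "s * w = t * (b + v)" unfolding w_def using s0 by simp
    ultimately have "s * ((1 - w) * p + w * q) = (1 - t) * (a + v) * p + t * (b + v) * q" for p q
      by (simp add: distrib_left flip: mult.assoc)
    then show ?thesis by (simp add: stable_tail_def mult.assoc)
  qed
  finally show "stable_tail A ((1 - t) *\<^sub>R a + t *\<^sub>R b) v \<le> (1 - t) * stable_tail A a v + t * stable_tail A b v"
    by (simp add: stable_tail_def s_def)
qed simp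

text \<open>
  A convex function that starts at its minimum \<open>v\<close> is nondecreasing.
\<close>
lemma stable_tail_mono_left:
  assumes A: "A \<in> pickands" and "0 \<le> a" "a \<le> b" "v > 0"
  shows "stable_tail A a v \<le> stable_tail A b v"
proof (cases "a = 0 \<or> a = b")
  case True
  then show ?thesis using stable_tail_zero[OF A, of v] stable_tail_bounds[OF A, of b v] assms by auto
next
  case False
  have "(stable_tail A 0 v - stable_tail A a v) / (0 - a) \<le> (stable_tail A a v - stable_tail A b v) / (a - b)"
    using convex_on_slope_le[OF stable_tail_convex[OF A assms(4)], of 0 b a] assms False by auto
  moreover have "(stable_tail A 0 v - stable_tail A a v) / (0 - a) \<ge> 0"
    using stable_tail_zero[OF A, of v] stable_tail_bounds[OF A, of a v] assms False
    by (intro divide_nonpos_neg) auto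
  ultimately have "(stable_tail A a v - stable_tail A b v) / (a - b) \<ge> 0" by linarith
  then show ?thesis using assms False by (auto simp: zero_le_divide_iff)
qed

text \<open>
  Reflecting the Pickands function exchanges the two arguments, so that facts about the first argument
  carry over to the second one.
\<close>
lemma stable_tail_swap:
  assumes "A \<in> pickands"
  obtains B where "B \<in> pickands" "\<And>u v. u > 0 \<Longrightarrow> v > 0 \<Longrightarrow> stable_tail B v u = stable_tail A u v"
proof
  let ?B = "\<lambda>t\<in>{0..1}. A (1 - t)"
  have "convex_on {0..1} ?B"
  proof (rule convex_onI)
    fix t x y :: real assume *: "0 < t" "t < 1" "x \<in> {0..1}" "y \<in> {0..1}"
    have "(1 - t) * x + t * y \<in> {0..1}"
      using * convexD_alt[OF convex_real_interval(5)[of 0 1], of x y t] by simp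
    moreover have "1 - ((1 - t) * x + t * y) = (1 - t) * (1 - x) + t * (1 - y)" by (simp add: algebra_simps)
    ultimately show "?B ((1 - t) *\<^sub>R x + t *\<^sub>R y) \<le> (1 - t) * ?B x + t * ?B y"
      using convex_onD[OF pickandsD(1)[OF assms], of t "1 - x" "1 - y"] * by simp
  qed simp
  moreover have "A (1 - t) \<ge> 0" if "t \<in> {0..1}" for t using pickandsD(2)[OF assms, of "1 - t"] that by auto
  ultimately show "?B \<in> pickands"
    using pickandsD(2-4)[OF assms, of "1 - _"] by (fastforce simp: pickands_def)
  show "stable_tail ?B v u = stable_tail A u v" if "u > 0" "v > 0" for u v
  proof -
    have "1 - v / (v + u) = u / (u + v)" using that by (simp add: field_simps)
    then show ?thesis using that by (simp add: stable_tail_def add.commute)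
  qed
qed

lemma stable_tail_mono:
  assumes A: "A \<in> pickands" and "0 < a" "a \<le> c" "0 < b" "b \<le> d"
  shows "stable_tail A a b \<le> stable_tail A c d"
proof -
  obtain B where B: "B \<in> pickands" "\<And>u v. u > 0 \<Longrightarrow> v > 0 \<Longrightarrow> stable_tail B v u = stable_tail A u v"
    using stable_tail_swap[OF A] by blast
  have "stable_tail A a b \<le> stable_tail A c b" by (rule stable_tail_mono_left[OF A]) (use assms in auto)
  also have "\<dots> \<le> stable_tail A c d"
    using stable_tail_mono_left[OF B(1), of b d c] B(2)[of c b] B(2)[of c d] assms by auto
  finally show ?thesis .
qed

text \<open>
  By homogeneity, the slope of \<open>\<ell>\<close> in its first argument between \<open>u\<close> and \<open>u'\<close>, at height \<open>v\<close>, is the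
  slope of the convex function \<open>\<ell> _ 1\<close> between \<open>u / v\<close> and \<open>u' / v\<close>; this interval moves to the left
  as \<open>v\<close> grows.
\<close>
lemma stable_tail_submodular:
  assumes A: "A \<in> pickands" and "0 < u" "u \<le> u'" "0 < v" "v \<le> v'"
  shows "stable_tail A u' v' + stable_tail A u v \<le> stable_tail A u v' + stable_tail A u' v"
proof (cases "u = u'")
  case False
  define h where "h s = stable_tail A s 1" for s
  have scale: "stable_tail A a b = b * h (a / b)" if "b > 0" for a b
    using stable_tail_homogeneous[of b A "a / b" 1] that by (simp add: h_def)
  have "(h (u' / v') - h (u / v')) / (u' / v' - u / v') \<le> (h (u' / v) - h (u / v)) / (u' / v - u / v)"
    by (rule convex_on_chord_mono[where S="{0..}"])
       (use assms False stable_tail_convex[OF A, of 1] in \<open>auto simp: h_def[abs_def] divide_strict_right_mono intro!: divide_left_mono\<close>)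
  moreover have "(h (u' / w) - h (u / w)) / (u' / w - u / w) = (stable_tail A u' w - stable_tail A u w) / (u' - u)" if "w > 0" for w
    using that by (simp add: scale flip: diff_divide_distrib) (simp add: algebra_simps)
  ultimately have "(stable_tail A u' v' - stable_tail A u v') / (u' - u) \<le> (stable_tail A u' v - stable_tail A u v) / (u' - u)"
    using assms by simp
  then show ?thesis using assms False by (simp add: divide_le_cancel)
qed simp

section \<open>Copulas and the copula property of Archimax copulas\<close>

lemma copulaD:
  assumes "C \<in> copulas"
  shows "\<And>x y. 0 \<le> x \<Longrightarrow> x \<le> 1 \<Longrightarrow> 0 \<le> y \<Longrightarrow> y \<le> 1 \<Longrightarrow> 0 \<le> C (x, y) \<and> C (x, y) \<le> 1"
    "\<And>x. 0 \<le> x \<Longrightarrow> x \<le> 1 \<Longrightarrow> C (x, 0) = 0 \<and> C (0, x) = 0 \<and> C (x, 1) = x \<and> C (1, x) = x"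
    "\<And>a b c d. 0 \<le> a \<Longrightarrow> a \<le> b \<Longrightarrow> b \<le> 1 \<Longrightarrow> 0 \<le> c \<Longrightarrow> c \<le> d \<Longrightarrow> d \<le> 1 \<Longrightarrow>
       C (b, c) + C (a, d) \<le> C (b, d) + C (a, c)"
proof -
  show "0 \<le> C (x, y) \<and> C (x, y) \<le> 1" if "0 \<le> x" "x \<le> 1" "0 \<le> y" "y \<le> 1" for x y
    using assms that by (auto simp: copulas_def PiE_iff)
  show "C (x, 0) = 0 \<and> C (0, x) = 0 \<and> C (x, 1) = x \<and> C (1, x) = x" if "0 \<le> x" "x \<le> 1" for x
    using assms that by (auto simp: copulas_def)
  show "C (b, c) + C (a, d) \<le> C (b, d) + C (a, c)"
    if "0 \<le> a" "a \<le> b" "b \<le> 1" "0 \<le> c" "c \<le> d" "d \<le> 1" for a b c d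
  proof -
    have *: "\<forall>x\<^sub>1\<in>{0..1}. \<forall>x\<^sub>2\<in>{0..1}. \<forall>y\<^sub>1\<in>{0..1}. \<forall>y\<^sub>2\<in>{0..1}. x\<^sub>1 \<le> x\<^sub>2 \<longrightarrow> y\<^sub>1 \<le> y\<^sub>2 \<longrightarrow>
        0 \<le> C (x\<^sub>2, y\<^sub>2) - C (x\<^sub>2, y\<^sub>1) - C (x\<^sub>1, y\<^sub>2) + C (x\<^sub>1, y\<^sub>1)"
      using assms by (simp add: copulas_def)
    show ?thesis using *[rule_format, of a b c d] that by simp
  qed
qed

lemma copula_increment:
  assumes C: "C \<in> copulas" and "0 \<le> a" "a \<le> b" "b \<le> 1" "0 \<le> y" "y \<le> 1"
  shows "C (a, y) \<le> C (b, y)" "C (b, y) - C (a, y) \<le> b - a"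
    "C (y, a) \<le> C (y, b)" "C (y, b) - C (y, a) \<le> b - a"
proof -
  have z: "C (a, 0) = 0" "C (b, 0) = 0" "C (a, 1) = a" "C (b, 1) = b"
     "C (0, a) = 0" "C (0, b) = 0" "C (1, a) = a" "C (1, b) = b"
    using copulaD(2)[OF C, of a] copulaD(2)[OF C, of b] assms by auto
  show "C (a, y) \<le> C (b, y)" using copulaD(3)[OF C, of a b 0 y] assms z by simp
  show "C (b, y) - C (a, y) \<le> b - a" using copulaD(3)[OF C, of a b y 1] assms z by simp
  show "C (y, a) \<le> C (y, b)" using copulaD(3)[OF C, of 0 y a b] assms z by simp
  show "C (y, b) - C (y, a) \<le> b - a" using copulaD(3)[OF C, of y 1 a b] assms z by simp
qed

lemma copula_lipschitz:
  assumes C: "C \<in> copulas" and "x \<in> {0..1}" "x' \<in> {0..1}" "y \<in> {0..1}" "y' \<in> {0..1}"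
  shows "\<bar>C (x, y) - C (x', y')\<bar> \<le> \<bar>x - x'\<bar> + \<bar>y - y'\<bar>"
proof -
  have "\<bar>C (x, y) - C (x', y)\<bar> \<le> \<bar>x - x'\<bar>"
    using copula_increment(1,2)[OF C, of x x' y] copula_increment(1,2)[OF C, of x' x y] assms
    by (cases "x \<le> x'") auto
  moreover have "\<bar>C (x', y) - C (x', y')\<bar> \<le> \<bar>y - y'\<bar>"
    using copula_increment(3,4)[OF C, of y y' x'] copula_increment(3,4)[OF C, of y' y x'] assms
    by (cases "y \<le> y'") auto
  ultimately show ?thesis by linarith
qed

lemma copula_bounds:
  assumes C: "C \<in> copulas" and "0 \<le> x" "x \<le> 1" "0 \<le> y" "y \<le> 1"
  shows "C (x, y) \<le> min x y"
  using copula_increment(3)[OF C, of y 1 x] copula_increment(1)[OF C, of x 1 y] copulaD(2)[OF C, of x] copulaD(2)[OF C, of y] assms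
  by auto

text \<open>
  The two Frechet-Hoeffding bounds agree on the boundary of the square, which determines the boundary
  values of every copula.
\<close>
lemma frechet_boundary:
  fixes x y :: real
  assumes "(x, y) \<in> unit_square - open_unit_square"
  shows "max 0 (x + y - 1) = min x y"
  using assms by (auto simp: min_def max_def)

lemma continuous_extension_boundary:
  assumes bounds: "\<And>x y. (x, y) \<in> open_unit_square \<Longrightarrow> max 0 (x + y - 1) \<le> F (x, y) \<and> F (x, y) \<le> min x y"
    and p: "(x, y) \<in> unit_square - open_unit_square"
  shows "continuous_extension F (x, y) = min x y"
proof -
  have "(x, y) \<in> closure open_unit_square" using p by (simp add: closure_Times)
  then have nontriv: "at (x, y) within open_unit_square \<noteq> bot"
    using p by (simp add: at_within_eq_bot_iff insert_absorb Diff_insert_absorb)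
  have "(F \<longlongrightarrow> min x y) (at (x, y) within open_unit_square)"
  proof (rule tendsto_sandwich)
    show "\<forall>\<^sub>F q in at (x, y) within open_unit_square. max 0 (fst q + snd q - 1) \<le> F q"
      "\<forall>\<^sub>F q in at (x, y) within open_unit_square. F q \<le> min (fst q) (snd q)"
      unfolding eventually_at_filter by (intro always_eventually allI impI; use bounds in force)+
    have "((\<lambda>q. max 0 (fst q + snd q - 1)) \<longlongrightarrow> max 0 (fst (x, y) + snd (x, y) - 1)) (at (x, y) within open_unit_square)"
      by (intro tendsto_intros)
    then show "((\<lambda>q. max 0 (fst q + snd q - 1)) \<longlongrightarrow> min x y) (at (x, y) within open_unit_square)"
      using frechet_boundary[OF p] by simp
    have "((\<lambda>q. min (fst q) (snd q)) \<longlongrightarrow> min (fst (x, y)) (snd (x, y))) (at (x, y) within open_unit_square)"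
      by (intro tendsto_intros)
    then show "((\<lambda>q. min (fst q) (snd q)) \<longlongrightarrow> min x y) (at (x, y) within open_unit_square)" by simp
  qed
  then show ?thesis using p tendsto_Lim[OF nontriv] by (auto simp: continuous_extension_def)
qed

lemma continuous_extension_cong:
  assumes "\<And>p. p \<in> open_unit_square \<Longrightarrow> F p = G p"
  shows "continuous_extension F = continuous_extension G"
proof -
  have "Lim (at p within open_unit_square) F = Lim (at p within open_unit_square) G" for p
    unfolding Topological_Spaces.Lim_def using assms
    by (intro arg_cong[where f=The] ext tendsto_cong) (simp add: eventually_at_filter)
  then show ?thesis using assms by (auto simp: continuous_extension_def fun_eq_iff)
qed

text \<open>
  The rectangle inequality extends to the closed square by moving the corners of a rectangle into the
  open square.  The values at the corners converge, because an interior corner is eventually not moved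
  at all and a boundary corner is controlled by the Frechet-Hoeffding bounds.
\<close>
lemma continuous_extension_copula:
  assumes bounds: "\<And>x y. (x, y) \<in> open_unit_square \<Longrightarrow> max 0 (x + y - 1) \<le> F (x, y) \<and> F (x, y) \<le> min x y"
    and rect: "\<And>a b c d. 0 < a \<Longrightarrow> a \<le> b \<Longrightarrow> b < 1 \<Longrightarrow> 0 < c \<Longrightarrow> c \<le> d \<Longrightarrow> d < 1 \<Longrightarrow>
       F (b, c) + F (a, d) \<le> F (b, d) + F (a, c)"
  shows "continuous_extension F \<in> copulas"
proof -
  define G where "G = continuous_extension F"
  have inner: "G (x, y) = F (x, y)" if "(x, y) \<in> open_unit_square" for x y
    using that by (auto simp: G_def continuous_extension_def)
  have bdry: "G (x, y) = min x y" if "(x, y) \<in> unit_square - open_unit_square" for x y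
    unfolding G_def by (rule continuous_extension_boundary[OF bounds that])
  have Gb: "max 0 (x + y - 1) \<le> G (x, y) \<and> G (x, y) \<le> min x y" if "(x, y) \<in> unit_square" for x y
    using bounds[of x y] inner[of x y] bdry[of x y] frechet_boundary[of x y] that
    by (cases "(x, y) \<in> open_unit_square") auto
  \<comment> \<open>Moves a coordinate into the open unit interval, by at most \<open>1 / (n + 3)\<close>.\<close>
  define cl where "cl n x = max (1 / real (n + 3)) (min (1 - 1 / real (n + 3)) x)" for n and x :: real
  have cl_in: "0 < cl n x" "cl n x < 1" for n x
  proof -
    have "0 < 1 / real (n + 3)" "1 / real (n + 3) < 1" by auto
    then show "0 < cl n x" "cl n x < 1" unfolding cl_def by linarith+
  qed
  have cl_mono: "x \<le> y \<Longrightarrow> cl n x \<le> cl n y" for n x y by (auto simp: cl_def min_def max_def)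
  have inv: "(\<lambda>n. 1 / real (n + 3)) \<longlonglongrightarrow> 0" using LIMSEQ_ignore_initial_segment[OF lim_1_over_n[where 'a=real], of 3] by simp
  have cl_lim: "(\<lambda>n. cl n x) \<longlonglongrightarrow> x" if "x \<in> {0..1}" for x
    using tendsto_max[OF inv tendsto_min[OF tendsto_diff[OF tendsto_const inv, of 1] tendsto_const, of x]] that
    by (simp add: cl_def)
  have cl_ev: "eventually (\<lambda>n. cl n x = x) sequentially" if "x \<in> {0<..<1}" for x
  proof -
    have "eventually (\<lambda>n. 1 / real (n + 3) < x) sequentially" "eventually (\<lambda>n. 1 / real (n + 3) < 1 - x) sequentially"
      by (rule order_tendstoD(2)[OF inv], use that in simp)+
    then show ?thesis by eventually_elim (auto simp: cl_def)
  qed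
  have G_lim: "(\<lambda>n. G (cl n x, cl n y)) \<longlonglongrightarrow> G (x, y)" if xy: "(x, y) \<in> unit_square" for x y
  proof (cases "(x, y) \<in> open_unit_square")
    case True
    then have "eventually (\<lambda>n. cl n x = x) sequentially" "eventually (\<lambda>n. cl n y = y) sequentially"
      using cl_ev by auto
    then have "eventually (\<lambda>n. G (cl n x, cl n y) = G (x, y)) sequentially" by eventually_elim simp
    then show ?thesis by (rule tendsto_eventually)
  next
    case False
    have cl_sq: "(cl n x, cl n y) \<in> unit_square" for n
      using cl_in[of n x] cl_in[of n y] by auto
    show ?thesis
    proof (rule tendsto_sandwich)
      show "\<forall>\<^sub>F n in sequentially. max 0 (cl n x + cl n y - 1) \<le> G (cl n x, cl n y)"
        "\<forall>\<^sub>F n in sequentially. G (cl n x, cl n y) \<le> min (cl n x) (cl n y)"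
        using Gb[OF cl_sq] by auto
      have "(\<lambda>n. max 0 (cl n x + cl n y - 1)) \<longlonglongrightarrow> max 0 (x + y - 1)" "(\<lambda>n. min (cl n x) (cl n y)) \<longlonglongrightarrow> min x y"
        using xy cl_lim by (auto intro!: tendsto_intros)
      then show "(\<lambda>n. max 0 (cl n x + cl n y - 1)) \<longlonglongrightarrow> G (x, y)" "(\<lambda>n. min (cl n x) (cl n y)) \<longlonglongrightarrow> G (x, y)"
        using frechet_boundary[of x y] bdry[of x y] xy False by auto
    qed
  qed
  have "G (b, c) + G (a, d) \<le> G (b, d) + G (a, c)"
    if *: "0 \<le> a" "a \<le> b" "b \<le> 1" "0 \<le> c" "c \<le> d" "d \<le> 1" for a b c d
  proof (rule LIMSEQ_le)
    show "(\<lambda>n. G (cl n b, cl n c) + G (cl n a, cl n d)) \<longlonglongrightarrow> G (b, c) + G (a, d)"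
      "(\<lambda>n. G (cl n b, cl n d) + G (cl n a, cl n c)) \<longlonglongrightarrow> G (b, d) + G (a, c)"
      using * by (auto intro!: tendsto_add G_lim)
    show "\<exists>N. \<forall>n\<ge>N. G (cl n b, cl n c) + G (cl n a, cl n d) \<le> G (cl n b, cl n d) + G (cl n a, cl n c)"
      using * by (intro exI[of _ 0] allI impI) (simp add: inner cl_in cl_mono rect)
  qed
  then have "0 \<le> G (b, d) - G (b, c) - G (a, d) + G (a, c)"
    if "0 \<le> a" "a \<le> b" "b \<le> 1" "0 \<le> c" "c \<le> d" "d \<le> 1" for a b c d
    using that by (smt (verit))
  moreover have "G (x, y) \<in> {0..1}" if "(x, y) \<in> unit_square" for x y
    using Gb[OF that] that by (auto simp: min_le_iff_disj)
  then have "G \<in> unit_square \<rightarrow>\<^sub>E {0..1}"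
    by (auto simp: PiE_iff G_def continuous_extension_def)
  moreover have "G (x, 0) = 0 \<and> G (0, x) = 0 \<and> G (x, 1) = x \<and> G (1, x) = x" if "x \<in> {0..1}" for x
    using bdry[of x 0] bdry[of 0 x] bdry[of x 1] bdry[of 1 x] that by auto
  ultimately show ?thesis
    unfolding G_def[symmetric] copulas_def by auto
qed

lemma archimax_bounds:
  assumes \<psi>: "\<psi> \<in> generators" and A: "A \<in> pickands" and xy: "(x, y) \<in> open_unit_square"
  shows "max 0 (x + y - 1) \<le> archimax \<psi> A (x, y) \<and> archimax \<psi> A (x, y) \<le> min x y"
proof -
  note g = generatorsD[OF \<psi>]
  define u v where "u = gen_inv \<psi> x" and "v = gen_inv \<psi> y"
  have uv: "u > 0" "v > 0" "\<psi> u = x" "\<psi> v = y" using gen_inv[OF \<psi>] xy by (auto simp: u_def v_def)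
  have C: "archimax \<psi> A (x, y) = \<psi> (stable_tail A u v)"
    using archimax_interior[of x y] xy by (simp add: u_def v_def)
  note b = stable_tail_bounds[OF A less_imp_le[OF uv(1)] uv(2)]
  have "\<psi> (u + v) \<le> \<psi> (stable_tail A u v)" "\<psi> (stable_tail A u v) \<le> \<psi> u" "\<psi> (stable_tail A u v) \<le> \<psi> v"
    using b uv by (auto intro!: monotone_onD[OF g(2)])
  moreover have "x + y \<le> \<psi> 0 + \<psi> (u + v)"
    using convex_on_majorization[OF g(3), of 0 "u + v" u v] uv by auto
  ultimately show ?thesis unfolding C using g uv b by (auto simp: g(7))
qed

text \<open>
  Submodularity of \<open>\<ell>\<close> says that the arguments of \<open>\<psi>\<close> at the two diagonal corners have at most the
  sum of those at the other two corners.  Raising the largest argument to make the sums equal only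
  lowers \<open>\<psi>\<close>, and then convexity of \<open>\<psi>\<close> applies.
\<close>
lemma archimax_rectangle:
  assumes \<psi>: "\<psi> \<in> generators" and A: "A \<in> pickands"
    and abcd: "0 < a" "a \<le> b" "b < 1" "0 < c" "c \<le> d" "d < 1"
  shows "archimax \<psi> A (b, c) + archimax \<psi> A (a, d) \<le> archimax \<psi> A (b, d) + archimax \<psi> A (a, c)"
proof -
  note g = generatorsD[OF \<psi>]
  let ?i = "gen_inv \<psi>" let ?l = "\<lambda>x y. stable_tail A (?i x) (?i y)"
  have pos: "?i a > 0" "?i b > 0" "?i c > 0" "?i d > 0" using gen_inv[OF \<psi>] abcd by auto
  have le: "?i b \<le> ?i a" "?i d \<le> ?i c" using gen_inv_antimono[OF \<psi>] abcd by auto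
  have lp: "?l p q > 0" if "?i p > 0" "?i q > 0" for p q
    using stable_tail_bounds(1)[OF A, of "?i p" "?i q"] that by linarith
  have sub: "?l a c + ?l b d \<le> ?l b c + ?l a d"
    using stable_tail_submodular[OF A pos(2) le(1) pos(4) le(2)] by simp
  have mono: "?l b d \<le> ?l b c" "?l b d \<le> ?l a d"
    using stable_tail_mono[OF A] pos le by auto
  \<comment> \<open>The fourth point that balances the other three; it is at least \<open>?l a c\<close>.\<close>
  define e where "e = ?l b c + ?l a d - ?l b d"
  have "\<psi> (?l b c) + \<psi> (?l a d) \<le> \<psi> (?l b d) + \<psi> e"
    by (rule convex_on_majorization[OF g(3)]) (use lp pos mono in \<open>auto simp: e_def less_imp_le add_increasing\<close>)
  moreover have "\<psi> e \<le> \<psi> (?l a c)"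
    using sub lp[OF pos(1,3)] by (intro monotone_onD[OF g(2)]) (auto simp: e_def)
  ultimately show ?thesis using archimax_interior abcd by simp
qed

lemma archimax_extension: "archimax \<psi> A = continuous_extension (archimax \<psi> A)"
  unfolding archimax_def by (rule continuous_extension_cong) (auto simp: continuous_extension_def)

theorem archimax_copula:
  assumes "\<psi> \<in> generators" "A \<in> pickands"
  shows "archimax \<psi> A \<in> copulas"
  by (subst archimax_extension, rule continuous_extension_copula)
     (use archimax_bounds[OF assms] archimax_rectangle[OF assms] in blast)+

section \<open>Partial derivatives of copulas\<close>

definition unit_clamp :: "real \<Rightarrow> real" where
  "unit_clamp s = max 0 (min 1 s)"

text \<open>
  The right derivative of \<open>C\<close> in the first variable, defined everywhere as a limit of difference
  quotients along \<open>1 / (n + 1)\<close> so that it is evidently measurable; clamping keeps the arguments in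
  the unit interval.
\<close>
definition copula_deriv :: "(real \<times> real \<Rightarrow> real) \<Rightarrow> real \<Rightarrow> real \<Rightarrow> real" where
  "copula_deriv C y s = lim (\<lambda>n. (C (unit_clamp (s + inverse (real (Suc n))), y) - C (unit_clamp s, y)) / inverse (real (Suc n)))"

lemma unit_clamp: "unit_clamp (s::real) \<in> {0..1}" "s \<in> {0..1} \<Longrightarrow> unit_clamp s = s"
  by (auto simp: unit_clamp_def)

lemma unit_clamp_lipschitz: "\<bar>unit_clamp s - unit_clamp (t::real)\<bar> \<le> \<bar>s - t\<bar>"
  by (auto simp: unit_clamp_def)

lemma unit_clamp_mono: "s \<le> t \<Longrightarrow> unit_clamp s \<le> unit_clamp (t::real)"
  by (auto simp: unit_clamp_def)

context
  fixes C :: "real \<times> real \<Rightarrow> real" and y :: real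
  assumes C: "C \<in> copulas" and y: "y \<in> {0..1}"
begin

lemma copula_clamp_continuous: "continuous_on UNIV (\<lambda>s. C (unit_clamp s, y))"
proof (rule lipschitz_on_continuous_on[OF lipschitz_onI])
  show "dist (C (unit_clamp s, y)) (C (unit_clamp t, y)) \<le> 1 * dist s t" for s t
    using copula_lipschitz[OF C unit_clamp(1) unit_clamp(1) y y, of s t] unit_clamp_lipschitz[of s t]
    by (simp add: dist_real_def)
qed simp

lemma copula_deriv_measurable [measurable]: "copula_deriv C y \<in> borel_measurable borel"
proof -
  have [measurable]: "(\<lambda>s. C (unit_clamp s, y)) \<in> borel_measurable borel"
    by (rule borel_measurable_continuous_onI[OF copula_clamp_continuous])
  have [measurable]: "(\<lambda>s. C (unit_clamp (s + r), y)) \<in> borel_measurable borel" for r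
    by (rule measurable_compose[of "\<lambda>s. s + r" borel borel]) measurable
  show ?thesis unfolding copula_deriv_def[abs_def] by measurable
qed

lemma copula_difference_quotient_limit:
  assumes "((\<lambda>t. C (t, y)) has_real_derivative d) (at s)" "s \<in> {0<..<1}"
  shows "(\<lambda>n. (C (unit_clamp (s + inverse (real (Suc n))), y) - C (unit_clamp s, y)) / inverse (real (Suc n))) \<longlonglongrightarrow> d"
proof -
  have "((\<lambda>t. C (unit_clamp t, y)) has_real_derivative d) (at s)"
  proof (rule has_field_derivative_transform_within_open[OF assms(1), of "{0<..<1}"])
    show "C (t, y) = C (unit_clamp t, y)" if "t \<in> {0<..<1}" for t using unit_clamp(2)[of t] that by simp
  qed (use assms in auto)
  then have "(\<lambda>h. (C (unit_clamp (s + h), y) - C (unit_clamp s, y)) / h) \<midarrow>0\<rightarrow> d"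
    by (simp add: DERIV_def)
  moreover have "filterlim (\<lambda>n. inverse (real (Suc n))) (at 0) sequentially"
    using LIMSEQ_inverse_real_of_nat by (auto simp: filterlim_at)
  ultimately show ?thesis by (rule filterlim_compose)
qed

lemma copula_deriv_eq:
  assumes "((\<lambda>t. C (t, y)) has_real_derivative d) (at s)" "s \<in> {0<..<1}"
  shows "copula_deriv C y s = d"
  unfolding copula_deriv_def using copula_difference_quotient_limit[OF assms] by (rule limI)

text \<open>
  The integral of a difference quotient is a difference quotient of an antiderivative of \<open>C (_, y)\<close>, and
  converges to the increment of \<open>C (_, y)\<close>.  The difference quotients lie between \<open>0\<close> and \<open>1\<close>, so
  dominated convergence gives the fundamental theorem of calculus with mere almost everywhere
  differentiability.
\<close>
lemma copula_deriv_integral: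
  assumes diff: "AE s in lborel. s \<in> {0<..<1} \<longrightarrow> (\<lambda>t. C (t, y)) differentiable (at s)"
    and x: "x \<in> {0..1}"
  shows "integrable lborel (\<lambda>s. indicator {0..x} s * copula_deriv C y s)"
    "(\<integral>s. indicator {0..x} s * copula_deriv C y s \<partial>lborel) = C (x, y)"
proof -
  define G where "G s = C (unit_clamp s, y)" for s
  define h where "h n = inverse (real (Suc n))" for n
  define q where "q n s = (G (s + h n) - G s) / h n" for n s
  have h: "h n > 0" for n by (simp add: h_def)
  have contG: "continuous_on UNIV G" unfolding G_def[abs_def] by (rule copula_clamp_continuous)
  have contq: "continuous_on UNIV (q n)" for n
    unfolding q_def[abs_def] using h[of n]
    by (intro continuous_intros continuous_on_compose2[OF contG]) auto
  have "\<exists>H. \<forall>s::real. - \<infinity> < ereal s \<longrightarrow> ereal s < \<infinity> \<longrightarrow> (H has_vector_derivative G s) (at s)"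
    using contG by (intro einterval_antiderivative) (auto simp: continuous_on_eq_continuous_at)
  \<comment> \<open>An antiderivative of \<open>G\<close>, used to integrate the difference quotients of \<open>G\<close>.\<close>
  then obtain H where H: "\<And>s. (H has_real_derivative G s) (at s)"
    by (auto simp: has_real_derivative_iff_has_vector_derivative)
  define P where "P n s = (H (s + h n) - H s) / h n" for n s
  have P: "(P n has_real_derivative q n s) (at s)" for n s
    unfolding P_def[abs_def] q_def using h[of n]
    by (auto intro!: derivative_eq_intros DERIV_chain2[OF H] H)
  have int_q: "(\<integral>s. indicator {0..x} s * q n s \<partial>lborel) = P n x - P n 0" for n
    using integral_FTC_atLeastAtMost[of 0 x "P n" "q n"] x P[of n] contq[of n]
    by (auto simp: has_real_derivative_iff_has_vector_derivative intro: has_vector_derivative_at_within continuous_on_subset)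
  have P_lim: "(\<lambda>n. P n s) \<longlonglongrightarrow> G s" for s
  proof -
    have "(\<lambda>k. (H (s + k) - H s) / k) \<midarrow>0\<rightarrow> G s" using H[of s] by (simp add: DERIV_def)
    moreover have "filterlim h (at 0) sequentially"
      using LIMSEQ_inverse_real_of_nat h by (auto simp: filterlim_at h_def[abs_def])
    ultimately show ?thesis unfolding P_def by (rule filterlim_compose)
  qed
  have q_bound: "norm (q n s) \<le> 1" for n s
  proof -
    have "\<bar>G (s + h n) - G s\<bar> \<le> h n"
      using copula_lipschitz[OF C unit_clamp(1) unit_clamp(1) y y, of "s + h n" s] unit_clamp_lipschitz[of "s + h n" s] h[of n]
      by (simp add: G_def)
    then show ?thesis using h[of n] by (simp add: q_def)
  qed
  have [measurable]: "q n \<in> borel_measurable borel" for n by (rule borel_measurable_continuous_onI[OF contq])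
  have "AE s in lborel. s \<noteq> 0 \<and> s \<noteq> 1"
    by (intro AE_conjI AE_lborel_singleton)
  then have lim: "AE s in lborel. (\<lambda>n. indicator {0..x} s * q n s) \<longlonglongrightarrow> indicator {0..x} s * copula_deriv C y s"
    using diff
  proof eventually_elim
    case (elim s)
    show ?case
    proof (cases "s \<in> {0..x}")
      case True
      then have s: "s \<in> {0<..<1}" using elim x by auto
      with elim obtain d where d: "((\<lambda>t. C (t, y)) has_real_derivative d) (at s)"
        by (auto simp: real_differentiable_def)
      show ?thesis
        using copula_difference_quotient_limit[OF d s] copula_deriv_eq[OF d s]
        by (intro tendsto_intros) (simp add: q_def[abs_def] G_def h_def)
    qed simp
  qed
  have 1: "integrable lborel (\<lambda>s. indicator {0..x} s :: real)" using x by (intro integrable_real_indicator) auto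
  have 2: "AE s in lborel. norm (indicator {0..x} s * q n s) \<le> indicator {0..x} s" for n
    using q_bound by (auto simp: indicator_def)
  show "integrable lborel (\<lambda>s. indicator {0..x} s * copula_deriv C y s)"
    by (rule integrable_dominated_convergence[OF _ _ 1 lim 2]) measurable
  have "(\<lambda>n. \<integral>s. indicator {0..x} s * q n s \<partial>lborel) \<longlonglongrightarrow> (\<integral>s. indicator {0..x} s * copula_deriv C y s \<partial>lborel)"
    by (rule integral_dominated_convergence[OF _ _ 1 lim 2]) measurable
  moreover have "(\<lambda>n. P n x - P n 0) \<longlonglongrightarrow> G x - G 0" by (intro tendsto_intros P_lim)
  ultimately have "(\<integral>s. indicator {0..x} s * copula_deriv C y s \<partial>lborel) = G x - G 0"
    unfolding int_q by (rule LIMSEQ_unique)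
  then show "(\<integral>s. indicator {0..x} s * copula_deriv C y s \<partial>lborel) = C (x, y)"
    using x y copulaD(2)[OF C, of y] unit_clamp(2)[of x] unit_clamp(2)[of 0] by (simp add: G_def)
qed

end

lemma copula_deriv_bounds:
  assumes C: "C \<in> copulas" and y: "y \<in> {0..1}" and s: "s \<in> {0<..<1}"
    and diff: "(\<lambda>t. C (t, y)) differentiable (at s)"
  shows "0 \<le> copula_deriv C y s" "copula_deriv C y s \<le> 1"
proof -
  obtain d where d: "((\<lambda>t. C (t, y)) has_real_derivative d) (at s)"
    using diff by (auto simp: real_differentiable_def)
  note lim = copula_difference_quotient_limit[OF C y d s]
  let ?h = "\<lambda>n. inverse (real (Suc n))"
  have "0 \<le> (C (unit_clamp (s + ?h n), y) - C (unit_clamp s, y)) / ?h n \<and>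
        (C (unit_clamp (s + ?h n), y) - C (unit_clamp s, y)) / ?h n \<le> 1" for n
  proof -
    have h: "?h n > 0" by simp
    have "unit_clamp s \<le> unit_clamp (s + ?h n)" by (rule unit_clamp_mono) simp
    moreover have "unit_clamp (s + ?h n) - unit_clamp s \<le> ?h n"
      using unit_clamp_lipschitz[of "s + ?h n" s] h by linarith
    ultimately show ?thesis
      using copula_increment(1,2)[OF C, of "unit_clamp s" "unit_clamp (s + ?h n)" y] unit_clamp(1)[of s] unit_clamp(1)[of "s + ?h n"] y h
      by (simp add: divide_le_eq del: of_nat_Suc)
  qed
  then show "0 \<le> copula_deriv C y s" "copula_deriv C y s \<le> 1"
    unfolding copula_deriv_eq[OF C y d s]
    using LIMSEQ_le_const[OF lim] LIMSEQ_le_const2[OF lim] by blast+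
qed

text \<open>
  This is the rectangle inequality for thin rectangles. It makes the partial derivative at \<open>s\<close> a
  candidate for a distribution function in \<open>y\<close>.
\<close>
lemma copula_deriv_mono:
  assumes C: "C \<in> copulas" and y: "0 \<le> y" "y \<le> y'" "y' \<le> 1" and s: "s \<in> {0<..<1}"
    and diff: "(\<lambda>t. C (t, y)) differentiable (at s)" "(\<lambda>t. C (t, y')) differentiable (at s)"
  shows "copula_deriv C y s \<le> copula_deriv C y' s"
proof -
  have Y: "y \<in> {0..1}" "y' \<in> {0..1}" using y by auto
  obtain d d' where d: "((\<lambda>t. C (t, y)) has_real_derivative d) (at s)" "((\<lambda>t. C (t, y')) has_real_derivative d') (at s)"
    using diff by (auto simp: real_differentiable_def)
  let ?h = "\<lambda>n. inverse (real (Suc n))"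
  have "(C (unit_clamp (s + ?h n), y) - C (unit_clamp s, y)) / ?h n \<le> (C (unit_clamp (s + ?h n), y') - C (unit_clamp s, y')) / ?h n" for n
  proof -
    have h: "?h n > 0" by simp
    have "unit_clamp s \<le> unit_clamp (s + ?h n)" by (rule unit_clamp_mono) simp
    then have "C (unit_clamp (s + ?h n), y) - C (unit_clamp s, y) \<le> C (unit_clamp (s + ?h n), y') - C (unit_clamp s, y')"
      using copulaD(3)[OF C, of "unit_clamp s" "unit_clamp (s + ?h n)" y y'] unit_clamp(1)[of s] unit_clamp(1)[of "s + ?h n"] y
      by auto
    then show ?thesis using h by (intro divide_right_mono) auto
  qed
  then show ?thesis
    unfolding copula_deriv_eq[OF C Y(1) d(1) s] copula_deriv_eq[OF C Y(2) d(2) s]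
    using LIMSEQ_le[OF copula_difference_quotient_limit[OF C Y(1) d(1) s] copula_difference_quotient_limit[OF C Y(2) d(2) s]] by blast
qed

section \<open>Markov kernels from partial derivatives\<close>

text \<open>
  A nondecreasing function that is only known on a dense set is made into a distribution function by
  taking infima over larger points, which enforces right continuity.
\<close>
lemma real_distribution_from_dense:
  fixes h :: "real \<Rightarrow> real" and D :: "real set"
  assumes dense: "\<And>a b. a < b \<Longrightarrow> \<exists>q\<in>D. a < q \<and> q < b"
    and mono: "\<And>p q. p \<in> D \<Longrightarrow> q \<in> D \<Longrightarrow> p \<le> q \<Longrightarrow> h p \<le> h q"
    and lo: "\<And>q. q \<in> D \<Longrightarrow> q \<le> 0 \<Longrightarrow> h q = 0" and hi: "\<And>q. q \<in> D \<Longrightarrow> q \<ge> 1 \<Longrightarrow> h q = 1"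
  defines "F \<equiv> \<lambda>y. Inf (h ` (D \<inter> {y<..}))"
  shows "real_distribution (interval_measure F)" "cdf (interval_measure F) = F"
    "\<And>y q. q \<in> D \<Longrightarrow> y < q \<Longrightarrow> F y \<le> h q" "\<And>y q. q \<in> D \<Longrightarrow> q \<le> y \<Longrightarrow> h q \<le> F y"
    "\<And>y. (\<And>n. qs n \<in> D \<and> y < qs n) \<Longrightarrow> qs \<longlonglongrightarrow> y \<Longrightarrow> (\<lambda>n. h (qs n)) \<longlonglongrightarrow> F y"
    "\<And>y. y < 0 \<Longrightarrow> F y = 0" "\<And>y. y \<ge> 1 \<Longrightarrow> F y = 1"
proof -
  have range: "0 \<le> h q \<and> h q \<le> 1" if "q \<in> D" for q
  proof -
    obtain a where a: "a \<in> D" "a < min q 0" using dense[OF diff_strict_left_mono[OF zero_less_one], of "min q 0"] by auto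
    obtain b where b: "b \<in> D" "max q 1 < b" using dense[OF less_add_one, of "max q 1"] by auto
    from a b show ?thesis using mono[of a q] mono[of q b] lo[of a] hi[of b] that by auto
  qed
  have ne: "D \<inter> {y<..} \<noteq> {}" for y using dense[of y "y + 1"] by auto
  have bdd: "bdd_below (h ` (D \<inter> {y<..}))" for y using range by (intro bdd_belowI2[of _ 0]) auto
  show low: "F y \<le> h q" if "q \<in> D" "y < q" for y q
    unfolding F_def using that by (intro cINF_lower bdd) auto
  show up: "h q \<le> F y" if "q \<in> D" "q \<le> y" for y q
    unfolding F_def using that by (intro cINF_greatest ne mono) auto
  have F_mono: "F x \<le> F y" if "x \<le> y" for x y
    unfolding F_def using that by (intro cINF_superset_mono ne bdd) auto
  show F0: "F y = 0" if "y < 0" for y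
  proof -
    obtain q r where "q \<in> D" "q < y" "r \<in> D" "y < r" "r < 0" using dense[of "y - 1" y] dense[OF \<open>y < 0\<close>] by auto
    then show ?thesis using up[of q y] low[of r y] lo[of q] lo[of r] by auto
  qed
  show F1: "F y = 1" if "y \<ge> 1" for y
  proof (rule antisym)
    obtain q where "q \<in> D" "y < q" using ne[of y] by auto
    then show "F y \<le> 1" using low[of q y] hi[of q] that by simp
    show "1 \<le> F y" unfolding F_def using hi that by (intro cINF_greatest ne) auto
  qed
  have right: "\<exists>b>y. \<forall>z. y < z \<and> z < b \<longrightarrow> F z < F y + e" if "e > 0" for y e
  proof -
    obtain q where "q \<in> D" "y < q" "h q < F y + e"
      using cInf_lessD[of "h ` (D \<inter> {y<..})" "F y + e"] ne[of y] \<open>e > 0\<close> unfolding F_def by auto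
    then show ?thesis using low by (intro exI[of _ q]) (auto intro: le_less_trans)
  qed
  have cont: "continuous (at_right y) F" for y
    unfolding continuous_within
  proof (rule order_tendstoI)
    fix a assume "a < F y"
    then have "\<forall>z>y. a < F z" using F_mono by (meson less_imp_le order_less_le_trans)
    then show "\<forall>\<^sub>F x in at_right y. a < F x"
      unfolding eventually_at_right_field using gt_ex by blast
  next
    fix a assume "F y < a"
    then show "\<forall>\<^sub>F x in at_right y. F x < a"
      using right[of "a - F y" y] by (auto simp: eventually_at_right_field)
  qed
  have bot: "(F \<longlongrightarrow> 0) at_bot"
    by (rule tendsto_eventually) (auto simp: eventually_at_bot_linorder F0 intro!: exI[of _ "-1"])
  have top: "(F \<longlongrightarrow> 1) at_top"
    by (rule tendsto_eventually) (auto simp: eventually_at_top_linorder F1 intro!: exI[of _ 1])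
  show "real_distribution (interval_measure F)" by (rule real_distribution_interval_measure[OF F_mono cont bot top])
  show "cdf (interval_measure F) = F" by (rule cdf_interval_measure[OF F_mono cont bot])
  show "(\<lambda>n. h (qs n)) \<longlonglongrightarrow> F y" if qs: "\<And>n. qs n \<in> D \<and> y < qs n" "qs \<longlonglongrightarrow> y" for y
  proof (rule order_tendstoI)
    fix a assume "a < F y"
    then show "\<forall>\<^sub>F n in sequentially. a < h (qs n)" using low qs(1) by (meson always_eventually order_less_le_trans)
  next
    fix a assume "F y < a"
    then obtain q where q: "q \<in> D" "y < q" "h q < a"
      using cInf_lessD[of "h ` (D \<inter> {y<..})" a] ne[of y] unfolding F_def by auto
    have "eventually (\<lambda>n. qs n < q) sequentially" using order_tendstoD(2)[OF qs(2) q(2)] .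
    then show "\<forall>\<^sub>F n in sequentially. h (qs n) < a"
    proof eventually_elim
      case (elim n)
      have "h (qs n) \<le> h q" using mono[of "qs n" q] qs(1)[of n] q(1) elim by simp
      then show ?case using q(3) by simp
    qed
  qed
qed

text \<open>
  The property that \<^const>\<open>copula_measure\<close> is to satisfy; a copula determines the measure with this
  property by \<open>represents_unique\<close>.
\<close>
definition represents :: "(real \<times> real) measure \<Rightarrow> (real \<times> real \<Rightarrow> real) \<Rightarrow> bool" where
  "represents M C \<longleftrightarrow> prob_space M \<and> sets M = sets borel \<and>
     (\<forall>x\<in>{0..1}. \<forall>y\<in>{0..1}. measure M ({0..x} \<times> {0..y}) = C (x, y))"

lemma represents_unit_square:
  assumes C: "C \<in> copulas" and M: "represents M C"
  shows "AE p in M. p \<in> unit_square"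
proof -
  interpret prob_space M using M by (simp add: represents_def)
  have "measure M unit_square = 1" using M copulaD(2)[OF C, of 1] by (simp add: represents_def)
  moreover have "unit_square \<in> sets M" using M by (auto simp: represents_def intro!: borel_closed closed_Times)
  ultimately show ?thesis using prob_eq_1 by blast
qed

lemma represents_unique:
  assumes C: "C \<in> copulas" and M: "represents M C" and N: "represents N C"
  shows "M = N"
proof (rule measure_eqI_generator_eq[where E="range atMost" and \<Omega>=UNIV and A="\<lambda>i. {..(real i, real i)}"])
  interpret M: prob_space M using M by (simp add: represents_def)
  interpret N: prob_space N using N by (simp add: represents_def)
  have eq: "emeasure Q {..(a, b)} = (if a < 0 \<or> b < 0 then 0 else ennreal (C (min a 1, min b 1)))"
    if Q: "represents Q C" for Q a b
  proof -
    interpret Q: prob_space Q using Q by (simp add: represents_def)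
    have sets: "sets Q = sets borel" using Q by (simp add: represents_def)
    have "{..(a, b)} \<in> sets Q" "{0..min a 1} \<times> {0..min b 1} \<in> sets Q"
      unfolding sets by (auto intro!: borel_closed closed_Times)
    moreover have "AE p in Q. p \<in> {..(a, b)} \<longleftrightarrow> p \<in> {0..min a 1} \<times> {0..min b 1}"
      using represents_unit_square[OF C Q] by eventually_elim (auto simp: less_eq_prod_def)
    ultimately have "emeasure Q {..(a, b)} = emeasure Q ({0..min a 1} \<times> {0..min b 1})"
      by (intro emeasure_eq_AE) auto
    also have "\<dots> = (if a < 0 \<or> b < 0 then 0 else ennreal (C (min a 1, min b 1)))"
      using Q by (auto simp: represents_def Q.emeasure_eq_measure)
    finally show ?thesis .
  qed
  show "emeasure M X = emeasure N X" if "X \<in> range atMost" for X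
    using that eq[OF M] eq[OF N] by auto
  have "{..(a, b)} \<inter> {..(c, d)} = {..(min a c, min b d)}" for a b c d :: real
    by (auto simp: less_eq_prod_def)
  then show "Int_stable (range (atMost :: real \<times> real \<Rightarrow> _))"
    by (auto simp: Int_stable_def)
  show "sets M = sigma_sets UNIV (range atMost)" "sets N = sigma_sets UNIV (range atMost)"
    using M N by (simp_all add: represents_def borel_eq_atMost)
  show "(\<Union>i. {..(real i, real i)}) = UNIV"
  proof (intro equalityI subsetI UN_I)
    fix p :: "real \<times> real"
    obtain i where "real i > max (fst p) (snd p)" using reals_Archimedean2 by blast
    then show "p \<in> {..(real (nat \<lceil>max (fst p) (snd p)\<rceil>), real (nat \<lceil>max (fst p) (snd p)\<rceil>))}"
      by (auto simp: less_eq_prod_def intro: order_trans[OF _ real_nat_ceiling_ge])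
  qed auto
  show "emeasure M {..(real i, real i)} \<noteq> \<infinity>" for i by simp
qed auto

lemma copula_measure_eq:
  assumes "C \<in> copulas" "represents M C"
  shows "copula_measure C = M"
  unfolding copula_measure_def represents_def[symmetric]
  using assms represents_unique by blast

text \<open>
  The partial derivatives at the points of \<open>D\<close>, regularized to a distribution function, define the
  kernel \<open>K\<close>; integrating \<open>K\<close> over the uniform distribution gives a measure with distribution function
  \<open>C\<close>, so \<open>K\<close> disintegrates the measure of \<open>C\<close>.  Regularization may change the value at a given \<open>y\<close>
  in \<open>D\<close>, but only for \<open>s\<close> in a null set: the regularized value is at least the derivative, and both
  have the same integral.
\<close>
lemma copula_kernel_exists:
  fixes C :: "real \<times> real \<Rightarrow> real" and D :: "real set"
  assumes C: "C \<in> copulas" and D: "countable D" "\<And>a b. a < b \<Longrightarrow> \<exists>q\<in>D. a < q \<and> q < b"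
    and diff: "\<And>y. y \<in> D \<Longrightarrow> y \<in> {0<..<1} \<Longrightarrow> AE s in lborel. s \<in> {0<..<1} \<longrightarrow> (\<lambda>t. C (t, y)) differentiable (at s)"
  obtains K where "represents (copula_measure C) C" "is_markov_kernel_of C K" "\<And>s. real_distribution (K s)"
    "\<And>s y. y < 0 \<Longrightarrow> cdf (K s) y = 0" "\<And>s y. y \<ge> 1 \<Longrightarrow> cdf (K s) y = 1"
    "\<And>y. y \<in> D \<Longrightarrow> y \<in> {0<..<1} \<Longrightarrow> AE s in lborel. s \<in> {0<..<1} \<longrightarrow> ((\<lambda>t. C (t, y)) has_real_derivative cdf (K s) y) (at s)"
proof -
  have "AE s in lborel. \<forall>y\<in>D \<inter> {0<..<1}. s \<in> {0<..<1} \<longrightarrow> (\<lambda>t. C (t, y)) differentiable (at s)"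
    using D(1) diff by (subst AE_ball_countable) auto
  then obtain N where N: "N \<in> null_sets lborel"
    "\<And>s y. s \<notin> N \<Longrightarrow> y \<in> D \<Longrightarrow> y \<in> {0<..<1} \<Longrightarrow> s \<in> {0<..<1} \<Longrightarrow> (\<lambda>t. C (t, y)) differentiable (at s)"
    by (auto elim!: AE_E3)
  have [measurable]: "N \<in> sets borel" using N(1) by auto
  \<comment> \<open>Outside \<open>good\<close> the kernel is the point mass at \<open>0\<close>.\<close>
  define good where "good = {0<..<1} - N"
  have [measurable]: "good \<in> sets borel" by (simp add: good_def)
  define h where "h s q = (if q \<le> 0 then 0 else if q \<ge> 1 \<or> s \<notin> good then 1 else copula_deriv C q s)" for s q
  have h_meas [measurable]: "(\<lambda>s. h s q) \<in> borel_measurable borel" for q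
  proof (cases "0 < q \<and> q < 1")
    case True
    then have [measurable]: "copula_deriv C q \<in> borel_measurable borel" by (intro copula_deriv_measurable[OF C]) auto
    show ?thesis unfolding h_def by measurable
  qed (auto simp: h_def)
  have h_range: "0 \<le> h s q \<and> h s q \<le> 1" if "q \<in> D" for s q
    using that copula_deriv_bounds[OF C, of q s] N(2)[of s q] by (auto simp: h_def good_def)
  have h_mono: "h s p \<le> h s q" if "p \<in> D" "q \<in> D" "p \<le> q" for s p q
    using that h_range[of p s] h_range[of q s] copula_deriv_mono[OF C, of p q s] N(2)[of s p] N(2)[of s q]
    by (auto simp: h_def good_def)
  define F where "F s y = Inf (h s ` (D \<inter> {y<..}))" for s y
  define K where "K s = interval_measure (F s)" for s
  have K: "real_distribution (K s)" "cdf (K s) = F s" for s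
    unfolding K_def F_def by (rule real_distribution_from_dense[where D=D and h="h s", OF D(2) h_mono]; simp add: h_def)+
  have F_le: "F s y \<le> h s q" if "q \<in> D" "y < q" for s y q
    unfolding F_def by (rule real_distribution_from_dense(3)[where D=D and h="h s", OF D(2) h_mono]) (simp_all add: h_def that)
  have le_F: "h s q \<le> F s y" if "q \<in> D" "q \<le> y" for s y q
    unfolding F_def by (rule real_distribution_from_dense(4)[where D=D and h="h s", OF D(2) h_mono]) (simp_all add: h_def that)
  have F_lim: "(\<lambda>n. h s (qs n)) \<longlonglongrightarrow> F s y" if "\<And>n. qs n \<in> D \<and> y < qs n" "qs \<longlonglongrightarrow> y" for s y qs
    unfolding F_def by (rule real_distribution_from_dense(5)[where D=D and h="h s", OF D(2) h_mono]) (simp_all add: h_def that)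
  have F0: "F s y = 0" if "y < 0" for s y
    unfolding F_def by (rule real_distribution_from_dense(6)[where D=D and h="h s", OF D(2) h_mono]) (simp_all add: h_def that)
  have F1: "F s y = 1" if "y \<ge> 1" for s y
    unfolding F_def by (rule real_distribution_from_dense(7)[where D=D and h="h s", OF D(2) h_mono]) (simp_all add: h_def that)
  have F_meas [measurable]: "(\<lambda>s. F s y) \<in> borel_measurable borel" for y
    unfolding F_def using D(1) D(2)[of y "y + 1"] h_range
    by (intro borel_measurable_cINF) (auto intro!: bdd_belowI2[of _ 0] countable_Int1)
  have F_range: "0 \<le> F s y \<and> F s y \<le> 1" for s y
    using real_distribution.cdf_bounded_prob[OF K(1), of s y] finite_borel_measure.cdf_nonneg[of "K s" y] K(2)[of s] real_distribution.finite_borel_measure_M[OF K(1)]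
    by auto
  have ae_good: "AE s in lborel. s \<in> {0<..<1} \<longrightarrow> s \<in> good"
    using AE_not_in[OF N(1)] by eventually_elim (auto simp: good_def)
  have ae01: "AE s in lborel. s \<noteq> (0::real) \<and> s \<noteq> 1" by (intro AE_conjI AE_lborel_singleton)
  have int_h: "(\<integral>s. indicator {0..x} s * h s q \<partial>lborel) = C (x, q)" "integrable lborel (\<lambda>s. indicator {0..x} s * h s q)"
    if q: "q \<in> D" "0 < q" "q < 1" and x: "x \<in> {0..1}" for q x
  proof -
    have ae: "AE s in lborel. indicator {0..x} s * h s q = indicator {0..x} s * copula_deriv C q s"
      using ae_good ae01 by eventually_elim (use x q in \<open>auto simp: h_def indicator_def\<close>)
    have q': "q \<in> {0..1}" using q by auto
    note [measurable] = copula_deriv_measurable[OF C q']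
    have d: "AE s in lborel. s \<in> {0<..<1} \<longrightarrow> (\<lambda>t. C (t, q)) differentiable (at s)"
      using diff[of q] q by auto
    show "(\<integral>s. indicator {0..x} s * h s q \<partial>lborel) = C (x, q)"
      using copula_deriv_integral(2)[OF C q' d x] integral_cong_AE[OF _ _ ae] by simp
    show "integrable lborel (\<lambda>s. indicator {0..x} s * h s q)"
      using copula_deriv_integral(1)[OF C q' d x] integrable_cong_AE[OF _ _ ae] by simp
  qed
  have ind: "integrable lborel (\<lambda>s. indicator {0..x} s :: real)" if "x \<in> {0..1}" for x :: real
    using that by (intro integrable_real_indicator) auto
  have int_F': "integrable lborel (\<lambda>s. indicator {0..x} s * F s y)" if "x \<in> {0..1}" for x y
    by (rule Bochner_Integration.integrable_bound[OF ind[OF that]]) (use F_range in \<open>auto simp: indicator_def\<close>)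
  have int_F: "(\<integral>s. indicator {0..x} s * F s y \<partial>lborel) = C (x, y)" if x: "x \<in> {0..1}" and y: "y \<in> {0..1}" for x y
  proof (cases "y = 1")
    case True
    have "(\<integral>s. indicator {0..x} s * F s y \<partial>lborel) = measure lborel {0..x}"
      unfolding True by (simp add: F1)
    then show ?thesis using x True copulaD(2)[OF C, of x] by simp
  next
    case False
    then have y1: "y < 1" using y by simp
    have "\<exists>q\<in>D. y < q \<and> q < min 1 (y + inverse (real (Suc n)))" for n
      by (rule D(2)) (use y1 in simp)
    then obtain qs where qs: "\<And>n. qs n \<in> D \<and> y < qs n \<and> qs n < min 1 (y + inverse (real (Suc n)))" by metis
    have qs_lim: "qs \<longlonglongrightarrow> y"
    proof (rule tendsto_sandwich)
      show "\<forall>\<^sub>F n in sequentially. y \<le> qs n" "\<forall>\<^sub>F n in sequentially. qs n \<le> y + inverse (real (Suc n))"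
        using qs by (auto intro!: always_eventually less_imp_le)
      show "(\<lambda>n. y + inverse (real (Suc n))) \<longlonglongrightarrow> y" using tendsto_add[OF tendsto_const LIMSEQ_inverse_real_of_nat, of y] by simp
    qed simp
    have "(\<lambda>n. \<integral>s. indicator {0..x} s * h s (qs n) \<partial>lborel) \<longlonglongrightarrow> (\<integral>s. indicator {0..x} s * F s y \<partial>lborel)"
    proof (rule integral_dominated_convergence[OF _ _ ind[OF x]])
      show "AE s in lborel. (\<lambda>n. indicator {0..x} s * h s (qs n)) \<longlonglongrightarrow> indicator {0..x} s * F s y"
        using qs qs_lim by (auto intro!: tendsto_intros F_lim)
      show "AE s in lborel. norm (indicator {0..x} s * h s (qs n)) \<le> indicator {0..x} s" for n
        using h_range[of "qs n"] qs by (auto simp: indicator_def)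
    qed measurable
    moreover have "(\<integral>s. indicator {0..x} s * h s (qs n) \<partial>lborel) = C (x, qs n)" for n
      using qs[of n] y x by (intro int_h) auto
    moreover have "(\<lambda>n. C (x, qs n)) \<longlonglongrightarrow> C (x, y)"
    proof (rule tendsto_sandwich)
      have *: "C (x, y) \<le> C (x, qs n) \<and> C (x, qs n) \<le> C (x, y) + (qs n - y)" for n
        using copula_increment(3,4)[OF C, of y "qs n" x] qs[of n] x y by auto
      then show "\<forall>\<^sub>F n in sequentially. C (x, y) \<le> C (x, qs n)"
        "\<forall>\<^sub>F n in sequentially. C (x, qs n) \<le> C (x, y) + (qs n - y)" by auto
      show "(\<lambda>n. C (x, y) + (qs n - y)) \<longlonglongrightarrow> C (x, y)"
        using tendsto_add[OF tendsto_const tendsto_diff[OF qs_lim tendsto_const], of "C (x, y)" y] by simp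
    qed simp
    ultimately show ?thesis using LIMSEQ_unique by simp
  qed
  have K_meas: "K \<in> borel \<rightarrow>\<^sub>M prob_algebra borel"
  proof (rule measurable_prob_algebra_generated[where \<Omega>=UNIV and G="range atMost"])
    show "sets borel = sigma_sets UNIV (range (atMost :: real \<Rightarrow> _))" by (simp add: borel_eq_atMost)
    show "Int_stable (range (atMost :: real \<Rightarrow> _))" by (auto simp: Int_stable_def)
    show "prob_space (K s)" "sets (K s) = sets borel" for s
      using K(1)[of s] by (simp_all add: real_distribution_def real_distribution_axioms_def)
    fix A :: "real set" assume "A \<in> range atMost"
    then obtain a where A: "A = {..a}" by auto
    have "emeasure (K s) A = ennreal (F s a)" for s
      using K(2)[of s] finite_measure.emeasure_eq_measure[of "K s"] real_distribution.finite_borel_measure_M[OF K(1)[of s]]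
      by (simp add: A cdf_def fun_eq_iff finite_borel_measure_def)
    then show "(\<lambda>s. emeasure (K s) A) \<in> borel_measurable borel" by simp
  qed auto
  have sets_K [simp]: "sets (K s) = sets borel" for s by (simp add: K_def)
  have K_prob: "prob_space (K s)" for s using K(1) by (simp add: real_distribution_def)
  have K_Icc: "measure (K s) {0..y} = F s y" if "0 \<le> y" for s y
  proof -
    interpret K: prob_space "K s" by (rule K_prob)
    have "(cdf (K s) \<longlongrightarrow> measure (K s) {..<0}) (at_left 0)"
      using finite_borel_measure.cdf_at_left[OF real_distribution.finite_borel_measure_M[OF K(1)]] .
    moreover have "(cdf (K s) \<longlongrightarrow> 0) (at_left 0)"
      unfolding K(2) by (rule tendsto_eventually) (auto simp: eventually_at_filter F0)
    ultimately have "measure (K s) {..<0} = 0" using tendsto_unique trivial_limit_at_left_real by blast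
    moreover have "{..y} = {..<0} \<union> {0..y}" using that by auto
    moreover have "measure (K s) ({..<0} \<union> {0..y}) = measure (K s) {..<0} + measure (K s) {0..y}"
      by (intro K.finite_measure_Union) auto
    ultimately show ?thesis using K(2)[of s] by (metis cdf_def add_0)
  qed
  define U where "U = density lborel (indicator {0..1::real})"
  have U: "U \<in> space (prob_algebra borel)"
    by (auto simp: U_def space_prob_algebra emeasure_density intro!: prob_spaceI)
  define J where "J s = distr (K s) (borel :: (real \<times> real) measure) (Pair s)" for s
  have J_meas: "J \<in> borel \<rightarrow>\<^sub>M prob_algebra borel"
    unfolding J_def by (rule measurable_distr_prob_space2[OF K_meas]) (simp add: borel_prod)
  define M where "M = U \<bind> J"
  have M_eq: "emeasure M (E \<times> G) = (\<integral>\<^sup>+s\<in>E. emeasure (K s) G \<partial>lborel)"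
    if E: "E \<in> sets borel" "E \<subseteq> {0..1}" and G: "G \<in> sets borel" for E G
  proof -
    have meas: "E \<times> G \<in> sets borel" using E G by (simp add: borel_Times)
    have [measurable]: "Pair s \<in> K s \<rightarrow>\<^sub>M borel" for s :: real
      using borel_measurable_Pair[of "\<lambda>_. s" borel "\<lambda>x. x"] by (simp cong: measurable_cong_sets)
    have J: "emeasure (J s) (E \<times> G) = indicator E s * emeasure (K s) G" for s
      using meas by (auto simp: J_def emeasure_distr indicator_def sets_eq_imp_space_eq[OF sets_K] vimage_def)
    have [measurable]: "(\<lambda>s. emeasure (J s) (E \<times> G)) \<in> borel_measurable borel"
      using measurable_prob_algebraD[OF J_meas] meas by (rule measurable_emeasure_kernel)
    have "emeasure M (E \<times> G) = (\<integral>\<^sup>+s. emeasure (J s) (E \<times> G) \<partial>U)"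
      unfolding M_def by (rule emeasure_bind_prob_algebra[OF U J_meas meas])
    also have "\<dots> = (\<integral>\<^sup>+s. indicator {0..1} s * emeasure (J s) (E \<times> G) \<partial>lborel)"
      unfolding U_def by (rule nn_integral_density) auto
    also have "\<dots> = (\<integral>\<^sup>+s\<in>E. emeasure (K s) G \<partial>lborel)"
      using E(2) by (intro nn_integral_cong) (auto simp: J indicator_def)
    finally show ?thesis .
  qed
  have M_prob: "prob_space M" unfolding M_def by (rule prob_space_bind'[OF U J_meas])
  have M_sets: "sets M = sets borel" unfolding M_def by (rule sets_bind'[OF U J_meas])
  interpret M: prob_space M by (rule M_prob)
  have "measure M ({0..x} \<times> {0..y}) = C (x, y)" if x: "x \<in> {0..1}" and y: "y \<in> {0..1}" for x y
  proof -
    have "ennreal (measure M ({0..x} \<times> {0..y})) = (\<integral>\<^sup>+s\<in>{0..x}. emeasure (K s) {0..y} \<partial>lborel)"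
      using M_eq[of "{0..x}" "{0..y}"] x by (simp add: M.emeasure_eq_measure)
    also have "\<dots> = (\<integral>\<^sup>+s. ennreal (indicator {0..x} s * F s y) \<partial>lborel)"
      using K_Icc y by (intro nn_integral_cong) (auto simp: indicator_def finite_measure.emeasure_eq_measure[OF prob_space.finite_measure[OF K_prob]])
    also have "\<dots> = ennreal (\<integral>s. indicator {0..x} s * F s y \<partial>lborel)"
      using F_range by (intro nn_integral_eq_integral int_F'[OF x]) (auto simp: indicator_def)
    finally show ?thesis using int_F[OF x y] copulaD(1)[OF C, of x y] x y by simp
  qed
  then have rep: "represents M C" using M_prob M_sets by (simp add: represents_def)
  then have CM: "copula_measure C = M" by (rule copula_measure_eq[OF C])
  have kernel: "is_markov_kernel_of C K"
    unfolding is_markov_kernel_of_def CM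
    using measurable_restrict_space1[OF K_meas] K_Icc[of 1] F1 M_eq by auto
  have "AE s in lborel. s \<in> {0<..<1} \<longrightarrow> ((\<lambda>t. C (t, y)) has_real_derivative cdf (K s) y) (at s)"
    if y: "y \<in> D" "y \<in> {0<..<1}" for y
  proof -
    have y': "0 < y" "y < 1" "y \<in> {0..1}" and one: "(1::real) \<in> {0..1}" using y by auto
    have int: "integrable lborel (\<lambda>s. indicator {0..1} s * F s y - indicator {0..1} s * h s y)"
      by (intro Bochner_Integration.integrable_diff int_F'[OF one] int_h(2)[OF y(1) y'(1,2) one])
    have "(\<integral>s. indicator {0..1} s * F s y - indicator {0..1} s * h s y \<partial>lborel) = 0"
      by (subst Bochner_Integration.integral_diff[OF int_F'[OF one] int_h(2)[OF y(1) y'(1,2) one]])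
         (simp add: int_F[OF one y'(3)] int_h(1)[OF y(1) y'(1,2) one])
    moreover have "AE s in lborel. 0 \<le> indicator {0..1} s * F s y - indicator {0..1} s * h s y"
      using le_F[OF y(1) order_refl] by (auto simp: indicator_def)
    ultimately have "AE s in lborel. indicator {0..1} s * F s y - indicator {0..1} s * h s y = 0"
      using integral_nonneg_eq_0_iff_AE[OF int] by simp
    with ae_good diff[OF y] show ?thesis
    proof eventually_elim
      case (elim s)
      show ?case
      proof
        assume s: "s \<in> {0<..<1}"
        with elim obtain d where d: "((\<lambda>t. C (t, y)) has_real_derivative d) (at s)"
          by (auto simp: real_differentiable_def)
        have "F s y = copula_deriv C y s" using elim s y' by (auto simp: h_def indicator_def)
        then show "((\<lambda>t. C (t, y)) has_real_derivative cdf (K s) y) (at s)"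
          using copula_deriv_eq[OF C y'(3) d s] d by (simp add: K(2))
      qed
    qed
  qed
  then show ?thesis
    using that[of K] rep CM kernel K F0 F1 by simp
qed

section \<open>A derivative criterion for weak conditional convergence\<close>

lemma weak_conv_m_dense:
  fixes D :: "real set"
  assumes dense: "\<And>a b. a < b \<Longrightarrow> \<exists>q\<in>D. a < q \<and> q < b"
    and M: "\<And>n. real_distribution (Ms n)" "real_distribution M"
    and lim: "\<And>q. q \<in> D \<Longrightarrow> (\<lambda>n. cdf (Ms n) q) \<longlonglongrightarrow> cdf M q"
  shows "weak_conv_m Ms M"
  unfolding weak_conv_m_def weak_conv_def
proof (intro allI impI)
  fix x assume cont: "isCont (cdf M) x"
  note mono = finite_borel_measure.cdf_nondecreasing[OF real_distribution.finite_borel_measure_M]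
  show "(\<lambda>n. cdf (Ms n) x) \<longlonglongrightarrow> cdf M x"
  proof (rule order_tendstoI)
    fix a assume "a < cdf M x"
    with cont obtain d where d: "d > 0" "\<And>y. \<bar>y - x\<bar> < d \<Longrightarrow> a < cdf M y"
      unfolding isCont_def using order_tendstoD(1)[of "cdf M" "cdf M x" "at x" a]
      by (auto simp: eventually_at dist_real_def) (metis abs_zero diff_self)
    obtain q where q: "q \<in> D" "x - d < q" "q < x" using dense[of "x - d" x] d(1) by auto
    then have "a < cdf M q" by (intro d) auto
    from order_tendstoD(1)[OF lim[OF q(1)] this]
    show "\<forall>\<^sub>F n in sequentially. a < cdf (Ms n) x"
      by eventually_elim (erule order_less_le_trans, rule mono[OF M(1)], use q in simp)
  next
    fix a assume "cdf M x < a"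
    with cont obtain d where d: "d > 0" "\<And>y. \<bar>y - x\<bar> < d \<Longrightarrow> cdf M y < a"
      unfolding isCont_def using order_tendstoD(2)[of "cdf M" "cdf M x" "at x" a]
      by (auto simp: eventually_at dist_real_def) (metis abs_zero diff_self)
    obtain q where q: "q \<in> D" "x < q" "q < x + d" using dense[of x "x + d"] d(1) by auto
    then have "cdf M q < a" by (intro d) auto
    from order_tendstoD(2)[OF lim[OF q(1)] this]
    show "\<forall>\<^sub>F n in sequentially. cdf (Ms n) x < a"
      by eventually_elim (erule order_le_less_trans[rotated], rule mono[OF M(1)], use q in simp)
  qed
qed

text \<open>
  Conditional distribution functions are partial derivatives almost everywhere, and convergence of
  distribution functions on a dense set is weak convergence.  Since \<open>D\<close> is countable, the exceptional
  null sets can be joined.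
\<close>
theorem weak_cond_conv_derivatives:
  fixes D :: "real set"
  assumes Cs: "\<And>n. Cs n \<in> copulas" and C: "C \<in> copulas"
    and D: "countable D" "\<And>a b. a < b \<Longrightarrow> \<exists>q\<in>D. a < q \<and> q < b"
    and lim: "\<And>y. y \<in> D \<Longrightarrow> y \<in> {0<..<1} \<Longrightarrow> AE s in lborel. s \<in> {0<..<1} \<longrightarrow>
       (\<forall>n. (\<lambda>t. Cs n (t, y)) differentiable (at s)) \<and> (\<lambda>t. C (t, y)) differentiable (at s) \<and>
       (\<lambda>n. deriv (\<lambda>t. Cs n (t, y)) s) \<longlonglongrightarrow> deriv (\<lambda>t. C (t, y)) s"
  shows "weak_cond_conv Cs C"
proof -
  define ker where "ker B K \<longleftrightarrow> is_markov_kernel_of B K \<and> (\<forall>s. real_distribution (K s)) \<and>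
      (\<forall>s y. y < 0 \<longrightarrow> cdf (K s) y = 0) \<and> (\<forall>s y. y \<ge> 1 \<longrightarrow> cdf (K s) y = 1) \<and>
      (\<forall>y\<in>D \<inter> {0<..<1}. AE s in lborel. s \<in> {0<..<1} \<longrightarrow> ((\<lambda>t. B (t, y)) has_real_derivative cdf (K s) y) (at s))"
    for B and K :: "real \<Rightarrow> real measure"
  have ex: "\<exists>K. ker B K"
    if "B \<in> copulas" and diff: "\<And>y. y \<in> D \<Longrightarrow> y \<in> {0<..<1} \<Longrightarrow> AE s in lborel. s \<in> {0<..<1} \<longrightarrow> (\<lambda>t. B (t, y)) differentiable (at s)" for B
    unfolding ker_def by (rule copula_kernel_exists[OF that(1) D diff]) blast+
  have "\<forall>n. \<exists>K. ker (Cs n) K"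
    by (intro allI ex Cs) (auto elim!: eventually_mono dest!: lim)
  then obtain Ks where "\<And>n. ker (Cs n) (Ks n)" by metis
  then have Ks: "\<And>n. is_markov_kernel_of (Cs n) (Ks n)" "\<And>n s. real_distribution (Ks n s)"
      "\<And>n s y. y < 0 \<Longrightarrow> cdf (Ks n s) y = 0" "\<And>n s y. y \<ge> 1 \<Longrightarrow> cdf (Ks n s) y = 1"
      "\<And>n y. y \<in> D \<inter> {0<..<1} \<Longrightarrow> AE s in lborel. s \<in> {0<..<1} \<longrightarrow> ((\<lambda>t. Cs n (t, y)) has_real_derivative cdf (Ks n s) y) (at s)"
    by (auto simp: ker_def)
  have "\<exists>K. ker C K"
    by (intro ex C) (auto elim!: eventually_mono dest!: lim)
  then obtain K where "ker C K" by blast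
  then have K: "is_markov_kernel_of C K" "\<And>s. real_distribution (K s)"
      "\<And>s y. y < 0 \<Longrightarrow> cdf (K s) y = 0" "\<And>s y. y \<ge> 1 \<Longrightarrow> cdf (K s) y = 1"
      "\<And>y. y \<in> D \<inter> {0<..<1} \<Longrightarrow> AE s in lborel. s \<in> {0<..<1} \<longrightarrow> ((\<lambda>t. C (t, y)) has_real_derivative cdf (K s) y) (at s)"
    by (auto simp: ker_def)
  have "AE s in lborel. s \<in> {0<..<1} \<longrightarrow> (\<lambda>n. cdf (Ks n s) y) \<longlonglongrightarrow> cdf (K s) y" if y: "y \<in> D \<inter> {0<..<1}" for y
  proof -
    have "AE s in lborel. \<forall>n. s \<in> {0<..<1} \<longrightarrow> ((\<lambda>t. Cs n (t, y)) has_real_derivative cdf (Ks n s) y) (at s)"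
      unfolding AE_all_countable using Ks(5)[OF y] by blast
    from this K(5)[OF y] lim[OF IntD1[OF y] IntD2[OF y]] show ?thesis
    proof eventually_elim
      case (elim s)
      show ?case
      proof
        assume s: "s \<in> {0<..<1}"
        have "deriv (\<lambda>t. Cs n (t, y)) s = cdf (Ks n s) y" for n using elim s by (intro DERIV_imp_deriv) auto
        moreover have "deriv (\<lambda>t. C (t, y)) s = cdf (K s) y" using elim s by (intro DERIV_imp_deriv) auto
        ultimately show "(\<lambda>n. cdf (Ks n s) y) \<longlonglongrightarrow> cdf (K s) y" using elim s by simp
      qed
    qed
  qed
  then have "AE s in lborel. \<forall>y\<in>D \<inter> {0<..<1}. s \<in> {0<..<1} \<longrightarrow> (\<lambda>n. cdf (Ks n s) y) \<longlonglongrightarrow> cdf (K s) y"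
    using D(1) by (subst AE_ball_countable) auto
  then obtain N where N: "N \<in> null_sets lborel"
    "\<And>s y. s \<notin> N \<Longrightarrow> y \<in> D \<inter> {0<..<1} \<Longrightarrow> s \<in> {0<..<1} \<Longrightarrow> (\<lambda>n. cdf (Ks n s) y) \<longlonglongrightarrow> cdf (K s) y"
    by (auto elim!: AE_E3)
  define \<Lambda> where "\<Lambda> = {0<..<1} - N"
  have "weak_conv_m (\<lambda>n. Ks n s) (K s)" if s: "s \<in> \<Lambda>" for s
  proof (rule weak_conv_m_dense[where D="(D \<inter> {0<..<1}) \<union> {..<0} \<union> {1..}"])
    fix a b :: real assume "a < b"
    consider "a < 0" | "b > 1" | "0 \<le> a" "b \<le> 1" by linarith
    then show "\<exists>q\<in>D \<inter> {0<..<1} \<union> {..<0} \<union> {1..}. a < q \<and> q < b"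
    proof cases
      case 1
      then obtain q where "a < q" "q < min b 0" using dense[of a "min b 0"] \<open>a < b\<close> by auto
      then show ?thesis by auto
    next
      case 2
      then obtain q where "max a 1 < q" "q < b" using dense[of "max a 1" b] \<open>a < b\<close> by auto
      then show ?thesis by auto
    next
      case 3
      obtain q where "q \<in> D" "a < q" "q < b" using D(2)[OF \<open>a < b\<close>] by blast
      then show ?thesis using 3 by auto
    qed
  next
    fix q assume "q \<in> D \<inter> {0<..<1} \<union> {..<0} \<union> {1..}"
    then show "(\<lambda>n. cdf (Ks n s) q) \<longlonglongrightarrow> cdf (K s) q"
      using N(2)[of s q] s by (auto simp: \<Lambda>_def Ks K)
  qed (use Ks K in auto)
  moreover have "\<Lambda> \<in> sets borel" "\<Lambda> \<subseteq> {0..1}" using N(1) by (auto simp: \<Lambda>_def)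
  moreover have "emeasure lborel \<Lambda> = 1" unfolding \<Lambda>_def using emeasure_Diff_null_set[OF N(1), of "{0<..<1}"] by simp
  ultimately show ?thesis unfolding weak_cond_conv_def using Ks(1) K(1) by blast
qed

section \<open>Archimax copulas depend continuously on generator and Pickands function\<close>

text \<open>
  A translate of the rationals works: only countably many translates meet \<open>B\<close>.
\<close>
lemma countable_avoiding_dense:
  fixes B :: "real set"
  assumes "countable B"
  obtains D where "countable D" "\<And>a b. a < b \<Longrightarrow> \<exists>q\<in>D. a < q \<and> q < b" "D \<inter> B = {}"
proof -
  have "countable ((\<lambda>(b, q). b - of_rat q) ` (B \<times> (UNIV :: rat set)))" using assms by auto
  then obtain c where c: "c \<notin> (\<lambda>(b, q). b - of_rat q) ` (B \<times> (UNIV :: rat set))"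
    using uncountable_UNIV_real by (metis UNIV_eq_I)
  show thesis
  proof
    show "countable (range (\<lambda>q. c + of_rat q))" by simp
    show "\<exists>q\<in>range (\<lambda>q. c + of_rat q). a < q \<and> q < b" if "a < b" for a b
    proof -
      obtain q where "a - c < of_rat q" "of_rat q < b - c" using of_rat_dense[of "a - c" "b - c"] \<open>a < b\<close> by auto
      then show ?thesis by (intro bexI[of _ "c + of_rat q"]) auto
    qed
    show "range (\<lambda>q. c + of_rat q) \<inter> B = {}"
    proof (rule ccontr)
      assume "range (\<lambda>q. c + of_rat q) \<inter> B \<noteq> {}"
      then obtain q where "c + of_rat q \<in> B" by auto
      then have "(\<lambda>(b, q). b - of_rat q) (c + of_rat q, q) \<in> (\<lambda>(b, q). b - of_rat q) ` (B \<times> (UNIV :: rat set))" by blast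
      with c show False by simp
    qed
  qed
qed

lemma generator_convergence:
  assumes \<psi>s: "\<And>n. \<psi>s n \<in> generators" and \<psi>: "\<psi> \<in> generators"
    and lim: "\<And>z. z > 0 \<Longrightarrow> (\<lambda>n. \<psi>s n z) \<longlonglongrightarrow> \<psi> z"
  shows "zs \<longlonglongrightarrow> z \<Longrightarrow> z > 0 \<Longrightarrow> (\<lambda>n. \<psi>s n (zs n)) \<longlonglongrightarrow> \<psi> z"
    "x \<in> {0<..<1} \<Longrightarrow> (\<lambda>n. gen_inv (\<psi>s n) x) \<longlonglongrightarrow> gen_inv \<psi> x"
proof -
  have anti: "antimono_on {0<..} (\<psi>s n)" for n
    using generatorsD(2)[OF \<psi>s] by (rule monotone_on_subset) auto
  show "zs \<longlonglongrightarrow> z \<Longrightarrow> z > 0 \<Longrightarrow> (\<lambda>n. \<psi>s n (zs n)) \<longlonglongrightarrow> \<psi> z"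
    by (rule antimono_limit_moving_argument[OF anti lim _ generator_isCont[OF \<psi>]])
  assume x: "x \<in> {0<..<1}"
  then have i: "gen_inv \<psi> x > 0" "\<psi> (gen_inv \<psi> x) = x" "\<And>n. gen_inv (\<psi>s n) x > 0" "\<And>n. \<psi>s n (gen_inv (\<psi>s n) x) = x"
    using gen_inv[OF \<psi>] gen_inv[OF \<psi>s] by auto
  show "(\<lambda>n. gen_inv (\<psi>s n) x) \<longlonglongrightarrow> gen_inv \<psi> x"
  proof (rule antimono_limit_inverse[OF anti lim i(1) _ _ i(3)])
    show "\<psi> (gen_inv \<psi> x) < \<psi> z" if "0 < z" "z < gen_inv \<psi> x" for z
    proof -
      have "\<psi> z \<ge> x" using monotone_onD[OF generatorsD(2)[OF \<psi>], of z "gen_inv \<psi> x"] that i by auto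
      then show ?thesis using generator_strict[OF \<psi>, of z "gen_inv \<psi> x"] that x by auto
    qed
    show "\<psi> z < \<psi> (gen_inv \<psi> x)" if "gen_inv \<psi> x < z" for z
      using generator_strict[OF \<psi> _ that] i x by auto
  qed (simp_all add: i)
qed

text \<open>
  Restricting to a neighbourhood of \<open>gen_inv \<psi> x\<close> where \<open>\<psi>\<close> is positive makes \<open>gen_inv \<psi>\<close> a genuine
  inverse.
\<close>
lemma gen_inv_isCont:
  assumes \<psi>: "\<psi> \<in> generators" and x: "0 < x" "x < 1"
  shows "isCont (gen_inv \<psi>) x"
proof -
  let ?u = "gen_inv \<psi> x"
  obtain a b where ab: "0 < a" "a < ?u" "?u < b" "\<psi> b > 0"
  proof -
    have "eventually (\<lambda>z. \<psi> z > 0) (at ?u)"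
      using order_tendstoD(1)[of \<psi> x "at ?u" 0] generator_isCont[OF \<psi> gen_inv(1)[OF \<psi> x]] gen_inv(2)[OF \<psi> x] x
      by (simp add: isCont_def)
    then obtain d where "d > 0" "\<And>z. z \<noteq> ?u \<Longrightarrow> dist z ?u < d \<Longrightarrow> \<psi> z > 0"
      unfolding eventually_at by blast
    then show thesis using gen_inv(1)[OF \<psi> x] by (intro that[of "?u / 2" "?u + d / 2"]) (auto simp: dist_real_def)
  qed
  have "isCont (gen_inv \<psi>) (\<psi> ?u)"
  proof (rule isCont_inverse_function2[of a ?u b])
    fix z assume z: "a \<le> z" "z \<le> b"
    have "\<psi> b \<le> \<psi> z" using monotone_onD[OF generatorsD(2)[OF \<psi>], of z b] z ab by auto
    then show "gen_inv \<psi> (\<psi> z) = z" using z ab by (intro gen_inv_unique[OF \<psi>]) auto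
    show "isCont \<psi> z" using z ab by (intro generator_isCont[OF \<psi>]) auto
  qed (use ab in auto)
  then show ?thesis using gen_inv(2)[OF \<psi> x] by simp
qed

lemma generator_derivative_nonzero:
  assumes \<psi>: "\<psi> \<in> generators" and u: "0 < u" "\<psi> u > 0" and d: "(\<psi> has_real_derivative d) (at u)"
  shows "d \<noteq> 0"
proof
  assume "d = 0"
  have "\<psi> (u + 1) - \<psi> u \<ge> d * (u + 1 - u)"
    by (rule convex_on_imp_above_tangent[OF generatorsD(3)[OF \<psi>]])
       (use u d in \<open>auto intro: has_field_derivative_at_within\<close>)
  moreover have "\<psi> (u + 1) < \<psi> u" by (rule generator_strict[OF \<psi>]) (use u in auto)
  ultimately show False using \<open>d = 0\<close> by simp
qed

lemma archimax_derivative: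
  assumes \<psi>: "\<psi> \<in> generators" and A: "A \<in> pickands" and xy: "0 < x" "x < 1" "0 < y" "y < 1"
  defines "u \<equiv> gen_inv \<psi> x" and "v \<equiv> gen_inv \<psi> y"
  assumes a: "(\<psi> has_real_derivative a) (at u)"
    and b: "(\<psi> has_real_derivative b) (at (stable_tail A u v))"
    and c: "((\<lambda>u. stable_tail A u v) has_real_derivative c) (at u)"
  shows "((\<lambda>t. archimax \<psi> A (t, y)) has_real_derivative (b * (c * inverse a))) (at x)"
proof (rule has_field_derivative_transform_within_open)
  have u: "u > 0" "\<psi> u = x" using gen_inv[OF \<psi>] xy by (auto simp: u_def)
  have "a \<noteq> 0" by (rule generator_derivative_nonzero[OF \<psi> u(1) _ a]) (use u xy in simp)
  then have "(gen_inv \<psi> has_real_derivative inverse a) (at x)"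
    using a gen_inv(2)[OF \<psi>] gen_inv_isCont[OF \<psi>] xy unfolding u_def
    by (intro DERIV_inverse_function[where f=\<psi> and a=0 and b=1]) auto
  then show "((\<lambda>t. \<psi> (stable_tail A (gen_inv \<psi> t) v)) has_real_derivative (b * (c * inverse a))) (at x)"
    by (intro DERIV_chain2[where f=\<psi> and g="\<lambda>t. stable_tail A (gen_inv \<psi> t) v", OF b[unfolded u_def]]
        DERIV_chain2[where f="\<lambda>u. stable_tail A u v" and g="gen_inv \<psi>", OF c[unfolded u_def]])
  show "\<psi> (stable_tail A (gen_inv \<psi> t) v) = archimax \<psi> A (t, y)" if "t \<in> {0<..<1}" for t
    using archimax_interior[of t y] that xy by (simp add: v_def)
qed (use xy in auto)

text \<open>
  The three differentiability requirements of the chain rule for \<open>C (_, y)\<close> at \<open>x\<close>.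
\<close>
definition regular_point :: "(real \<Rightarrow> real) \<Rightarrow> (real \<Rightarrow> real) \<Rightarrow> real \<Rightarrow> real \<Rightarrow> bool" where
  "regular_point \<psi> A x y \<longleftrightarrow> \<psi> differentiable (at (gen_inv \<psi> x)) \<and>
     \<psi> differentiable (at (stable_tail A (gen_inv \<psi> x) (gen_inv \<psi> y))) \<and>
     (\<lambda>u. stable_tail A u (gen_inv \<psi> y)) differentiable (at (gen_inv \<psi> x))"

lemma countable_generator_kinks:
  assumes "\<psi> \<in> generators"
  shows "countable {z. z > 0 \<and> \<not> \<psi> differentiable (at z)}"
proof -
  have "convex_on {0<..} \<psi>" by (rule convex_on_subset[OF generatorsD(3)[OF assms]]) auto
  from convex_countable_not_differentiable[OF _ _ this] show ?thesis by simp
qed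

text \<open>
  Since \<open>\<ell> _ v\<close> is convex and starts at its minimum \<open>v\<close>, it is strictly increasing once it has left
  that value.
\<close>
lemma stable_tail_level_set:
  assumes A: "A \<in> pickands" and "v > 0" "w > v" "0 < a" "0 < b" "stable_tail A a v = w" "stable_tail A b v = w"
  shows "a = b"
proof -
  have "False" if "0 < a" "a < b" "stable_tail A a v = w" "stable_tail A b v = w" for a b
  proof -
    have "(stable_tail A 0 v - stable_tail A a v) / (0 - a) \<le> (stable_tail A a v - stable_tail A b v) / (a - b)"
      using convex_on_slope_le[OF stable_tail_convex[OF A assms(2)], of 0 b a] that by auto
    moreover have "(v - w) / (0 - a) > 0" using that assms by (intro divide_neg_neg) auto
    ultimately show False using that stable_tail_zero[OF A, of v] by simp
  qed
  then show ?thesis using assms by (metis linorder_neqE_linordered_idom)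
qed

text \<open>
  Kinks of \<open>\<psi>\<close> and of \<open>\<ell> _ v\<close> are countable.  A kink of \<open>\<psi>\<close> is hit by \<open>\<ell> _ v\<close> at most once, unless
  it is the value \<open>v\<close>, which \<open>\<ell> _ v\<close> may take on a whole interval; that value is excluded by the
  hypothesis on \<open>y\<close>.
\<close>
lemma countable_irregular_points:
  assumes \<psi>: "\<psi> \<in> generators" and A: "A \<in> pickands" and y: "0 < y" "y < 1"
    and diff: "\<psi> differentiable (at (gen_inv \<psi> y))"
  shows "countable {x \<in> {0<..<1}. \<not> regular_point \<psi> A x y}"
proof -
  let ?i = "gen_inv \<psi>"
  define v where "v = ?i y"
  have v: "v > 0" "\<psi> differentiable (at v)" using gen_inv[OF \<psi> y] diff by (auto simp: v_def)
  let ?l = "\<lambda>u. stable_tail A u v"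
  define N where "N = {z. z > 0 \<and> \<not> \<psi> differentiable (at z)}"
  have N: "countable N" unfolding N_def by (rule countable_generator_kinks[OF \<psi>])
  define L where "L = {u. u > 0 \<and> \<not> ?l differentiable (at u)}"
  have "convex_on {0<..} ?l" by (rule convex_on_subset[OF stable_tail_convex[OF A v(1)]]) auto
  from convex_countable_not_differentiable[OF _ _ this] have "countable L" by (simp add: L_def)
  moreover have "countable {u. u > 0 \<and> ?l u \<in> N}"
  proof (rule countable_image_inj_on)
    have "?l ` {u. u > 0 \<and> ?l u \<in> N} \<subseteq> N" by auto
    then show "countable (?l ` {u. u > 0 \<and> ?l u \<in> N})" using N countable_subset by blast
    show "inj_on ?l {u. u > 0 \<and> ?l u \<in> N}"
    proof (rule inj_onI)
      fix a b assume "a \<in> {u. u > 0 \<and> ?l u \<in> N}" "b \<in> {u. u > 0 \<and> ?l u \<in> N}" "?l a = ?l b"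
      then have *: "0 < a" "0 < b" "?l a \<in> N" "?l a = ?l b" by auto
      have "?l a \<noteq> v" using * v(2) by (auto simp: N_def)
      then have "?l a > v" using stable_tail_bounds(2)[OF A, of a v] * v by simp
      then show "a = b" using stable_tail_level_set[OF A v(1)] * by metis
    qed
  qed
  ultimately have "countable (N \<union> L \<union> {u. u > 0 \<and> ?l u \<in> N})" using N by simp
  moreover have "{x \<in> {0<..<1}. \<not> regular_point \<psi> A x y} \<subseteq> \<psi> ` (N \<union> L \<union> {u. u > 0 \<and> ?l u \<in> N})"
  proof
    fix x assume x: "x \<in> {x \<in> {0<..<1}. \<not> regular_point \<psi> A x y}"
    then have u: "?i x > 0" "\<psi> (?i x) = x" using gen_inv[OF \<psi>] by auto
    moreover have "?l (?i x) > 0" using stable_tail_bounds(2)[OF A, of "?i x" v] u v by simp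
    ultimately have "?i x \<in> N \<union> L \<union> {u. u > 0 \<and> ?l u \<in> N}"
      using x by (auto simp: regular_point_def N_def L_def v_def)
    then show "x \<in> \<psi> ` (N \<union> L \<union> {u. u > 0 \<and> ?l u \<in> N})" using u(2) by force
  qed
  ultimately show ?thesis using countable_subset countable_image by meson
qed

text \<open>
  The heights \<open>y\<close> at which a whole interval of irregular points may occur.
\<close>
definition kink_values :: "(real \<Rightarrow> real) \<Rightarrow> real set" where
  "kink_values \<psi> = \<psi> ` {z. z > 0 \<and> \<not> \<psi> differentiable (at z)}"

lemma countable_kink_values: "\<psi> \<in> generators \<Longrightarrow> countable (kink_values \<psi>)"
  unfolding kink_values_def by (intro countable_image countable_generator_kinks)

lemma ae_regular_point:
  assumes \<psi>: "\<psi> \<in> generators" and A: "A \<in> pickands" and y: "0 < y" "y < 1" "y \<notin> kink_values \<psi>"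
  shows "AE s in lborel. s \<in> {0<..<1} \<longrightarrow> regular_point \<psi> A s y"
proof -
  have "\<psi> differentiable (at (gen_inv \<psi> y))"
    using gen_inv[OF \<psi> y(1,2)] y(3) unfolding kink_values_def
    by (metis (mono_tags, lifting) image_eqI mem_Collect_eq)
  from countable_irregular_points[OF \<psi> A y(1,2) this] show ?thesis
    by (intro AE_I'[OF countable_imp_null_set_lborel]) auto
qed

lemma stable_tail_limit:
  assumes As: "\<And>n. As n \<in> pickands" and lim: "\<And>t. t \<in> {0..1} \<Longrightarrow> (\<lambda>n. As n t) \<longlonglongrightarrow> A t"
    and u: "us \<longlonglongrightarrow> u" "u > 0" and v: "vs \<longlonglongrightarrow> v" "v > 0"
  shows "(\<lambda>n. stable_tail (As n) (us n) (vs n)) \<longlonglongrightarrow> stable_tail A u v"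
proof (rule homogeneous_limit_moving_arguments[OF _ _ _ u v])
  show "stable_tail (As n) a b \<le> stable_tail (As n) c d" if "0 < a" "a \<le> c" "0 < b" "b \<le> d" for n a b c d
    using stable_tail_mono[OF As] that .
  show "stable_tail (As n) (k * a) (k * b) = k * stable_tail (As n) a b" if "0 < k" for n a b k
    using stable_tail_homogeneous[OF that] .
  show "(\<lambda>n. stable_tail (As n) a b) \<longlonglongrightarrow> stable_tail A a b" if "0 < a" "0 < b" for a b
    unfolding stable_tail_def using that by (intro tendsto_intros lim) auto
qed

lemma archimax_limit:
  assumes \<psi>s: "\<And>n. \<psi>s n \<in> generators" and \<psi>: "\<psi> \<in> generators"
    and As: "\<And>n. As n \<in> pickands" and A: "A \<in> pickands"
    and lim\<psi>: "\<And>z. z > 0 \<Longrightarrow> (\<lambda>n. \<psi>s n z) \<longlonglongrightarrow> \<psi> z"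
    and limA: "\<And>t. t \<in> {0..1} \<Longrightarrow> (\<lambda>n. As n t) \<longlonglongrightarrow> A t"
    and xy: "0 < x" "x < 1" "0 < y" "y < 1"
  shows "(\<lambda>n. stable_tail (As n) (gen_inv (\<psi>s n) x) (gen_inv (\<psi>s n) y)) \<longlonglongrightarrow> stable_tail A (gen_inv \<psi> x) (gen_inv \<psi> y)"
    "(\<lambda>n. archimax (\<psi>s n) (As n) (x, y)) \<longlonglongrightarrow> archimax \<psi> A (x, y)"
proof -
  have pos: "gen_inv \<psi> x > 0" "gen_inv \<psi> y > 0" using gen_inv(1)[OF \<psi>] xy by auto
  show 1: "(\<lambda>n. stable_tail (As n) (gen_inv (\<psi>s n) x) (gen_inv (\<psi>s n) y)) \<longlonglongrightarrow> stable_tail A (gen_inv \<psi> x) (gen_inv \<psi> y)"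
    by (intro stable_tail_limit[OF As limA] generator_convergence[OF \<psi>s \<psi> lim\<psi>] pos) (use xy in auto)
  have "stable_tail A (gen_inv \<psi> x) (gen_inv \<psi> y) > 0"
    using stable_tail_bounds(2)[OF A, of "gen_inv \<psi> x" "gen_inv \<psi> y"] pos by simp
  then show "(\<lambda>n. archimax (\<psi>s n) (As n) (x, y)) \<longlonglongrightarrow> archimax \<psi> A (x, y)"
    using generator_convergence(1)[OF \<psi>s \<psi> lim\<psi> 1] archimax_interior xy by simp
qed

text \<open>
  Choose a countable dense set of heights avoiding the kink values of all generators involved.  At such
  a height almost every point is regular for all these copulas at once, and there each factor of the
  chain rule converges.
\<close>
theorem archimax_weak_cond_conv:
  assumes \<psi>s: "\<And>n. \<psi>s n \<in> generators" and \<psi>: "\<psi> \<in> generators"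
    and As: "\<And>n. As n \<in> pickands" and A: "A \<in> pickands"
    and lim\<psi>: "\<And>z. z > 0 \<Longrightarrow> (\<lambda>n. \<psi>s n z) \<longlonglongrightarrow> \<psi> z"
    and limA: "\<And>t. t \<in> {0..1} \<Longrightarrow> (\<lambda>n. As n t) \<longlonglongrightarrow> A t"
  shows "weak_cond_conv (\<lambda>n. archimax (\<psi>s n) (As n)) (archimax \<psi> A)"
proof -
  have "countable (kink_values \<psi> \<union> (\<Union>n. kink_values (\<psi>s n)))"
    using countable_kink_values \<psi> \<psi>s by auto
  then obtain D where D: "countable D" "\<And>a b. a < b \<Longrightarrow> \<exists>q\<in>D. a < q \<and> q < b"
    and avoid: "D \<inter> (kink_values \<psi> \<union> (\<Union>n. kink_values (\<psi>s n))) = {}"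
    using countable_avoiding_dense by blast
  show ?thesis
  proof (rule weak_cond_conv_derivatives[OF _ _ D])
    show "archimax (\<psi>s n) (As n) \<in> copulas" "archimax \<psi> A \<in> copulas" for n
      using archimax_copula \<psi> \<psi>s A As by auto
    fix y assume yD: "y \<in> D" and "y \<in> {0<..<1}"
    then have y: "0 < y" "y < 1" by auto
    have "AE s in lborel. \<forall>n. s \<in> {0<..<1} \<longrightarrow> regular_point (\<psi>s n) (As n) s y"
      unfolding AE_all_countable using ae_regular_point[OF \<psi>s As y] avoid yD by blast
    moreover have "AE s in lborel. s \<in> {0<..<1} \<longrightarrow> regular_point \<psi> A s y"
      using ae_regular_point[OF \<psi> A y] avoid yD by blast
    ultimately show "AE s in lborel. s \<in> {0<..<1} \<longrightarrow>
       (\<forall>n. (\<lambda>t. archimax (\<psi>s n) (As n) (t, y)) differentiable (at s)) \<and> (\<lambda>t. archimax \<psi> A (t, y)) differentiable (at s) \<and>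
       (\<lambda>n. deriv (\<lambda>t. archimax (\<psi>s n) (As n) (t, y)) s) \<longlonglongrightarrow> deriv (\<lambda>t. archimax \<psi> A (t, y)) s"
    proof eventually_elim
      case (elim s)
      show ?case
      proof
        assume "s \<in> {0<..<1}"
        then have s: "0 < s" "s < 1" and R: "\<And>n. regular_point (\<psi>s n) (As n) s y" "regular_point \<psi> A s y"
          using elim by auto
        define us vs zs where "us n = gen_inv (\<psi>s n) s" and "vs n = gen_inv (\<psi>s n) y" and "zs n = stable_tail (As n) (us n) (vs n)" for n
        define u v z where "u = gen_inv \<psi> s" and "v = gen_inv \<psi> y" and "z = stable_tail A u v"
        obtain as where as: "\<And>n. (\<psi>s n has_real_derivative as n) (at (us n))"
          using R(1) unfolding regular_point_def real_differentiable_def us_def by metis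
        obtain bs where bs: "\<And>n. (\<psi>s n has_real_derivative bs n) (at (zs n))"
          using R(1) unfolding regular_point_def real_differentiable_def us_def vs_def zs_def by metis
        obtain cs where cs: "\<And>n. ((\<lambda>u. stable_tail (As n) u (vs n)) has_real_derivative cs n) (at (us n))"
          using R(1) unfolding regular_point_def real_differentiable_def us_def vs_def by metis
        obtain a b c where abc: "(\<psi> has_real_derivative a) (at u)" "(\<psi> has_real_derivative b) (at z)"
            "((\<lambda>u. stable_tail A u v) has_real_derivative c) (at u)"
          using R(2) unfolding regular_point_def real_differentiable_def u_def v_def z_def by metis
        have pos: "us n > 0" "vs n > 0" "\<psi>s n (us n) = s" "u > 0" "v > 0" "\<psi> u = s" for n
          using gen_inv[OF \<psi>s] gen_inv[OF \<psi>] s y by (auto simp: us_def vs_def u_def v_def)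
        have zpos: "zs n > 0" "z > 0" for n
          using stable_tail_bounds(2)[OF As[of n], of "us n" "vs n"] stable_tail_bounds(2)[OF A, of u v] pos(1)[of n] pos(2)[of n] pos(4,5) by (auto simp: zs_def z_def)
        have us: "us \<longlonglongrightarrow> u" and vs: "vs \<longlonglongrightarrow> v"
          using generator_convergence(2)[OF \<psi>s \<psi> lim\<psi>] s y by (auto simp: us_def[abs_def] vs_def[abs_def] u_def v_def)
        have zs: "zs \<longlonglongrightarrow> z"
          using archimax_limit(1)[OF \<psi>s \<psi> As A lim\<psi> limA s y] by (simp add: zs_def[abs_def] us_def vs_def z_def u_def v_def)
        have cvx: "convex_on {0<..} (\<psi>s n)" for n
          by (rule convex_on_subset[OF generatorsD(3)[OF \<psi>s]]) auto
        have as_lim: "as \<longlonglongrightarrow> a"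
          by (rule convex_derivative_limit[of "{0<..}" \<psi>s \<psi> u us]) (use cvx lim\<psi> pos us as abc s in auto)
        have bs_lim: "bs \<longlonglongrightarrow> b"
          by (rule convex_derivative_limit[of "{0<..}" \<psi>s \<psi> z zs])
             (use cvx lim\<psi> zpos zs bs abc generator_convergence(1)[OF \<psi>s \<psi> lim\<psi> zs] in auto)
        have cs_lim: "cs \<longlonglongrightarrow> c"
        proof (rule convex_derivative_limit[of "{0<..}" "\<lambda>n u. stable_tail (As n) u (vs n)" "\<lambda>u. stable_tail A u v" u us])
          show "convex_on {0<..} (\<lambda>u. stable_tail (As n) u (vs n))" for n
            by (rule convex_on_subset[OF stable_tail_convex[OF As pos(2)]]) auto
          show "(\<lambda>n. stable_tail (As n) r (vs n)) \<longlonglongrightarrow> stable_tail A r v" if "r \<in> {0<..}" for r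
            by (rule stable_tail_limit[OF As limA _ _ vs pos(5)]) (use that in auto)
        qed (use zs pos us cs abc in \<open>auto simp: zs_def[abs_def] z_def\<close>)
        have "a \<noteq> 0" using generator_derivative_nonzero[OF \<psi> _ _ abc(1)] pos s by auto
        then have lim: "(\<lambda>n. bs n * (cs n * inverse (as n))) \<longlonglongrightarrow> b * (c * inverse a)"
          by (intro tendsto_intros as_lim bs_lim cs_lim)
        have Dn: "((\<lambda>t. archimax (\<psi>s n) (As n) (t, y)) has_real_derivative bs n * (cs n * inverse (as n))) (at s)" for n
          using archimax_derivative[OF \<psi>s As s y] as bs cs by (simp add: us_def vs_def zs_def)
        have D: "((\<lambda>t. archimax \<psi> A (t, y)) has_real_derivative b * (c * inverse a)) (at s)"
          using archimax_derivative[OF \<psi> A s y] abc by (simp add: u_def v_def z_def)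
        show "(\<forall>n. (\<lambda>t. archimax (\<psi>s n) (As n) (t, y)) differentiable (at s)) \<and> (\<lambda>t. archimax \<psi> A (t, y)) differentiable (at s) \<and>
           (\<lambda>n. deriv (\<lambda>t. archimax (\<psi>s n) (As n) (t, y)) s) \<longlonglongrightarrow> deriv (\<lambda>t. archimax \<psi> A (t, y)) s"
          using Dn D lim unfolding DERIV_imp_deriv[OF Dn] DERIV_imp_deriv[OF D] real_differentiable_def by blast
      qed
    qed
  qed
qed

section \<open>Kendall's tau of extreme-value copulas\<close>

text \<open>
  The logarithms in the definition of an extreme-value copula are the inverse of an exponential
  generator; base \<open>2\<close> yields the normalization \<open>\<psi> 1 = 1 / 2\<close>.
\<close>
lemma ev_copula_eq_archimax:
  fixes A :: "real \<Rightarrow> real"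
  defines "\<psi> \<equiv> \<lambda>z\<in>{0..}. 2 powr (- z)"
  shows "\<psi> \<in> generators" "A \<in> pickands \<Longrightarrow> ev_copula A = archimax \<psi> A"
proof -
  have cvx: "convex_on {0..} (\<lambda>z::real. 2 powr (- z) :: real)"
  proof (rule f''_ge0_imp_convex)
    show "((\<lambda>z. 2 powr (- z) :: real) has_real_derivative (- ln 2 * 2 powr (- z))) (at z)" for z :: real
      by (auto intro!: derivative_eq_intros)
    show "((\<lambda>z. - ln 2 * 2 powr (- z) :: real) has_real_derivative ((ln 2)\<^sup>2 * 2 powr (- z))) (at z)" for z :: real
      by (auto intro!: derivative_eq_intros simp: power2_eq_square)
  qed auto
  have lim: "((\<lambda>z::real. 2 powr (- z) :: real) \<longlongrightarrow> 0) at_top"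
    by real_asymp
  show \<psi>: "\<psi> \<in> generators"
    unfolding generators_def
  proof (intro CollectI conjI)
    have "2 powr (- z) \<le> (1::real)" if "z \<ge> 0" for z :: real
      using powr_mono[of "- z" 0 "2::real"] that by simp
    then show "\<psi> \<in> {0..} \<rightarrow>\<^sub>E {0..1}" by (auto simp: \<psi>_def)
    have "continuous_on {0..} (\<lambda>z::real. 2 powr (- z) :: real)" by (intro continuous_intros) auto
    then show "continuous_on {0..} \<psi>" by (rule continuous_on_eq) (simp add: \<psi>_def)
    show "antimono_on {0..} \<psi>" by (auto simp: \<psi>_def monotone_on_def)
    show "convex_on {0..} \<psi>" using cvx by (auto simp: convex_on_def \<psi>_def)
    show "\<psi> 0 = 1" "\<psi> 1 = 1 / 2" by (auto simp: \<psi>_def powr_minus)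
    show "(\<psi> \<longlongrightarrow> 0) at_top"
      by (rule Lim_transform_eventually[OF lim]) (auto simp: \<psi>_def eventually_at_top_linorder intro!: exI[of _ 0])
    show "strict_antimono_on {z. 0 \<le> z \<and> ennreal z < Inf (ennreal ` {x. 0 \<le> x \<and> \<psi> x = 0})} \<psi>"
      by (auto simp: \<psi>_def monotone_on_def)
  qed
  have inv: "gen_inv \<psi> x = - log 2 x" if "0 < x" "x < 1" for x
    using that by (intro gen_inv_unique[OF \<psi>]) (auto simp: \<psi>_def)
  assume A: "A \<in> pickands"
  show "ev_copula A = archimax \<psi> A"
    unfolding ev_copula_def archimax_def
  proof (rule continuous_extension_cong, clarify)
    fix x y :: real assume "x \<in> {0<..<1}" "y \<in> {0<..<1}"
    then have xy: "0 < x" "x < 1" "0 < y" "y < 1" by auto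
    define u v where "u = enn2real (pseudo_inverse \<psi> x)" and "v = enn2real (pseudo_inverse \<psi> y)"
    have uv: "u = - log 2 x" "v = - log 2 y" using inv xy by (auto simp: u_def v_def gen_inv_def)
    have pos: "u > 0" "v > 0" using xy by (auto simp: uv)
    have sum: "u + v = - log 2 (x * y)" using xy by (simp add: uv log_mult_pos)
    have "u / (u + v) = (ln x / ln 2) / (ln (x * y) / ln 2)" unfolding sum unfolding uv log_def by simp
    then have ratio: "u / (u + v) = ln x / ln (x * y)" by simp
    have t: "0 \<le> u / (u + v)" "u / (u + v) \<le> 1" using pos by auto
    have "A (u / (u + v)) \<ge> 0" using pickandsD(2)[OF A t] t(1) by linarith
    then have "(u + v) * A (u / (u + v)) \<ge> 0" using pos by simp
    then have "\<psi> ((u + v) * A (u / (u + v))) = 2 powr (log 2 (x * y) * A (u / (u + v)))"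
      by (simp add: \<psi>_def sum)
    also have "\<dots> = (x * y) powr A (u / (u + v))" using xy by (simp flip: powr_powr)
    finally show "(x * y) powr A (ln x / ln (x * y)) = (let u = enn2real (pseudo_inverse \<psi> x); v = enn2real (pseudo_inverse \<psi> y)
               in \<psi> ((u + v) * A (u / (u + v))))"
      unfolding ratio[symmetric] by (simp add: Let_def u_def v_def)
  qed
qed

text \<open>
  By convexity, \<open>A\<close> lies below the polygon through \<open>(0, 1)\<close>, \<open>(1/2, 1/2)\<close> and \<open>(1, 1)\<close>, which is the
  lower bound for Pickands functions.
\<close>
lemma pickands_half:
  assumes A: "A \<in> pickands" and half: "A (1 / 2) = 1 / 2"
  shows "A = pickands_M"
proof
  fix t
  note c = convex_onD[OF pickandsD(1)[OF A]]
  show "A t = pickands_M t"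
  proof (cases "t \<in> {0..1}")
    case False
    then show ?thesis using A by (auto simp: pickands_def pickands_M_def PiE_iff extensional_def)
  next
    case True
    have "A t \<le> max t (1 - t)"
    proof (cases "t \<le> 1 / 2")
      case True
      have "A ((1 - 2 * t) *\<^sub>R 0 + (2 * t) *\<^sub>R (1 / 2)) \<le> (1 - 2 * t) * A 0 + 2 * t * A (1 / 2)"
        by (rule c) (use True \<open>t \<in> {0..1}\<close> in auto)
      then show ?thesis using pickandsD(5)[OF A] half by simp
    next
      case False
      have "A ((1 - (2 * t - 1)) *\<^sub>R (1 / 2) + (2 * t - 1) *\<^sub>R 1) \<le> (1 - (2 * t - 1)) * A (1 / 2) + (2 * t - 1) * A 1"
        by (rule c) (use False \<open>t \<in> {0..1}\<close> in auto)
      then show ?thesis using pickandsD(6)[OF A] half by (simp add: algebra_simps)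
    qed
    then show ?thesis using pickandsD(2,3)[OF A, of t] True by (auto simp: pickands_M_def max_def split: if_splits)
  qed
qed

lemma archimax_diagonal:
  assumes \<psi>: "\<psi> \<in> generators" and A: "A \<in> pickands" "A \<noteq> pickands_M" and x: "0 < x" "x < 1"
  shows "archimax \<psi> A (x, x) < x"
proof -
  let ?u = "gen_inv \<psi> x"
  have u: "?u > 0" "\<psi> ?u = x" using gen_inv[OF \<psi> x] by auto
  have "A (1 / 2) > 1 / 2" using pickands_half[OF A(1)] pickandsD(2)[OF A(1), of "1 / 2"] A(2) by fastforce
  then have "stable_tail A ?u ?u > ?u" using u by (simp add: stable_tail_def)
  then have "\<psi> (stable_tail A ?u ?u) < \<psi> ?u" using u x by (intro generator_strict[OF \<psi>]) auto
  then show ?thesis using archimax_interior x u by simp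
qed

lemma archimax_differentiable_ae:
  assumes \<psi>: "\<psi> \<in> generators" and A: "A \<in> pickands"
  obtains D where "countable D" "\<And>a b. a < b \<Longrightarrow> \<exists>q\<in>D. a < q \<and> q < b"
    "\<And>y. y \<in> D \<Longrightarrow> y \<in> {0<..<1} \<Longrightarrow> AE s in lborel. s \<in> {0<..<1} \<longrightarrow> (\<lambda>t. archimax \<psi> A (t, y)) differentiable (at s)"
proof -
  obtain D where D: "countable D" "\<And>a b. a < b \<Longrightarrow> \<exists>q\<in>D. a < q \<and> q < b" "D \<inter> kink_values \<psi> = {}"
    using countable_avoiding_dense[OF countable_kink_values[OF \<psi>]] by blast
  show thesis
  proof (rule that[OF D(1,2)])
    fix y assume "y \<in> D" "y \<in> {0<..<1}"
    then have y: "0 < y" "y < 1" "y \<notin> kink_values \<psi>" using D(3) by auto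
    from ae_regular_point[OF \<psi> A y]
    show "AE s in lborel. s \<in> {0<..<1} \<longrightarrow> (\<lambda>t. archimax \<psi> A (t, y)) differentiable (at s)"
      by eventually_elim
         (use archimax_derivative[OF \<psi> A _ _ y(1,2)] in \<open>auto simp: regular_point_def real_differentiable_def, blast\<close>)
  qed
qed

text \<open>
  Let \<open>(X, Y)\<close> have the law of \<open>C\<close>.  Since \<open>C (x, y) \<le> min x y\<close>, a value of \<open>\<tau>\<close> of at least \<open>1\<close>
  forces \<open>E (min X Y) \<ge> 1/2 = E X\<close>, hence \<open>X \<le> Y\<close> almost surely.  Then \<open>Y \<le> 1/2\<close> implies
  \<open>X \<le> 1/2\<close>, so \<open>C (1/2, 1/2) = P (Y \<le> 1/2) = 1/2\<close>.
\<close>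
lemma kendall_tau_less_one:
  assumes C: "C \<in> copulas" and rep: "represents (copula_measure C) C"
    and kernel: "is_markov_kernel_of C K" and half: "C (1 / 2, 1 / 2) < 1 / 2"
  shows "kendall_tau C < 1"
proof (rule ccontr)
  define M where "M = copula_measure C"
  assume "\<not> kendall_tau C < 1"
  then have ge: "(LINT p:unit_square|M. C p) \<ge> 1 / 2" by (simp add: kendall_tau_def M_def)
  have M: "prob_space M" "sets M = sets borel" "\<And>x y. x \<in> {0..1} \<Longrightarrow> y \<in> {0..1} \<Longrightarrow> measure M ({0..x} \<times> {0..y}) = C (x, y)"
    using rep by (auto simp: represents_def M_def)
  interpret M: prob_space M by (rule M(1))
  have [measurable]: "fst \<in> borel_measurable M" "snd \<in> borel_measurable M"
    unfolding measurable_cong_sets[OF M(2) refl] by (intro borel_measurable_continuous_onI continuous_intros)+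
  have ae_sq: "AE p in M. p \<in> unit_square" unfolding M_def by (rule represents_unit_square[OF C rep])
  have unit: "measure (K x) {0..1} = 1" "prob_space (K x)" if "x \<in> {0..1}" for x
  proof -
    show "measure (K x) {0..1} = 1" using kernel that by (simp add: is_markov_kernel_of_def)
    have "K \<in> restrict_space borel {0..1} \<rightarrow>\<^sub>M prob_algebra borel" using kernel by (simp add: is_markov_kernel_of_def)
    from measurable_space[OF this, of x] that show "prob_space (K x)" by (simp add: space_prob_algebra space_restrict_space)
  qed
  have marg: "emeasure M (E \<times> {0..1}) = emeasure lborel E" if "E \<in> sets borel" "E \<subseteq> {0..1}" for E
  proof -
    have "emeasure M (E \<times> {0..1}) = (\<integral>\<^sup>+x\<in>E. emeasure (K x) {0..1} \<partial>lborel)"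
      using kernel that by (simp add: is_markov_kernel_of_def M_def)
    also have "\<dots> = (\<integral>\<^sup>+x. indicator E x \<partial>lborel)"
      using that unit by (intro nn_integral_cong)
        (auto simp: indicator_def finite_measure.emeasure_eq_measure prob_space.finite_measure)
    also have "\<dots> = emeasure lborel E" using that by simp
    finally show ?thesis .
  qed
  define U where "U = density lborel (indicator {0..1::real})"
  have sets_U: "sets U = sets borel" by (simp add: U_def)
  have distr: "distr M borel fst = U"
  proof (rule measure_eqI)
    fix E assume "E \<in> sets (distr M borel fst)"
    then have E: "E \<in> sets borel" by simp
    have "emeasure (distr M borel fst) E = emeasure M (fst -` E)"
      using E sets_eq_imp_space_eq[OF M(2)] by (subst emeasure_distr) auto
    also have "\<dots> = emeasure M ((E \<inter> {0..1}) \<times> {0..1})"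
    proof (rule emeasure_eq_AE)
      show "AE p in M. p \<in> fst -` E \<longleftrightarrow> p \<in> (E \<inter> {0..1}) \<times> {0..1}"
        using ae_sq by eventually_elim auto
      show "fst -` E \<in> sets M"
        using measurable_sets[of fst M borel E] E sets_eq_imp_space_eq[OF M(2)] by simp
      show "(E \<inter> {0..1}) \<times> {0..1} \<in> sets M" using E unfolding M(2) by (intro borel_Times) auto
    qed
    also have "\<dots> = emeasure lborel (E \<inter> {0..1})" using E by (intro marg) auto
    also have "\<dots> = (\<integral>\<^sup>+x. indicator (E \<inter> {0..1}) x \<partial>lborel)" using E by simp
    also have "\<dots> = (\<integral>\<^sup>+x. indicator {0..1} x * indicator E x \<partial>lborel)"
      by (intro nn_integral_cong) (auto simp: indicator_def)
    also have "\<dots> = emeasure U E" unfolding U_def using E by (intro emeasure_density[symmetric]) auto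
    finally show "emeasure (distr M borel fst) E = emeasure U E" .
  qed (simp add: sets_U)
  \<comment> \<open>The positive part of \<open>X - Y\<close>; clamping makes it bounded on the whole plane.\<close>
  define g where "g p = min 1 (max 0 (fst p)) - min (min 1 (max 0 (fst p))) (min 1 (max 0 (snd p)))" for p :: "real \<times> real"
  have g_nonneg: "g p \<ge> 0" for p unfolding g_def by (simp only: diff_ge_0_iff_ge min.cobounded1)
  have [measurable]: "g \<in> borel_measurable M" unfolding g_def by measurable
  have "g p \<le> 1" for p by (simp add: g_def min_def max_def)
  then have g_int: "integrable M g"
    using g_nonneg by (intro M.integrable_const_bound[of _ 1]) auto
  have X_int: "integrable M (\<lambda>p. min 1 (max 0 (fst p)))"
    by (rule M.integrable_const_bound[of _ 1]) auto
  have X: "(\<integral>p. min 1 (max 0 (fst p)) \<partial>M) = 1 / 2"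
  proof -
    have "(\<integral>p. min 1 (max 0 (fst p)) \<partial>M) = (\<integral>x. min 1 (max 0 x) \<partial>distr M borel fst)"
      by (subst integral_distr) auto
    also have "\<dots> = (\<integral>x. indicator {0..1} x *\<^sub>R (min 1 (max 0 x)) \<partial>lborel)"
      unfolding distr U_def
      by (subst integral_density[of _ _ "indicator {0..1}", simplified ennreal_indicator]) auto
    also have "\<dots> = (\<integral>x. indicator {0..1} x *\<^sub>R x \<partial>lborel)"
      by (intro Bochner_Integration.integral_cong) (auto simp: indicator_def)
    also have "\<dots> = 1\<^sup>2 / 2 - 0\<^sup>2 / 2"
      by (rule integral_FTC_atLeastAtMost) (auto intro!: derivative_eq_intros continuous_intros simp flip: has_real_derivative_iff_has_vector_derivative)
    finally show ?thesis by simp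
  qed
  define c where "c p = indicator unit_square p *\<^sub>R C p" for p
  have [measurable]: "c \<in> borel_measurable M"
  proof -
    have "continuous_on unit_square C"
    proof (rule lipschitz_on_continuous_on[OF lipschitz_onI])
      fix p q :: "real \<times> real" assume "p \<in> unit_square" "q \<in> unit_square"
      then have "\<bar>C p - C q\<bar> \<le> \<bar>fst p - fst q\<bar> + \<bar>snd p - snd q\<bar>"
        using copula_lipschitz[OF C, of "fst p" "fst q" "snd p" "snd q"] by (auto simp: mem_Times_iff)
      also have "\<dots> \<le> 2 * dist p q"
        using dist_fst_le[of p q] dist_snd_le[of p q] by (simp add: dist_real_def)
      finally show "dist (C p) (C q) \<le> 2 * dist p q" by (simp add: dist_real_def)
    qed simp
    then have "c \<in> borel_measurable borel"
      unfolding c_def[abs_def] by (intro borel_measurable_continuous_on_indicator) (auto intro!: borel_closed closed_Times)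
    then show ?thesis by (simp cong: measurable_cong_sets add: M(2))
  qed
  have c_bounds: "0 \<le> c p \<and> c p \<le> 1" for p
    using copulaD(1)[OF C, of "fst p" "snd p"] by (auto simp: c_def indicator_def)
  have c_int: "integrable M c" by (rule M.integrable_const_bound[of _ 1]) (use c_bounds in auto)
  have "(\<integral>p. c p \<partial>M) \<le> (\<integral>p. min 1 (max 0 (fst p)) - g p \<partial>M)"
  proof (rule integral_mono_AE[OF c_int])
    show "AE p in M. c p \<le> min 1 (max 0 (fst p)) - g p"
      using ae_sq
    proof eventually_elim
      case (elim p)
      then have clamp: "min 1 (max 0 (fst p)) = fst p" "min 1 (max 0 (snd p)) = snd p" by auto
      have "C p \<le> min (fst p) (snd p)" using copula_bounds[OF C, of "fst p" "snd p"] elim by auto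
      then show ?case using elim unfolding c_def g_def clamp by simp
    qed
  qed (use X_int g_int in auto)
  also have "\<dots> = 1 / 2 - (\<integral>p. g p \<partial>M)" using X_int g_int X by simp
  finally have "(\<integral>p. g p \<partial>M) \<le> 0" using ge by (simp add: set_lebesgue_integral_def c_def)
  then have "(\<integral>p. g p \<partial>M) = 0" using Bochner_Integration.integral_nonneg[where M=M and f=g] g_nonneg by fastforce
  then have "AE p in M. g p = 0" using integral_nonneg_eq_0_iff_AE[OF g_int] g_nonneg by simp
  with ae_sq have "AE p in M. p \<in> {0..1/2} \<times> {0..1/2} \<longleftrightarrow> p \<in> {0..1} \<times> {0..1/2}"
    by eventually_elim (auto simp: g_def)
  then have "measure M ({0..1/2} \<times> {0..1/2}) = measure M ({0..1} \<times> {0..1/2})"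
    by (intro M.finite_measure_eq_AE) (auto simp: M(2) intro!: borel_closed closed_Times)
  then have "C (1 / 2, 1 / 2) = 1 / 2" using M(3) copulaD(2)[OF C, of "1/2"] by simp
  with half show False by simp
qed

lemma kendall_tau_ev_copula_less_one:
  assumes A: "A \<in> pickands" "A \<noteq> pickands_M"
  shows "kendall_tau (ev_copula A) < 1"
proof -
  obtain \<psi> where \<psi>: "\<psi> \<in> generators" "ev_copula A = archimax \<psi> A"
    using ev_copula_eq_archimax A(1) by blast
  let ?C = "archimax \<psi> A"
  have C: "?C \<in> copulas" by (rule archimax_copula[OF \<psi>(1) A(1)])
  obtain D where D: "countable D" "\<And>a b. a < b \<Longrightarrow> \<exists>q\<in>D. a < q \<and> q < b"
    "\<And>y. y \<in> D \<Longrightarrow> y \<in> {0<..<1} \<Longrightarrow> AE s in lborel. s \<in> {0<..<1} \<longrightarrow> (\<lambda>t. ?C (t, y)) differentiable (at s)"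
    using archimax_differentiable_ae[OF \<psi>(1) A(1)] by blast
  obtain K where "represents (copula_measure ?C) ?C" "is_markov_kernel_of ?C K"
    by (rule copula_kernel_exists[OF C D]) (assumption | rule that)+
  then show ?thesis
    unfolding \<psi>(2) using archimax_diagonal[OF \<psi>(1) A, of "1 / 2"] by (intro kendall_tau_less_one[OF C]) auto
qed

section \<open>Compactness: pointwise convergence of Archimax copulas suffices\<close>

text \<open>
  The restrictions to the rationals lie in a compact metrizable product space, so some subsequence
  converges at all rationals, and the Lipschitz bound makes it Cauchy everywhere else.
\<close>
lemma lipschitz_convergent_subsequence:
  fixes f :: "nat \<Rightarrow> real \<Rightarrow> 'b::complete_space"
  assumes S: "compact S" and range: "\<And>n x. f n x \<in> S"
    and lip: "\<And>n x y. dist (f n x) (f n y) \<le> L * \<bar>x - y\<bar>"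
  obtains r l where "strict_mono (r :: nat \<Rightarrow> nat)" "\<And>x. (\<lambda>n. f (r n) x) \<longlonglongrightarrow> l x"
proof -
  have "compactin (product_topology (\<lambda>i::rat. euclidean) UNIV) (PiE UNIV (\<lambda>i::rat. S))"
    by (simp add: compactin_PiE S)
  then have "compact (PiE UNIV (\<lambda>i::rat. S))" by (simp add: euclidean_product_topology)
  then have "seq_compact (PiE UNIV (\<lambda>i::rat. S))" by (rule compact_imp_seq_compact)
  moreover have "\<forall>n. (\<lambda>q. f n (of_rat q)) \<in> PiE UNIV (\<lambda>i::rat. S)" using range by auto
  ultimately obtain g r where r: "strict_mono r" "((\<lambda>n q. f n (of_rat q)) \<circ> r) \<longlonglongrightarrow> g"
    by (rule seq_compactE)
  have coord: "(\<lambda>n. f (r n) (of_rat q)) \<longlonglongrightarrow> g q" for q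
  proof -
    have "isCont (\<lambda>h :: rat \<Rightarrow> 'b. h q) g"
      using continuous_on_product_coordinates[where i=q] continuous_on_eq_continuous_at[OF open_UNIV] by fast
    from isCont_tendsto_compose[OF this r(2)] show ?thesis by (simp add: o_def)
  qed
  have "convergent (\<lambda>n. f (r n) x)" for x
  proof (rule Cauchy_convergent, rule metric_CauchyI)
    fix e :: real assume e: "e > 0"
    define d where "d = e / 3 / (\<bar>L\<bar> + 1)"
    have d: "d > 0" using e by (simp add: d_def)
    obtain q where "x - d < of_rat q" "of_rat q < x + d" using of_rat_dense[of "x - d" "x + d"] d by auto
    then have q: "\<bar>x - of_rat q\<bar> < d" by auto
    have "\<bar>L\<bar> + 1 \<noteq> 0" by linarith
    then have Ld1: "(\<bar>L\<bar> + 1) * d = e / 3" unfolding d_def by (metis nonzero_mult_div_cancel_left times_divide_eq_right)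
    have "L * \<bar>x - of_rat q\<bar> \<le> \<bar>L\<bar> * d" using q by (intro mult_mono) auto
    also have "\<dots> < (\<bar>L\<bar> + 1) * d" using d by simp
    also have "\<dots> = e / 3" by (rule Ld1)
    finally have Ld: "L * \<bar>x - of_rat q\<bar> < e / 3" .
    have "Cauchy (\<lambda>n. f (r n) (of_rat q))" using coord[of q] LIMSEQ_imp_Cauchy by blast
    then obtain N where N: "\<And>m n. m \<ge> N \<Longrightarrow> n \<ge> N \<Longrightarrow> dist (f (r m) (of_rat q)) (f (r n) (of_rat q)) < e / 3"
      using metric_CauchyD[of _ "e / 3"] e by (metis divide_pos_pos zero_less_numeral)
    show "\<exists>M. \<forall>m\<ge>M. \<forall>n\<ge>M. dist (f (r m) x) (f (r n) x) < e"
    proof (intro exI allI impI)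
      fix m n assume mn: "N \<le> m" "N \<le> n"
      have "dist (f (r m) x) (f (r n) x) \<le> dist (f (r m) x) (f (r m) (of_rat q)) + dist (f (r m) (of_rat q)) (f (r n) (of_rat q))
         + dist (f (r n) (of_rat q)) (f (r n) x)"
        by (smt (verit) dist_triangle)
      also have "\<dots> < e / 3 + e / 3 + e / 3"
        using N[OF mn] lip[of "r m" x "of_rat q"] lip[of "r n" "of_rat q" x] Ld by (simp add: abs_minus_commute)
      finally show "dist (f (r m) x) (f (r n) x) < e" by simp
    qed
  qed
  then show thesis using that[OF r(1)] unfolding convergent_def by metis
qed

lemma pickands_lipschitz:
  assumes A: "A \<in> pickands" and "s \<in> {0..1}" "t \<in> {0..1}"
  shows "\<bar>A s - A t\<bar> \<le> \<bar>s - t\<bar>"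
proof -
  have *: "\<bar>A t - A s\<bar> \<le> t - s" if "0 \<le> s" "s < t" "t \<le> 1" for s t
  proof -
    note c = convex_on_chord_mono[OF pickandsD(1)[OF A]]
    have "(A t - A s) / (t - s) \<le> (A 1 - A s) / (1 - s)" by (rule c) (use that in auto)
    also have "\<dots> \<le> 1" using pickandsD(2)[OF A, of s] pickandsD(6)[OF A] that by simp
    finally have up: "A t - A s \<le> t - s" using that by (simp add: divide_le_eq)
    have "- 1 \<le> (A t - A 0) / (t - 0)" using pickandsD(3)[OF A, of t] pickandsD(5)[OF A] that by (simp add: le_divide_eq)
    also have "\<dots> \<le> (A t - A s) / (t - s)" by (rule c) (use that in auto)
    finally have "- (t - s) \<le> A t - A s" using that by (simp add: le_divide_eq)
    with up show ?thesis by auto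
  qed
  show ?thesis using *[of s t] *[of t s] assms by (cases s t rule: linorder_cases) auto
qed

text \<open>
  Convexity and \<open>\<psi> 0 = 1\<close> give \<open>\<psi> p - \<psi> q \<le> 1 - p / q \<le> ln q - ln p\<close> for \<open>p < q\<close>: on the
  logarithmic scale generators are equicontinuous, however steep they are at \<open>0\<close>.
\<close>
lemma generator_exp_lipschitz:
  assumes \<psi>: "\<psi> \<in> generators"
  shows "\<bar>\<psi> (exp a) - \<psi> (exp b)\<bar> \<le> \<bar>a - b\<bar>"
proof -
  note g = generatorsD[OF \<psi>]
  have *: "\<bar>\<psi> (exp a) - \<psi> (exp b)\<bar> \<le> b - a" if ab: "a < b" for a b
  proof -
    define t where "t = exp (a - b)"
    have t: "0 \<le> t" "t \<le> 1" using ab by (auto simp: t_def)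
    have "exp a = (1 - t) * 0 + t * exp b" by (simp add: t_def flip: exp_add)
    then have "\<psi> (exp a) \<le> (1 - t) * \<psi> 0 + t * \<psi> (exp b)"
      using convex_onD[OF g(3) t, of 0 "exp b"] by simp
    then have "\<psi> (exp a) - \<psi> (exp b) \<le> (1 - t) * (1 - \<psi> (exp b))" by (simp add: g(4) algebra_simps)
    also have "\<dots> \<le> 1 - t" using t g(7)[of "exp b"] by (simp add: mult_left_le)
    also have "\<dots> \<le> b - a" using exp_ge_add_one_self[of "a - b"] unfolding t_def by linarith
    finally show ?thesis using monotone_onD[OF g(2), of "exp a" "exp b"] ab by simp
  qed
  show ?thesis using *[of a b] *[of b a] by (cases a b rule: linorder_cases) auto
qed

text \<open>
  Both functions are packed into one sequence of plane-valued Lipschitz functions, so that a single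
  subsequence serves them both.
\<close>
lemma archimax_components_subsequence:
  assumes \<psi>s: "\<And>n. \<psi>s n \<in> generators" and As: "\<And>n. As n \<in> pickands"
  obtains r \<psi> A where "strict_mono (r :: nat \<Rightarrow> nat)" "\<And>z. z \<ge> 0 \<Longrightarrow> (\<lambda>n. \<psi>s (r n) z) \<longlonglongrightarrow> \<psi> z"
    "\<And>t. t \<in> {0..1} \<Longrightarrow> (\<lambda>n. As (r n) t) \<longlonglongrightarrow> A t" "\<psi> \<in> extensional {0..}" "A \<in> extensional {0..1}"
proof -
  \<comment> \<open>Clamping extends the Pickands functions to the whole line.\<close>
  define f where "f n x = (\<psi>s n (exp x), As n (unit_clamp x))" for n x
  have range: "f n x \<in> {0..1} \<times> {0..1}" for n x
    using generatorsD(7,8)[OF \<psi>s[of n], of "exp x"] pickandsD(2,4)[OF As[of n], of "unit_clamp x"] unit_clamp(1)[of x]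
    by (auto simp: f_def)
  have lip: "dist (f n x) (f n y) \<le> 2 * \<bar>x - y\<bar>" for n x y
  proof -
    have "dist (f n x) (f n y) \<le> \<bar>\<psi>s n (exp x) - \<psi>s n (exp y)\<bar> + \<bar>As n (unit_clamp x) - As n (unit_clamp y)\<bar>"
      unfolding f_def dist_Pair_Pair dist_real_def using sqrt_sum_squares_le_sum_abs[of "\<psi>s n (exp x) - \<psi>s n (exp y)"] by simp
    also have "\<dots> \<le> \<bar>x - y\<bar> + \<bar>x - y\<bar>"
      using pickands_lipschitz[OF As[of n] unit_clamp(1) unit_clamp(1), of x y] unit_clamp_lipschitz[of x y]
      by (intro add_mono generator_exp_lipschitz[OF \<psi>s]) auto
    finally show ?thesis by simp
  qed
  have "compact ({0..1::real} \<times> {0..1::real})" by (intro compact_Times) auto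
  then obtain r l where r: "strict_mono r" "\<And>x. (\<lambda>n. f (r n) x) \<longlonglongrightarrow> l x"
    using lipschitz_convergent_subsequence[where f=f, OF _ range lip] by blast
  show thesis
  proof (rule that[OF r(1)])
    show "(\<lambda>n. \<psi>s (r n) z) \<longlonglongrightarrow> (\<lambda>z\<in>{0..}. if z = 0 then 1 else fst (l (ln z))) z" if "z \<ge> 0" for z
      using tendsto_fst[OF r(2)[of "ln z"]] that generatorsD(4)[OF \<psi>s] by (cases "z = 0") (auto simp: f_def)
    show "(\<lambda>n. As (r n) t) \<longlonglongrightarrow> (\<lambda>t\<in>{0..1}. snd (l t)) t" if "t \<in> {0..1}" for t
      using tendsto_snd[OF r(2)[of t]] that unit_clamp(2)[of t] by (auto simp: f_def)
  qed (rule restrict_extensional)+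
qed

lemma pickands_limit:
  assumes As: "\<And>n. As n \<in> pickands" and lim: "\<And>t. t \<in> {0..1} \<Longrightarrow> (\<lambda>n. As n t) \<longlonglongrightarrow> A t" and ext: "A \<in> extensional {0..1}"
  shows "A \<in> pickands"
proof -
  have b: "t \<le> A t" "1 - t \<le> A t" "A t \<le> 1" if "0 \<le> t" "t \<le> 1" for t
    using LIMSEQ_le_const[OF lim[of t]] LIMSEQ_le_const2[OF lim[of t]] pickandsD(2-4)[OF As that] that by auto
  have "convex_on {0..1} A"
  proof (rule convex_onI)
    fix t x y :: real assume *: "0 < t" "t < 1" "x \<in> {0..1}" "y \<in> {0..1}"
    have m: "(1 - t) *\<^sub>R x + t *\<^sub>R y \<in> {0..1}"
      using * convexD_alt[OF convex_real_interval(5)[of 0 1], of x y t] by simp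
    have "As n ((1 - t) *\<^sub>R x + t *\<^sub>R y) \<le> (1 - t) * As n x + t * As n y" for n
      by (rule convex_onD[OF pickandsD(1)[OF As]]) (use * in auto)
    moreover have "(\<lambda>n. (1 - t) * As n x + t * As n y) \<longlonglongrightarrow> (1 - t) * A x + t * A y"
      using * by (intro tendsto_intros lim) auto
    ultimately show "A ((1 - t) *\<^sub>R x + t *\<^sub>R y) \<le> (1 - t) * A x + t * A y"
      using LIMSEQ_le[OF lim[OF m]] by blast
  qed simp
  moreover have "A t \<ge> 0" if "0 \<le> t" "t \<le> 1" for t using b[OF that] that by linarith
  ultimately show ?thesis using b ext by (auto simp: pickands_def PiE_iff)
qed

text \<open>
  Everything passes to the limit except continuity at \<open>0\<close> and decay to \<open>0\<close>.  The inequality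
  \<open>\<psi>\<^sub>n (2 z) \<le> C\<^sub>n (\<psi>\<^sub>n z, \<psi>\<^sub>n z)\<close> survives the limit; applied at \<open>z = 2\<^sup>n\<close> and \<open>z = 2\<^sup>-\<^sup>n\<close>, it makes the
  limits of \<open>\<psi>\<close> at infinity and at \<open>0\<close> fixed points of the diagonal of \<open>C\<close>.  The normalization
  \<open>\<psi> 1 = 1/2\<close> decides which of the fixed points \<open>0\<close> and \<open>1\<close> it is.
\<close>
lemma generator_limit:
  assumes \<psi>s: "\<And>n. \<psi>s n \<in> generators" and As: "\<And>n. As n \<in> pickands"
    and lim: "\<And>z. z \<ge> 0 \<Longrightarrow> (\<lambda>n. \<psi>s n z) \<longlonglongrightarrow> \<psi> z" and ext: "\<psi> \<in> extensional {0..}"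
    and C: "C \<in> copulas" and diag: "\<And>x. 0 < x \<Longrightarrow> x < 1 \<Longrightarrow> C (x, x) < x"
    and limC: "\<And>x. 0 < x \<Longrightarrow> x < 1 \<Longrightarrow> (\<lambda>n. archimax (\<psi>s n) (As n) (x, x)) \<longlonglongrightarrow> C (x, x)"
  shows "\<psi> \<in> generators"
proof -
  note g = generatorsD[OF \<psi>s]
  have b: "0 \<le> \<psi> z" "\<psi> z \<le> 1" if "z \<ge> 0" for z
    using LIMSEQ_le_const[OF lim[OF that]] LIMSEQ_le_const2[OF lim[OF that]] g(7,8) that by auto
  have val: "\<psi> 0 = 1" "\<psi> 1 = 1 / 2"
    using LIMSEQ_unique[OF lim[of 0], of 1] LIMSEQ_unique[OF lim[of 1], of "1 / 2"] by (simp_all add: g)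
  have anti: "\<psi> y \<le> \<psi> x" if "0 \<le> x" "x \<le> y" for x y
    by (rule LIMSEQ_le[OF lim lim]) (use that in \<open>auto intro!: monotone_onD[OF g(2)]\<close>)
  have cvx: "convex_on {0..} \<psi>"
  proof (rule convex_onI)
    fix t x y :: real assume *: "0 < t" "t < 1" "x \<in> {0..}" "y \<in> {0..}"
    have m: "(1 - t) *\<^sub>R x + t *\<^sub>R y \<ge> 0" using * by simp
    have "\<psi>s n ((1 - t) *\<^sub>R x + t *\<^sub>R y) \<le> (1 - t) * \<psi>s n x + t * \<psi>s n y" for n
      by (rule convex_onD[OF g(3)]) (use * in auto)
    moreover have "(\<lambda>n. (1 - t) * \<psi>s n x + t * \<psi>s n y) \<longlonglongrightarrow> (1 - t) * \<psi> x + t * \<psi> y"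
      using * by (intro tendsto_intros lim) auto
    ultimately show "\<psi> ((1 - t) *\<^sub>R x + t *\<^sub>R y) \<le> (1 - t) * \<psi> x + t * \<psi> y"
      using LIMSEQ_le[OF lim[OF m]] by blast
  qed simp
  have double: "\<psi> (2 * z) \<le> C (\<psi> z, \<psi> z)" if z: "z > 0" "0 < \<psi> z" "\<psi> z < 1" for z
  proof (rule LIMSEQ_le)
    have xs: "(\<lambda>n. \<psi>s n z) \<longlonglongrightarrow> \<psi> z" using lim z by simp
    let ?C = "\<lambda>n. archimax (\<psi>s n) (As n)"
    have "(\<lambda>n. \<bar>\<psi>s n z - \<psi> z\<bar>) \<longlonglongrightarrow> 0" using xs by (simp add: LIM_zero_iff tendsto_rabs_zero_iff)
    then have lim2: "(\<lambda>n. 2 * \<bar>\<psi>s n z - \<psi> z\<bar>) \<longlonglongrightarrow> 0" by (rule tendsto_mult_right_zero)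
    have bd: "\<bar>?C n (\<psi>s n z, \<psi>s n z) - ?C n (\<psi> z, \<psi> z)\<bar> \<le> 2 * \<bar>\<psi>s n z - \<psi> z\<bar>" for n
      using copula_lipschitz[OF archimax_copula[OF \<psi>s[of n] As[of n]], of "\<psi>s n z" "\<psi> z" "\<psi>s n z" "\<psi> z"] b[of z] g(7,8)[of z n] z by simp
    have "(\<lambda>n. ?C n (\<psi>s n z, \<psi>s n z) - ?C n (\<psi> z, \<psi> z)) \<longlonglongrightarrow> 0"
      by (rule Lim_null_comparison[OF always_eventually lim2]) (intro allI, unfold real_norm_def, rule bd)
    from tendsto_add[OF this limC[OF z(2,3)]]
    show "(\<lambda>n. ?C n (\<psi>s n z, \<psi>s n z)) \<longlonglongrightarrow> C (\<psi> z, \<psi> z)" by simp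
    show "(\<lambda>n. \<psi>s n (2 * z)) \<longlonglongrightarrow> \<psi> (2 * z)" using lim z by simp
    have "eventually (\<lambda>n. \<psi>s n (2 * z) \<le> ?C n (\<psi>s n z, \<psi>s n z)) sequentially"
      using order_tendstoD(1)[OF xs z(2)] order_tendstoD(2)[OF xs z(3)]
    proof eventually_elim
      case (elim n)
      have inv: "gen_inv (\<psi>s n) (\<psi>s n z) = z" using elim z by (intro gen_inv_unique[OF \<psi>s]) auto
      have "\<psi>s n (2 * z) \<le> \<psi>s n (stable_tail (As n) z z)"
        using stable_tail_bounds[OF As[of n], of z z] z by (intro monotone_onD[OF g(2)]) auto
      then show ?case using archimax_interior[of "\<psi>s n z" "\<psi>s n z"] elim inv by simp
    qed
    then show "\<exists>N. \<forall>n\<ge>N. \<psi>s n (2 * z) \<le> ?C n (\<psi>s n z, \<psi>s n z)" by (simp add: eventually_sequentially)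
  qed
  have fixpoint: "c = 0 \<or> c = 1"
    if zs: "\<And>n. zs n > 0" "(\<lambda>n. \<psi> (zs n)) \<longlonglongrightarrow> c" "(\<lambda>n. \<psi> (2 * zs n)) \<longlonglongrightarrow> c" for zs c
  proof (rule ccontr)
    assume "\<not> (c = 0 \<or> c = 1)"
    moreover have "0 \<le> c" "c \<le> 1"
      using LIMSEQ_le_const[OF zs(2)] LIMSEQ_le_const2[OF zs(2)] b less_imp_le[OF zs(1)] by blast+
    ultimately have c: "0 < c" "c < 1" by auto
    have "(\<lambda>n. \<bar>\<psi> (zs n) - c\<bar>) \<longlonglongrightarrow> 0" using zs(2) by (simp add: LIM_zero_iff tendsto_rabs_zero_iff)
    from tendsto_add[OF tendsto_const tendsto_mult[OF tendsto_const this], of "C (c, c)" 2]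
    have "(\<lambda>n. C (c, c) + 2 * \<bar>\<psi> (zs n) - c\<bar>) \<longlonglongrightarrow> C (c, c)" by simp
    moreover have "eventually (\<lambda>n. \<psi> (2 * zs n) \<le> C (c, c) + 2 * \<bar>\<psi> (zs n) - c\<bar>) sequentially"
      using order_tendstoD(1)[OF zs(2) c(1)] order_tendstoD(2)[OF zs(2) c(2)]
    proof eventually_elim
      case (elim n)
      have "\<bar>C (\<psi> (zs n), \<psi> (zs n)) - C (c, c)\<bar> \<le> 2 * \<bar>\<psi> (zs n) - c\<bar>"
        using copula_lipschitz[OF C, of "\<psi> (zs n)" c "\<psi> (zs n)" c] elim c by simp
      then show ?case using double[OF zs(1) elim] by linarith
    qed
    ultimately have "c \<le> C (c, c)"
      using zs(3) by (intro LIMSEQ_le[of "\<lambda>n. \<psi> (2 * zs n)"]) (auto simp: eventually_sequentially)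
    then show False using diag[OF c] by simp
  qed
  have up: "(\<lambda>n. \<psi> (2 ^ n)) \<longlonglongrightarrow> 0"
  proof -
    have "decseq (\<lambda>n. \<psi> (2 ^ n))" by (auto simp: decseq_def intro!: anti power_increasing)
    then obtain c where c: "(\<lambda>n. \<psi> (2 ^ n)) \<longlonglongrightarrow> c"
      using decseq_convergent[of "\<lambda>n. \<psi> (2 ^ n)" 0] b by (metis zero_le_numeral zero_le_power)
    have "c \<le> 1 / 2" using c by (rule LIMSEQ_le_const2) (use anti[of 1 "2 ^ _"] val in auto)
    moreover have "c = 0 \<or> c = 1"
      using LIMSEQ_Suc[OF c] by (intro fixpoint[OF _ c]) auto
    ultimately show ?thesis using c by auto
  qed
  have down: "(\<lambda>n. \<psi> ((1 / 2) ^ n)) \<longlonglongrightarrow> 1"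
  proof -
    have "incseq (\<lambda>n. \<psi> ((1 / 2) ^ n))" by (auto simp: incseq_def intro!: anti power_decreasing)
    then obtain c where c: "(\<lambda>n. \<psi> ((1 / 2) ^ n)) \<longlonglongrightarrow> c"
      using incseq_convergent[of "\<lambda>n. \<psi> ((1 / 2) ^ n)" 1] b by (metis zero_le_divide_1_iff zero_le_numeral zero_le_power)
    have "c \<ge> 1 / 2" using c by (rule LIMSEQ_le_const) (use anti[of "(1 / 2) ^ _" 1] val in \<open>auto simp: power_le_one\<close>)
    moreover have "c = 0 \<or> c = 1"
      using LIMSEQ_Suc[OF c] c by (intro fixpoint[of "\<lambda>n. (1 / 2) ^ Suc n"]) auto
    ultimately show ?thesis using c by auto
  qed
  have vanish: "(\<psi> \<longlongrightarrow> 0) at_top"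
  proof (rule order_tendstoI)
    fix a :: real assume "a < 0"
    then show "\<forall>\<^sub>F z in at_top. a < \<psi> z" using b by (auto simp: eventually_at_top_linorder intro!: exI[of _ 0] intro: less_le_trans)
  next
    fix a :: real assume "0 < a"
    then obtain n where "\<psi> (2 ^ n) < a" using order_tendstoD(2)[OF up] by (auto simp: eventually_sequentially)
    then show "\<forall>\<^sub>F z in at_top. \<psi> z < a"
      using anti[of "2 ^ n"] by (auto simp: eventually_at_top_linorder intro!: exI[of _ "2 ^ n"] intro: le_less_trans)
  qed
  have cont: "continuous_on {0..} \<psi>"
    unfolding continuous_on_eq_continuous_within
  proof
    fix z :: real assume "z \<in> {0..}"
    then consider "z = 0" | "z > 0" by fastforce
    then show "continuous (at z within {0..}) \<psi>"
    proof cases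
      case 1
      show ?thesis unfolding continuous_within 1 val(1)
      proof (rule order_tendstoI)
        fix a :: real assume "1 < a"
        then show "\<forall>\<^sub>F w in at 0 within {0..}. \<psi> w < a" using b by (auto simp: eventually_at_filter intro!: always_eventually intro: le_less_trans)
      next
        fix a :: real assume "a < 1"
        then obtain n where n: "\<psi> ((1 / 2) ^ n) > a" using order_tendstoD(1)[OF down] by (auto simp: eventually_sequentially)
        show "\<forall>\<^sub>F w in at 0 within {0..}. a < \<psi> w"
          unfolding eventually_at
        proof (intro exI[of _ "(1 / 2) ^ n"] conjI ballI impI)
          fix w :: real assume "w \<in> {0..}" "w \<noteq> 0 \<and> dist w 0 < (1 / 2) ^ n"
          then show "a < \<psi> w" using anti[of w "(1 / 2) ^ n"] n by auto
        qed simp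
      qed
    next
      case 2
      have "continuous_on {0<..} \<psi>"
        by (rule convex_on_continuous) (auto intro: convex_on_subset[OF cvx])
      then have "isCont \<psi> z" using 2 by (simp add: continuous_on_eq_continuous_at)
      then show ?thesis by (rule continuous_at_imp_continuous_at_within)
    qed
  qed
  have "strict_antimono_on {z. 0 \<le> z \<and> ennreal z < Inf (ennreal ` {x. 0 \<le> x \<and> \<psi> x = 0})} \<psi>"
  proof (rule monotone_onI)
    fix x y :: real
    assume x: "x \<in> {z. 0 \<le> z \<and> ennreal z < Inf (ennreal ` {x. 0 \<le> x \<and> \<psi> x = 0})}" and "x < y"
    have "\<psi> x \<noteq> 0"
    proof
      assume "\<psi> x = 0"
      then have "Inf (ennreal ` {x. 0 \<le> x \<and> \<psi> x = 0}) \<le> ennreal x" using x by (intro Inf_lower) auto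
      then show False using x by auto
    qed
    then show "\<psi> y < \<psi> x"
      using convex_vanishing_strict_decreasing[OF cvx _ vanish _ \<open>x < y\<close>] anti b[of x] x by (auto simp: monotone_on_def)
  qed
  then show ?thesis
    using b ext cont cvx val vanish anti by (auto simp: generators_def PiE_iff monotone_on_def)
qed

text \<open>
  Argue by contradiction along a subsequence on which \<open>\<eta>\<close> stays away from \<open>\<eta> C\<close>.  The limit
  components \<open>\<theta>\<close> and \<open>B\<close> of a further subsequence may differ from \<open>\<psi>\<close> and \<open>A\<close>, but they generate the
  same copula, and this is all that \<open>\<eta>\<close> sees.
\<close>
theorem archimax_dependence_limit:
  fixes \<eta> :: "(real \<times> real \<Rightarrow> real) \<Rightarrow> real"
  assumes \<eta>: "weak_cond_continuous \<eta>"
    and \<psi>: "\<psi> \<in> generators" and \<psi>s: "\<And>n. \<psi>s n \<in> generators"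
    and A: "A \<in> pickands" "A \<noteq> pickands_M" and As: "\<And>n. As n \<in> pickands"
    and lim: "\<And>x y. 0 < x \<Longrightarrow> x < 1 \<Longrightarrow> 0 < y \<Longrightarrow> y < 1 \<Longrightarrow>
      (\<lambda>n. archimax (\<psi>s n) (As n) (x, y)) \<longlonglongrightarrow> archimax \<psi> A (x, y)"
  shows "(\<lambda>n. \<eta> (archimax (\<psi>s n) (As n))) \<longlonglongrightarrow> \<eta> (archimax \<psi> A)"
proof (rule ccontr)
  let ?C = "\<lambda>n. archimax (\<psi>s n) (As n)"
  assume "\<not> ?thesis"
  then obtain e where e: "e > 0" "\<not> eventually (\<lambda>n. dist (\<eta> (?C n)) (\<eta> (archimax \<psi> A)) < e) sequentially"
    by (auto simp: tendsto_iff)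
  then have inf_far: "\<exists>\<^sub>\<infinity>n. \<not> dist (\<eta> (?C n)) (\<eta> (archimax \<psi> A)) < e"
    by (simp add: not_eventually cofinite_eq_sequentially)
  define S where "S = {n. \<not> dist (\<eta> (?C n)) (\<eta> (archimax \<psi> A)) < e}"
  have "infinite S" using inf_far by (simp add: S_def INFM_iff_infinite)
  then obtain q :: "nat \<Rightarrow> nat" where q: "strict_mono q" "\<And>n. q n \<in> S" using infinite_enumerate[of S] by blast
  obtain r \<theta> B where r: "strict_mono r" "\<And>z. z \<ge> 0 \<Longrightarrow> (\<lambda>n. \<psi>s (q (r n)) z) \<longlonglongrightarrow> \<theta> z"
    "\<And>t. t \<in> {0..1} \<Longrightarrow> (\<lambda>n. As (q (r n)) t) \<longlonglongrightarrow> B t" "\<theta> \<in> extensional {0..}" "B \<in> extensional {0..1}"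
    using archimax_components_subsequence[of "\<lambda>n. \<psi>s (q n)" "\<lambda>n. As (q n)", OF \<psi>s As] by blast
  have qr: "strict_mono (\<lambda>n. q (r n))" using strict_mono_o[OF q(1) r(1)] by (simp add: o_def)
  have sub: "(\<lambda>n. ?C (q (r n)) (x, y)) \<longlonglongrightarrow> archimax \<psi> A (x, y)" if "0 < x" "x < 1" "0 < y" "y < 1" for x y
    using LIMSEQ_subseq_LIMSEQ[OF lim[OF that] qr] by (simp add: o_def)
  have B: "B \<in> pickands" by (rule pickands_limit[OF As r(3,5)])
  have \<theta>: "\<theta> \<in> generators"
    by (rule generator_limit[where C="archimax \<psi> A" and \<psi>s="\<lambda>n. \<psi>s (q (r n))" and As="\<lambda>n. As (q (r n))"])
       (use \<psi>s As r archimax_copula[OF \<psi> A(1)] archimax_diagonal[OF \<psi> A] sub in auto)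
  have "archimax \<theta> B (x, y) = archimax \<psi> A (x, y)" if xy: "0 < x" "x < 1" "0 < y" "y < 1" for x y
    using archimax_limit(2)[of "\<lambda>n. \<psi>s (q (r n))" \<theta> "\<lambda>n. As (q (r n))" B, OF \<psi>s \<theta> As B r(2)[OF less_imp_le] r(3) xy] sub[OF xy]
    by (rule LIMSEQ_unique)
  then have "continuous_extension (archimax \<theta> B) = continuous_extension (archimax \<psi> A)"
    by (intro continuous_extension_cong) auto
  then have eq: "archimax \<theta> B = archimax \<psi> A" by (simp flip: archimax_extension)
  have "weak_cond_conv (\<lambda>n. ?C (q (r n))) (archimax \<psi> A)"
    using archimax_weak_cond_conv[of "\<lambda>n. \<psi>s (q (r n))" \<theta> "\<lambda>n. As (q (r n))" B, OF \<psi>s \<theta> As B r(2)[OF less_imp_le] r(3)] eq by simp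
  then have "(\<lambda>n. \<eta> (?C (q (r n)))) \<longlonglongrightarrow> \<eta> (archimax \<psi> A)"
    by (intro \<eta>[unfolded weak_cond_continuous_def, rule_format] archimax_copula \<psi>s As \<psi> A(1))
  then have "eventually (\<lambda>n. dist (\<eta> (?C (q (r n)))) (\<eta> (archimax \<psi> A)) < e) sequentially"
    using e(1) by (rule tendstoD)
  then show False using q(2) by (simp add: S_def)
qed

section \<open>Convergence of the rescaled generators and Pickands functions\<close>

text \<open>
  With \<open>f = generator_power \<alpha> \<psi>\<close>, its inverse \<open>U\<close> and the homogeneous extension \<open>G\<close> of
  \<open>pickands_power \<alpha> A\<close>, the Archimax copula is \<open>f (G (U x) (U y))\<close> again.  Each of the three
  ingredients converges, also along moving arguments.
\<close>
lemma archimax_limit_of_powers: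
  assumes \<psi>s: "\<And>n. \<psi>s n \<in> generators" and \<psi>: "\<psi> \<in> generators"
    and As: "\<And>n. As n \<in> pickands" and A: "A \<in> pickands"
    and \<alpha>s: "\<And>n. \<alpha>s n > 0" and \<alpha>: "\<alpha> > 0"
    and lim\<psi>: "\<And>z. z \<ge> 0 \<Longrightarrow> (\<lambda>n. generator_power (\<alpha>s n) (\<psi>s n) z) \<longlonglongrightarrow> generator_power \<alpha> \<psi> z"
    and limA: "\<And>t. t \<in> {0..1} \<Longrightarrow> (\<lambda>n. pickands_power (\<alpha>s n) (As n) t) \<longlonglongrightarrow> pickands_power \<alpha> A t"
    and xy: "0 < x" "x < 1" "0 < y" "y < 1"
  shows "(\<lambda>n. archimax (\<psi>s n) (As n) (x, y)) \<longlonglongrightarrow> archimax \<psi> A (x, y)"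
proof -
  define f where "f a \<theta> z = \<theta> (z powr a)" for a :: real and \<theta> :: "real \<Rightarrow> real" and z :: real
  define U where "U a \<theta> x = gen_inv \<theta> x powr (1 / a)" for a \<theta> x
  \<comment> \<open>\<open>G\<close> is the homogeneous function with profile \<open>pickands_power a B\<close>; see \<open>G_eq\<close> below.\<close>
  define G where "G a B p q = stable_tail B (p powr a) (q powr a) powr (1 / a)" for a B p q
  have f_lim: "(\<lambda>n. f (\<alpha>s n) (\<psi>s n) z) \<longlonglongrightarrow> f \<alpha> \<psi> z" if "z > 0" for z
    using lim\<psi>[of z] that by (simp add: f_def generator_power_def)
  have f_anti: "antimono_on {0<..} (f a \<theta>)" if "\<theta> \<in> generators" "a > 0" for a \<theta>
    using that by (auto simp: f_def intro!: monotone_onI monotone_onD[OF generatorsD(2)[OF that(1)]] powr_mono2)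
  have U: "U a \<theta> x > 0" "U a \<theta> x powr a = gen_inv \<theta> x" "f a \<theta> (U a \<theta> x) = x"
    if "\<theta> \<in> generators" "a > 0" "0 < x" "x < 1" for a \<theta> x
    using gen_inv[OF that(1,3,4)] that(2) by (auto simp: U_def f_def powr_powr)
  have U_lim: "(\<lambda>n. U (\<alpha>s n) (\<psi>s n) x) \<longlonglongrightarrow> U \<alpha> \<psi> x" if x: "0 < x" "x < 1" for x
  proof (rule antimono_limit_inverse[OF f_anti[OF \<psi>s \<alpha>s] f_lim U(1)[OF \<psi> \<alpha> x] _ _ U(1)[OF \<psi>s \<alpha>s x]])
    let ?u = "gen_inv \<psi> x"
    note u = gen_inv[OF \<psi> x]
    show "f \<alpha> \<psi> (U \<alpha> \<psi> x) < f \<alpha> \<psi> z" if "0 < z" "z < U \<alpha> \<psi> x" for z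
    proof -
      have z: "z powr \<alpha> < ?u" using powr_less_mono2[OF \<alpha> _ that(2)] that(1) U(2)[OF \<psi> \<alpha> x] by simp
      then have "\<psi> ?u \<le> \<psi> (z powr \<alpha>)" using u by (intro monotone_onD[OF generatorsD(2)[OF \<psi>]]) auto
      then have "\<psi> ?u < \<psi> (z powr \<alpha>)" using u x by (intro generator_strict[OF \<psi> _ z]) auto
      then show ?thesis unfolding U(3)[OF \<psi> \<alpha> x] using u by (simp add: f_def)
    qed
    show "f \<alpha> \<psi> z < f \<alpha> \<psi> (U \<alpha> \<psi> x)" if "U \<alpha> \<psi> x < z" for z
    proof -
      have z: "?u < z powr \<alpha>" using powr_less_mono2[OF \<alpha> _ that] U(1,2)[OF \<psi> \<alpha> x] by simp
      have "\<psi> (z powr \<alpha>) < \<psi> ?u" using u x by (intro generator_strict[OF \<psi> _ z]) auto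
      then show ?thesis unfolding U(3)[OF \<psi> \<alpha> x] using u by (simp add: f_def)
    qed
    show "(\<lambda>n. f (\<alpha>s n) (\<psi>s n) (U (\<alpha>s n) (\<psi>s n) x)) \<longlonglongrightarrow> f \<alpha> \<psi> (U \<alpha> \<psi> x)"
      by (simp add: U(3) \<psi>s \<psi> \<alpha>s \<alpha> x)
  qed
  have st_pos: "stable_tail B p q > 0" if "B \<in> pickands" "p > 0" "q > 0" for B p q
    using stable_tail_bounds(1)[OF that(1), of p q] that by simp
  have G_eq: "G a B p q = (p + q) * pickands_power a B (p / (p + q))"
    if B: "B \<in> pickands" and a: "a > 0" and pq: "p > 0" "q > 0" for a B p q
  proof -
    define s where "s = p powr a + q powr a"
    have s: "s > 0" using pq by (simp add: s_def add_pos_pos)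
    have q1: "1 - p / (p + q) = q / (p + q)" using pq by (simp add: field_simps)
    have S: "(p / (p + q)) powr a + (1 - p / (p + q)) powr a = s / (p + q) powr a"
      unfolding q1 using pq by (simp add: powr_divide s_def add_divide_distrib)
    have R: "(p / (p + q)) powr a / (s / (p + q) powr a) = p powr a / s"
      using pq by (simp add: powr_divide)
    have t: "0 \<le> p powr a / s" "p powr a / s \<le> 1" using s by (auto simp: s_def)
    have nn: "B (p powr a / s) \<ge> 0" using pickandsD(2)[OF B t] t(1) by linarith
    have "p / (p + q) \<in> {0..1}" using pq by auto
    then have "pickands_power a B (p / (p + q)) = (s / (p + q) powr a) powr (1 / a) * B (p powr a / s) powr (1 / a)"
      by (simp only: pickands_power_def restrict_apply' S R)
    also have "(s / (p + q) powr a) powr (1 / a) = s powr (1 / a) / (p + q)"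
      using pq s a by (simp add: powr_divide powr_powr)
    finally show ?thesis
      using pq s nn by (simp add: G_def stable_tail_def powr_mult s_def[symmetric])
  qed
  let ?Us = "\<lambda>n. U (\<alpha>s n) (\<psi>s n) x" and ?Vs = "\<lambda>n. U (\<alpha>s n) (\<psi>s n) y"
  have G_lim: "(\<lambda>n. G (\<alpha>s n) (As n) (?Us n) (?Vs n)) \<longlonglongrightarrow> G \<alpha> A (U \<alpha> \<psi> x) (U \<alpha> \<psi> y)"
  proof (rule homogeneous_limit_moving_arguments[where f="\<lambda>n. G (\<alpha>s n) (As n)" and g="G \<alpha> A" and us="?Us" and vs="?Vs"])
    show "G (\<alpha>s n) (As n) a b \<le> G (\<alpha>s n) (As n) c d" if "0 < a" "a \<le> c" "0 < b" "b \<le> d" for n a b c d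
      unfolding G_def using that \<alpha>s[of n] st_pos[OF As[of n], of "a powr \<alpha>s n" "b powr \<alpha>s n"]
      by (intro powr_mono2 stable_tail_mono[OF As]) auto
    show "G (\<alpha>s n) (As n) (k * a) (k * b) = k * G (\<alpha>s n) (As n) a b" if "0 < a" "0 < b" "0 < k" for n a b k
      using that \<alpha>s[of n] st_pos[OF As[of n], of "a powr \<alpha>s n" "b powr \<alpha>s n"]
      by (simp add: G_def powr_mult stable_tail_homogeneous powr_powr)
    show "(\<lambda>n. G (\<alpha>s n) (As n) a b) \<longlonglongrightarrow> G \<alpha> A a b" if "0 < a" "0 < b" for a b
      using that by (simp add: G_eq As A \<alpha>s \<alpha>) (intro tendsto_intros limA, auto)
  qed (use U_lim U(1)[OF \<psi> \<alpha>] xy in auto)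
  have Gpow: "G a B (U a \<theta> x) (U a \<theta> y) > 0"
    "f a \<theta> (G a B (U a \<theta> x) (U a \<theta> y)) = archimax \<theta> B (x, y)"
    if "\<theta> \<in> generators" "B \<in> pickands" "a > 0" for a B \<theta>
  proof -
    note u = gen_inv(1)[OF that(1) xy(1,2)] gen_inv(1)[OF that(1) xy(3,4)]
    have "stable_tail B (gen_inv \<theta> x) (gen_inv \<theta> y) > 0" by (rule st_pos[OF that(2) u])
    then show "G a B (U a \<theta> x) (U a \<theta> y) > 0" "f a \<theta> (G a B (U a \<theta> x) (U a \<theta> y)) = archimax \<theta> B (x, y)"
      using that(3) by (auto simp: G_def f_def U(2)[OF that(1,3)] xy powr_powr archimax_interior)
  qed
  have "isCont (f \<alpha> \<psi>) z" if "z > 0" for z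
    unfolding f_def using that by (intro isCont_o2[OF _ generator_isCont[OF \<psi>]] continuous_intros) auto
  from antimono_limit_moving_argument[OF f_anti[OF \<psi>s \<alpha>s] f_lim Gpow(1)[OF \<psi> A \<alpha>] this[OF Gpow(1)[OF \<psi> A \<alpha>]] G_lim]
  show ?thesis by (simp add: Gpow(2) \<psi>s \<psi> As A \<alpha>s \<alpha>)
qed

theorem corollary5:
  fixes \<eta> :: "(real \<times> real \<Rightarrow> real) \<Rightarrow> real"
    and \<psi> A :: "real \<Rightarrow> real"
    and \<psi>s As :: "nat \<Rightarrow> real \<Rightarrow> real"
  assumes "dependence_measure \<eta>"
    and "weak_cond_continuous \<eta>"
    and "\<psi> \<in> generators" and "\<And>n. \<psi>s n \<in> generators"
    and "A \<in> pickands - {pickands_M}" and "\<And>n. As n \<in> pickands - {pickands_M}"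
  shows
    "((\<forall>z\<in>{0..}. (\<lambda>n. generator_power (1 - kendall_tau (ev_copula (As n))) (\<psi>s n) z)
          \<longlonglongrightarrow> generator_power (1 - kendall_tau (ev_copula A)) \<psi> z) \<longrightarrow>
      (\<forall>t\<in>{0..1}. (\<lambda>n. pickands_power (1 - kendall_tau (ev_copula (As n))) (As n) t)
          \<longlonglongrightarrow> pickands_power (1 - kendall_tau (ev_copula A)) A t) \<longrightarrow>
      (\<lambda>n. \<eta> (archimax (\<psi>s n) (As n))) \<longlonglongrightarrow> \<eta> (archimax \<psi> A))
     \<and>
     (uniform_limit unit_square (\<lambda>n. archimax (\<psi>s n) (As n)) (archimax \<psi> A) sequentially \<longrightarrow>
      (\<lambda>n. \<eta> (archimax (\<psi>s n) (As n))) \<longlonglongrightarrow> \<eta> (archimax \<psi> A))"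
proof (intro conjI impI)
  have A: "A \<in> pickands" "A \<noteq> pickands_M" and As: "\<And>n. As n \<in> pickands" "\<And>n. As n \<noteq> pickands_M"
    using assms(5,6) by auto
  note limit = archimax_dependence_limit[OF assms(2,3,4) A As(1)]
  {
    assume "\<forall>z\<in>{0..}. (\<lambda>n. generator_power (1 - kendall_tau (ev_copula (As n))) (\<psi>s n) z)
          \<longlonglongrightarrow> generator_power (1 - kendall_tau (ev_copula A)) \<psi> z"
      and "\<forall>t\<in>{0..1}. (\<lambda>n. pickands_power (1 - kendall_tau (ev_copula (As n))) (As n) t)
          \<longlonglongrightarrow> pickands_power (1 - kendall_tau (ev_copula A)) A t"
    then show "(\<lambda>n. \<eta> (archimax (\<psi>s n) (As n))) \<longlonglongrightarrow> \<eta> (archimax \<psi> A)"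
      using kendall_tau_ev_copula_less_one[OF A] kendall_tau_ev_copula_less_one[OF As]
      by (intro limit archimax_limit_of_powers[OF assms(4,3) As(1) A(1),
            where \<alpha>s="\<lambda>n. 1 - kendall_tau (ev_copula (As n))" and \<alpha>="1 - kendall_tau (ev_copula A)"]) auto
  next
    assume "uniform_limit unit_square (\<lambda>n. archimax (\<psi>s n) (As n)) (archimax \<psi> A) sequentially"
    then show "(\<lambda>n. \<eta> (archimax (\<psi>s n) (As n))) \<longlonglongrightarrow> \<eta> (archimax \<psi> A)"
      by (intro limit tendsto_uniform_limitI[where S=unit_square]) auto
  }
qed

end
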